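(* There exist $n_0, c_0 \in \mathbb{N}$ such that for every $n \ge n_0$ and every $\epsilon \ge c_0 \cdot \frac{1}{2^{\sqrt{\log n}}}$ (with $\epsilon \le 1$), there is a single-pass streaming algorithm that, on random order streams of length $n$ over a universe $U$ of size $\mathrm{poly}(n)$, uses $O(\log n/\epsilon)$ bits of space and, with probability at least $9/10$, outputs a set of elements that contains every $\ell_2$ $\epsilon$-heavy hitter of the stream and contains no element that is not an $\ell_2$ $(\epsilon/256)$-heavy hitter.
   Context: A stream is a sequence $x_1,\dots,x_n$ of elements of a universe $U$ with $|U| = \mathrm{poly}(n)$. Equivalently, it is given by a multiset $S$ of $n$ elements of $U$ together with a bijection $\Pi: S \to [n]$ assigning each element of $S$ a position. A random order stream is one where $S$ is arbitrary (adversarial) but $\Pi$ is a uniformly random bijection; the success probability is over this random order and the algorithm's internal randomness. For $i \in U$, $f_i$ denotes the number of occurrences of $i$ in the stream, and $\|S\|_2 = \sqrt{\sum_{i \in U} f_i^2}$ is the $\ell_2$ norm of the frequency vector. For $0 < \epsilon \le 1$, an element $x$ is an $\ell_2$ $\epsilon$-heavy hitter if $f_x^2 \ge \epsilon \|S\|_2^2$. The algorithm reads the stream once, in order, and the space bound refers to its working memory in bits. *)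

theory Defs
  imports
    "HOL-Probability.Probability"
    "HOL-Combinatorics.Permutations"
    "HOL-Library.Landau_Symbols"
begin

text \<open>
  A randomized single-pass streaming algorithm over items of type \<open>'u\<close>. Its entire working memory
  is a bit string. Each transition sees only the current memory and the current item, and may toss
  fresh coins. Everything that is needed later (a clock, a hash seed, earlier coin tosses) has to be
  stored in the memory and is therefore charged to the space.
\<close>

record 'u stream_alg =
  start :: "bool list pmf"
  update :: "'u \<Rightarrow> bool list \<Rightarrow> bool list pmf"
  report :: "bool list \<Rightarrow> 'u set pmf"

text \<open>
  The memory has a fixed width, so that no information can be hidden in the length of the string:
  an algorithm with space \<open>s\<close> has \<open>2 ^ s\<close> memory states.
\<close>

definition uses_space :: "'u set \<Rightarrow> 'u stream_alg \<Rightarrow> nat \<Rightarrow> bool" where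
  "uses_space U A s \<longleftrightarrow>
     set_pmf (start A) \<subseteq> {w. length w = s} \<and>
     (\<forall>x\<in>U. \<forall>w. length w = s \<longrightarrow> set_pmf (update A x w) \<subseteq> {w'. length w' = s})"

primrec process :: "'u stream_alg \<Rightarrow> 'u list \<Rightarrow> bool list \<Rightarrow> bool list pmf" where
  "process A [] w = return_pmf w"
| "process A (x # xs) w = bind_pmf (update A x w) (process A xs)"

definition answer :: "'u stream_alg \<Rightarrow> 'u list \<Rightarrow> 'u set pmf" where
  "answer A xs = bind_pmf (bind_pmf (start A) (process A xs)) (report A)"

text \<open>
  The multiset is given by an arbitrary listing \<open>xs\<close> of its elements, copies counted separately;
  the indices \<open>{..<length xs}\<close> name these copies, and a uniformly random bijection between copies
  and positions is a uniformly random permutation of the indices.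
\<close>

definition random_order :: "'u list \<Rightarrow> 'u list pmf" where
  "random_order xs =
     map_pmf (\<lambda>p. permute_list p xs) (pmf_of_set {p. p permutes {..<length xs}})"

definition l2_norm :: "'u set \<Rightarrow> 'u multiset \<Rightarrow> real" where
  "l2_norm U S = L2_set (\<lambda>i. real (count S i)) U"

definition heavy_hitters :: "'u set \<Rightarrow> real \<Rightarrow> 'u multiset \<Rightarrow> 'u set" where
  "heavy_hitters U \<epsilon> S = {x \<in> U. (real (count S x))\<^sup>2 \<ge> \<epsilon> * (l2_norm U S)\<^sup>2}"

end

theory Submission
  imports Defs "HOL-Library.List_Lexorder" "HOL-Real_Asymp.Real_Asymp"
begin

text \<open>
  A seed drawn from an arbitrarily large set can be replaced by one of \<open>O(log |U|^n)\<close> fixed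
  seeds, so public coins (random labels and hash functions) cost only \<open>O(log n)\<close> bits. Give every copy
  in the stream an independent random label. In a random order stream the labels may be read off in
  sorted order along the positions, so that the algorithm, by choosing labels, schedules which part
  of the copies takes part in which phase.

  One half of the copies feeds a constant-size AMS sketch, which yields an estimate of
  \<open>\<parallel>S\<parallel>\<^sub>2\<^sup>2\<close> up to a constant factor. The other half is divided into
  \<open>D \<approx> sqrt (log n)\<close> independent passes, each consisting of epochs. In an epoch the algorithm runs
  through \<open>L\<close> slots: in the first half of a slot it stores short random identifiers of a thinned
  sample of the copies whose item is hashed to this slot, in the second half it looks for a repetition.
  The thinning is such that a heavy hitter occurs a constant number of times in either half, as in the
  birthday paradox, while all the items together leave only \<open>O(D/\<epsilon>)\<close> identifiers in a slot. A repeated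
  item is loaded into a single register and counted exactly during the rest of the epoch. Light
  items fail this test, and each heavy hitter passes it in a given pass with probability at least
  \<open>1/2\<close>, hence in some pass with probability \<open>1 - 2 powr -D\<close>.

  The memory is dominated by \<open>O(D/\<epsilon>)\<close> identifiers of \<open>O(log (1/\<epsilon>) + log log n) = O(sqrt (log n))\<close> bits and
  by the \<open>O(1/\<epsilon>)\<close> reported items of \<open>O(log n)\<close> bits; the former is where
  \<open>\<epsilon> \<ge> 2 powr - sqrt (log n)\<close> is used.
\<close>

section \<open>Averages and probabilities over finite sets\<close>

text \<open>The register is the bottleneck: an item with its exact count costs O(log n) bits, so
  there is only one, and no other item may seize it during the epoch of a heavy hitter. The expected
  number of accidental matches of light items per pass is O(\<open>D^2/\<epsilon>\<close>); spread
  over at least as many epochs, they probably avoid a given one. Epochs must also be long: no light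
  item may reach the counting threshold in any pass or epoch, and a union bound over the whole
  universe needs counts of order log n. This fixes \<open>L\<close> at order log n. A heavy hitter
  may have as few as sqrt (\<open>\<epsilon> * n\<close>) copies, which limits \<open>Ep * L\<close>
  to about that number divided by \<open>D\<close>. Finally \<open>D\<close> exceeds log
  (1/\<epsilon>), because the probability of being missed in all passes has to survive a union bound
  over up to 1/\<epsilon> heavy hitters. The thinning rate and the counting threshold both depend on
  the unknown norm; this is why the sketch is completed before the passes begin. All coin spaces are
  finite and uniform, so probabilities are finite averages until the very end.\<close>

definition avg :: "'a set \<Rightarrow> ('a \<Rightarrow> real) \<Rightarrow> real" where
  "avg S f = (\<Sum>x\<in>S. f x) / real (card S)"

definition pr :: "'a set \<Rightarrow> ('a \<Rightarrow> bool) \<Rightarrow> real" where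
  "pr S P = avg S (\<lambda>x. of_bool (P x))"

lemma avg_mono: "(\<And>x. x \<in> S \<Longrightarrow> f x \<le> g x) \<Longrightarrow> avg S f \<le> avg S g"
  by (simp add: avg_def divide_right_mono sum_mono)

lemma avg_cong: "(\<And>x. x \<in> S \<Longrightarrow> f x = g x) \<Longrightarrow> avg S f = avg S g"
  by (simp add: avg_def)

lemma avg_add: "avg S (\<lambda>x. f x + g x) = avg S f + avg S g"
  by (simp add: avg_def sum.distrib add_divide_distrib)

lemma avg_diff: "avg S (\<lambda>x. f x - g x) = avg S f - avg S g"
  by (simp add: avg_def sum_subtractf diff_divide_distrib)

lemma avg_cmult: "avg S (\<lambda>x. c * f x) = c * avg S f"
  by (simp add: avg_def sum_distrib_left)

lemma avg_cmult_right: "avg S (\<lambda>x. f x * c) = avg S f * c"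
  by (simp add: avg_def sum_distrib_right)

lemma avg_const: "finite S \<Longrightarrow> S \<noteq> {} \<Longrightarrow> avg S (\<lambda>x. c) = c"
  by (simp add: avg_def)

lemma avg_zero [simp]: "avg S (\<lambda>x. 0) = 0"
  by (simp add: avg_def)

lemma avg_nonneg: "(\<And>x. x \<in> S \<Longrightarrow> 0 \<le> f x) \<Longrightarrow> 0 \<le> avg S f"
  by (simp add: avg_def sum_nonneg)

lemma avg_sum: "avg S (\<lambda>x. \<Sum>i\<in>I. f i x) = (\<Sum>i\<in>I. avg S (f i))"
  unfolding avg_def by (subst sum.swap) (simp add: sum_divide_distrib)

lemma avg_le_const: "finite S \<Longrightarrow> S \<noteq> {} \<Longrightarrow> (\<And>x. x \<in> S \<Longrightarrow> f x \<le> c) \<Longrightarrow> avg S f \<le> c"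
  using avg_mono[of S f "\<lambda>_. c"] by (simp add: avg_const)

lemma avg_Times: "avg (A \<times> B) f = avg A (\<lambda>a. avg B (\<lambda>b. f (a, b)))"
  by (simp add: avg_def card_cartesian_product sum.cartesian_product sum_divide_distrib
      flip: sum_divide_distrib)

lemma avg_bij:
  assumes "bij_betw h S T"
  shows "avg S (\<lambda>x. f (h x)) = avg T f"
  using assms by (simp add: avg_def sum.reindex_bij_betw bij_betw_same_card)

lemma avg_swap: "avg A (\<lambda>a. avg B (f a)) = avg B (\<lambda>b. avg A (\<lambda>a. f a b))"
proof -
  have "(\<Sum>x\<in>A. \<Sum>y\<in>B. f x y / real (card B)) / real (card A) =
        (\<Sum>y\<in>B. \<Sum>x\<in>A. f x y / real (card A)) / real (card B)"
    by (subst sum.swap) (simp add: sum_divide_distrib mult.commute)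
  then show ?thesis
    by (simp add: avg_def sum_divide_distrib)
qed

lemma pr_mono: "(\<And>x. x \<in> S \<Longrightarrow> P x \<Longrightarrow> Q x) \<Longrightarrow> pr S P \<le> pr S Q"
  unfolding pr_def by (rule avg_mono) auto

lemma pr_cong: "(\<And>x. x \<in> S \<Longrightarrow> P x = Q x) \<Longrightarrow> pr S P = pr S Q"
  unfolding pr_def by (rule avg_cong) auto

lemma pr_nonneg: "0 \<le> pr S P"
  unfolding pr_def by (rule avg_nonneg) auto

lemma pr_le_1: "pr S P \<le> 1"
proof (cases "finite S \<and> S \<noteq> {}")
  case True
  then show ?thesis
    unfolding pr_def by (intro avg_le_const) auto
qed (auto simp: pr_def avg_def)

lemma pr_disj: "pr S (\<lambda>x. P x \<or> Q x) \<le> pr S P + pr S Q"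
  unfolding pr_def avg_add[symmetric] by (rule avg_mono) auto

lemma pr_Bex:
  assumes "finite I"
  shows "pr S (\<lambda>x. \<exists>i\<in>I. P i x) \<le> (\<Sum>i\<in>I. pr S (P i))"
  unfolding pr_def avg_sum[symmetric]
proof (rule avg_mono)
  fix x
  show "of_bool (\<exists>i\<in>I. P i x) \<le> (\<Sum>i\<in>I. of_bool (P i x) :: real)"
  proof (cases "\<exists>i\<in>I. P i x")
    case True
    then obtain i where "i \<in> I" "P i x"
      by blast
    then show ?thesis
      using member_le_sum[of i I "\<lambda>i. of_bool (P i x) :: real"] assms by auto
  qed (auto intro!: sum_nonneg)
qed

lemma pr_Bex_le:
  assumes "finite I" "\<And>i. i \<in> I \<Longrightarrow> pr S (P i) \<le> c"
  shows "pr S (\<lambda>x. \<exists>i\<in>I. P i x) \<le> real (card I) * c"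
  using pr_Bex[OF assms(1), of S P] sum_bounded_above[of I "\<lambda>i. pr S (P i)" c] assms(2)
  by fastforce

lemma pr_Times: "pr (A \<times> B) P = avg A (\<lambda>a. pr B (\<lambda>b. P (a, b)))"
  by (simp add: pr_def avg_Times)

lemma pr_markov:
  assumes "\<And>x. x \<in> S \<Longrightarrow> 0 \<le> f x" "0 < c"
  shows "pr S (\<lambda>x. c \<le> f x) \<le> avg S f / c"
proof -
  have "pr S (\<lambda>x. c \<le> f x) \<le> avg S (\<lambda>x. f x / c)"
    unfolding pr_def using assms by (intro avg_mono) (auto simp: of_bool_def)
  then show ?thesis
    using avg_cmult_right[of S f "1 / c"] by simp
qed

lemma pr_mem: "finite S \<Longrightarrow> pr S (\<lambda>x. x \<in> A) = real (card (S \<inter> A)) / real (card S)"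
  by (simp add: pr_def avg_def of_bool_def sum.If_cases)

section \<open>Independent coordinates: product formulas, variances and Chebyshev's
  inequality\<close>

lemma avg_PiE_insert:
  assumes "i \<notin> I"
  shows "avg (PiE (insert i I) S) F = avg (S i) (\<lambda>a. avg (PiE I S) (\<lambda>\<omega>. F (fun_upd \<omega> i a)))"
proof -
  have "bij_betw (\<lambda>(y, g). fun_upd g i y) (S i \<times> PiE I S) (PiE (insert i I) S)"
    using inj_combinator[OF assms, of S] by (simp add: bij_betw_def PiE_insert_eq)
  from avg_bij[OF this, of F, symmetric] show ?thesis
    by (simp add: avg_Times case_prod_unfold)
qed

lemma avg_PiE_prod:
  assumes "finite I" "\<And>i. i \<in> I \<Longrightarrow> finite (S i) \<and> S i \<noteq> {}"
  shows "avg (PiE I S) (\<lambda>\<omega>. \<Prod>i\<in>I. f i (\<omega> i)) = (\<Prod>i\<in>I. avg (S i) (f i))"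
  using assms
proof (induction I)
  case empty
  then show ?case
    by (simp add: avg_def)
next
  case (insert i I)
  have "avg (PiE (insert i I) S) (\<lambda>\<omega>. \<Prod>j\<in>insert i I. f j (\<omega> j)) =
      avg (S i) (\<lambda>a. avg (PiE I S) (\<lambda>\<omega>. f i a * (\<Prod>j\<in>I. f j (\<omega> j))))"
    unfolding avg_PiE_insert[OF insert.hyps(2)]
    using insert.hyps by (intro avg_cong) (auto intro!: prod.cong)
  then show ?case
    using insert by (simp add: avg_cmult avg_cmult_right)
qed

lemma finite_PiE_nonempty:
  assumes "finite I" "\<And>i. i \<in> I \<Longrightarrow> finite (S i) \<and> S i \<noteq> {}"
  shows "finite (PiE I S)" "PiE I S \<noteq> {}"
  using assms by (auto intro!: finite_PiE simp: PiE_eq_empty_iff)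

lemma avg_PiE_split:
  assumes "i \<in> I"
  shows "avg (PiE I S) F = avg (S i) (\<lambda>a. avg (PiE (I - {i}) S) (\<lambda>\<omega>. F (fun_upd \<omega> i a)))"
  using avg_PiE_insert[of i "I - {i}" S F] assms by (simp add: insert_absorb)

lemma avg_PiE_1:
  assumes "finite I" "\<And>i. i \<in> I \<Longrightarrow> finite (S i) \<and> S i \<noteq> {}" "i \<in> I"
  shows "avg (PiE I S) (\<lambda>\<omega>. F (\<omega> i)) = avg (S i) F"
  using assms finite_PiE_nonempty[of "I - {i}" S]
  by (subst avg_PiE_split[of i]) (simp_all add: avg_const)

lemma avg_PiE_2:
  assumes "finite I" "\<And>i. i \<in> I \<Longrightarrow> finite (S i) \<and> S i \<noteq> {}" "i \<in> I" "j \<in> I" "i \<noteq> j"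
  shows "avg (PiE I S) (\<lambda>\<omega>. F (\<omega> i) (\<omega> j)) = avg (S i) (\<lambda>a. avg (S j) (F a))"
  using assms
  by (subst avg_PiE_split[of i])
    (auto intro!: avg_cong avg_PiE_1[of _ _ j "F a" for a, simplified])

lemma avg_PiE_3:
  assumes "finite I" "\<And>i. i \<in> I \<Longrightarrow> finite (S i) \<and> S i \<noteq> {}"
    "i \<in> I" "j \<in> I" "k \<in> I" "i \<noteq> j" "i \<noteq> k" "j \<noteq> k"
  shows "avg (PiE I S) (\<lambda>\<omega>. F (\<omega> i) (\<omega> j) (\<omega> k)) =
    avg (S i) (\<lambda>a. avg (S j) (\<lambda>b. avg (S k) (F a b)))"
  using assms
  by (subst avg_PiE_split[of i])
    (auto intro!: avg_cong avg_PiE_2[of _ _ j k "F a" for a, simplified])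

lemma avg_PiE_sum_zero:
  assumes "finite I" "\<And>i. i \<in> I \<Longrightarrow> finite (S i) \<and> S i \<noteq> {}"
    "\<And>i. i \<in> I \<Longrightarrow> avg (S i) (X i) = 0"
  shows "avg (PiE I S) (\<lambda>\<omega>. \<Sum>i\<in>I. X i (\<omega> i)) = 0"
  using assms by (simp add: avg_sum avg_PiE_1)

text \<open>Cross terms are products of independent centred variables and vanish, so variances
  add.\<close>

lemma avg_PiE_sum_sq:
  assumes "finite I" "\<And>i. i \<in> I \<Longrightarrow> finite (S i) \<and> S i \<noteq> {}"
    "\<And>i. i \<in> I \<Longrightarrow> avg (S i) (X i) = 0"
  shows "avg (PiE I S) (\<lambda>\<omega>. (\<Sum>i\<in>I. X i (\<omega> i))\<^sup>2) = (\<Sum>i\<in>I. avg (S i) (\<lambda>a. (X i a)\<^sup>2))"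
  using assms
proof (induction I)
  case empty
  then show ?case
    by (simp add: avg_def)
next
  case (insert i I)
  let ?R = "\<lambda>\<omega>. \<Sum>j\<in>I. X j (\<omega> j)"
  have R0: "avg (PiE I S) ?R = 0"
    using insert by (intro avg_PiE_sum_zero) auto
  have ne: "finite (PiE I S)" "PiE I S \<noteq> {}" "finite (S i)" "S i \<noteq> {}"
    using insert finite_PiE_nonempty[of I S] by auto
  have "avg (PiE (insert i I) S) (\<lambda>\<omega>. (\<Sum>j\<in>insert i I. X j (\<omega> j))\<^sup>2) =
      avg (S i) (\<lambda>a. avg (PiE I S) (\<lambda>\<omega>. (X i a)\<^sup>2 + (2 * X i a) * ?R \<omega> + (?R \<omega>)\<^sup>2))"
    unfolding avg_PiE_insert[OF insert.hyps(2)]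
  proof (intro avg_cong)
    fix a \<omega>
    have "(\<Sum>j\<in>I. X j (fun_upd \<omega> i a j)) = ?R \<omega>"
      using insert.hyps by (intro sum.cong) auto
    then show "(\<Sum>j\<in>insert i I. X j (fun_upd \<omega> i a j))\<^sup>2 = (X i a)\<^sup>2 + (2 * X i a) * ?R \<omega> + (?R \<omega>)\<^sup>2"
      using insert.hyps by (simp add: power2_eq_square algebra_simps)
  qed
  also have "\<dots> = avg (S i) (\<lambda>a. (X i a)\<^sup>2) + avg (PiE I S) (\<lambda>\<omega>. (?R \<omega>)\<^sup>2)"
    using ne by (simp add: avg_add avg_const avg_cmult R0)
  finally show ?case
    using insert by simp
qed

lemma pr_chebyshev:
  assumes "finite I" "\<And>i. i \<in> I \<Longrightarrow> finite (S i) \<and> S i \<noteq> {}"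
    "\<And>i. i \<in> I \<Longrightarrow> avg (S i) (X i) = 0" "0 < t"
    "\<And>i. i \<in> I \<Longrightarrow> avg (S i) (\<lambda>a. (X i a)\<^sup>2) \<le> v i"
  shows "pr (PiE I S) (\<lambda>\<omega>. t \<le> \<bar>\<Sum>i\<in>I. X i (\<omega> i)\<bar>) \<le> (\<Sum>i\<in>I. v i) / t\<^sup>2"
proof -
  have "pr (PiE I S) (\<lambda>\<omega>. t \<le> \<bar>\<Sum>i\<in>I. X i (\<omega> i)\<bar>) \<le>
      pr (PiE I S) (\<lambda>\<omega>. t\<^sup>2 \<le> (\<Sum>i\<in>I. X i (\<omega> i))\<^sup>2)"
  proof (rule pr_mono)
    fix \<omega> assume "t \<le> \<bar>\<Sum>i\<in>I. X i (\<omega> i)\<bar>"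
    then have "t\<^sup>2 \<le> \<bar>\<Sum>i\<in>I. X i (\<omega> i)\<bar>\<^sup>2"
      using \<open>0 < t\<close> by (intro power_mono) auto
    then show "t\<^sup>2 \<le> (\<Sum>i\<in>I. X i (\<omega> i))\<^sup>2"
      by simp
  qed
  also have "\<dots> \<le> avg (PiE I S) (\<lambda>\<omega>. (\<Sum>i\<in>I. X i (\<omega> i))\<^sup>2) / t\<^sup>2"
    using \<open>0 < t\<close> by (intro pr_markov) auto
  also have "\<dots> \<le> (\<Sum>i\<in>I. v i) / t\<^sup>2"
    using assms by (subst avg_PiE_sum_sq) (auto intro!: divide_right_mono sum_mono)
  finally show ?thesis .
qed

text \<open>The variance p(1-p) of an indicator is bounded by p and not by a constant, which keeps
  Chebyshev's inequality useful for rare events such as falling into a fixed pass or epoch.\<close>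

lemma pr_weighted_count_deviation:
  fixes c :: "'i \<Rightarrow> real"
  assumes "finite I" "finite A" "A \<noteq> {}" "0 < t"
  shows "pr (PiE I (\<lambda>_. A)) (\<lambda>\<omega>. t \<le> \<bar>(\<Sum>i\<in>I. c i * of_bool (P (\<omega> i))) - pr A P * (\<Sum>i\<in>I. c i)\<bar>)
    \<le> pr A P * (\<Sum>i\<in>I. (c i)\<^sup>2) / t\<^sup>2"
proof -
  let ?X = "\<lambda>i a. c i * (of_bool (P a) - pr A P)"
  have m: "avg A (?X i) = 0" for i
    using assms by (simp add: avg_cmult avg_diff avg_const pr_def)
  have v: "avg A (\<lambda>a. (?X i a)\<^sup>2) \<le> (c i)\<^sup>2 * pr A P" for i
  proof -
    have "avg A (\<lambda>a. (?X i a)\<^sup>2) = (c i)\<^sup>2 * avg A (\<lambda>a. (of_bool (P a) - pr A P)\<^sup>2)"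
      by (simp add: power_mult_distrib avg_cmult)
    also have "avg A (\<lambda>a. (of_bool (P a) - pr A P)\<^sup>2) =
        avg A (\<lambda>a. of_bool (P a) - 2 * pr A P * of_bool (P a) + (pr A P)\<^sup>2)"
      by (intro avg_cong) (simp add: power2_eq_square algebra_simps)
    also have "\<dots> = pr A P - (pr A P)\<^sup>2"
      using assms by (simp add: avg_add avg_diff avg_const avg_cmult pr_def[symmetric])
        (simp add: power2_eq_square)
    also have "\<dots> \<le> pr A P"
      by simp
    finally show ?thesis
      by (simp add: mult_left_mono)
  qed
  have "pr (PiE I (\<lambda>_. A)) (\<lambda>\<omega>. t \<le> \<bar>\<Sum>i\<in>I. ?X i (\<omega> i)\<bar>) \<le> (\<Sum>i\<in>I. (c i)\<^sup>2 * pr A P) / t\<^sup>2"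
    using assms m v by (intro pr_chebyshev) auto
  then show ?thesis
    by (simp add: algebra_simps sum_subtractf sum_distrib_left sum_distrib_right)
qed

lemma avg_exists_le:
  assumes "finite S" "S \<noteq> {}"
  shows "\<exists>x\<in>S. f x \<le> avg S f"
proof (rule ccontr)
  assume "\<not> (\<exists>x\<in>S. f x \<le> avg S f)"
  then have "(\<Sum>x\<in>S. avg S f) < (\<Sum>x\<in>S. f x)"
    using assms by (intro sum_strict_mono) auto
  then show False
    using assms by (simp add: avg_def)
qed

section \<open>Public coins and random order\<close>

text \<open>
  Newman's argument with the moment generating function: \<open>2 powr f \<le> 1 + f\<close> for \<open>0 \<le> f \<le> 1\<close>, so
  for independent seeds the mean of \<open>2 powr (sum of the failures)\<close> is at most \<open>(1 + p) ^ N\<close>.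
\<close>

lemma exists_few_seeds:
  fixes fail :: "'w \<Rightarrow> 'x \<Rightarrow> real"
  assumes "finite \<Omega>" "\<Omega> \<noteq> {}" "finite X" "0 < N"
    and fail: "\<And>\<omega> x. \<omega> \<in> \<Omega> \<Longrightarrow> x \<in> X \<Longrightarrow> 0 \<le> fail \<omega> x \<and> fail \<omega> x \<le> 1"
    and p: "\<And>x. x \<in> X \<Longrightarrow> avg \<Omega> (\<lambda>\<omega>. fail \<omega> x) \<le> p" "0 \<le> p"
    and N: "real (card X) * (1 + p) ^ N < 2 powr (q * real N)"
  shows "\<exists>s. (\<forall>i<N. s i \<in> \<Omega>) \<and> (\<forall>x\<in>X. avg {..<N} (\<lambda>i. fail (s i) x) \<le> q)"
proof -
  let ?S = "PiE {..<N} (\<lambda>_. \<Omega>)"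
  let ?F = "\<lambda>s. \<Sum>x\<in>X. \<Prod>i<N. 2 powr fail (s i) x"
  have ne: "finite ?S" "?S \<noteq> {}"
    using assms finite_PiE_nonempty[of "{..<N}" "\<lambda>_. \<Omega>"] by auto
  have one: "avg \<Omega> (\<lambda>\<omega>. 2 powr fail \<omega> x) \<le> 1 + p" if "x \<in> X" for x
  proof -
    have "2 powr f \<le> 1 + f" if "0 \<le> f" "f \<le> 1" for f :: real
      \<comment> \<open>The weighted inequality of means for 2 and 1 with weights \<open>f\<close>
        and \<open>1 - f\<close>.\<close>
      using Youngs_inequality_0[of f "1 - f" 2 1] that by simp
    then have "avg \<Omega> (\<lambda>\<omega>. 2 powr fail \<omega> x) \<le> avg \<Omega> (\<lambda>\<omega>. 1 + fail \<omega> x)"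
      using fail that by (intro avg_mono) auto
    also have "\<dots> = 1 + avg \<Omega> (\<lambda>\<omega>. fail \<omega> x)"
      using assms by (simp add: avg_add avg_const)
    finally show ?thesis
      using p(1)[OF that] by simp
  qed
  have "avg ?S ?F = (\<Sum>x\<in>X. \<Prod>i<N. avg \<Omega> (\<lambda>\<omega>. 2 powr fail \<omega> x))"
    unfolding avg_sum
    by (intro sum.cong refl avg_PiE_prod[where f = "\<lambda>_ \<omega>. 2 powr fail \<omega> _"]) (use assms in auto)
  also have "\<dots> \<le> (\<Sum>x\<in>X. \<Prod>i<N. 1 + p)"
    using one by (intro sum_mono prod_mono) (auto intro: avg_nonneg)
  finally have "avg ?S ?F < 2 powr (q * real N)"
    using N by simp
  then obtain s where s: "s \<in> ?S" "?F s < 2 powr (q * real N)"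
    using avg_exists_le[OF ne, of ?F] by force
  have "avg {..<N} (\<lambda>i. fail (s i) x) \<le> q" if "x \<in> X" for x
  proof -
    have "2 powr (\<Sum>i<N. fail (s i) x) = (\<Prod>i<N. 2 powr fail (s i) x)"
      by (simp add: powr_sum)
    also have "\<dots> \<le> ?F s"
      using that assms(3) by (intro member_le_sum) (auto intro: prod_nonneg)
    finally have "(\<Sum>i<N. fail (s i) x) < q * real N"
      using s(2) by (smt (verit) powr_less_cancel_iff)
    then show ?thesis
      using \<open>0 < N\<close> by (simp add: avg_def field_simps)
  qed
  moreover have "\<forall>i<N. s i \<in> \<Omega>"
    using s(1) by auto
  ultimately show ?thesis
    by blast
qed

text \<open>
  Only exchangeability of the labels is used: \<open>T p\<close> relabels the copies by \<open>p\<close> and preserves the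
  uniform measure. \<open>C\<close> is the good event when copy \<open>i\<close> carries label \<open>lab \<omega> i\<close> itself.
\<close>

lemma random_order_sorted_labels:
  fixes lab :: "'w \<Rightarrow> nat \<Rightarrow> 'l" and key :: "'l \<Rightarrow> 'k::linorder"
    and T :: "(nat \<Rightarrow> nat) \<Rightarrow> 'w \<Rightarrow> 'w" and xs :: "'u list"
  defines "n \<equiv> length xs"
  assumes T: "\<And>p. p permutes {..<n} \<Longrightarrow> bij_betw (T p) \<Omega> \<Omega>"
    and lab: "\<And>p \<omega> i. p permutes {..<n} \<Longrightarrow> \<omega> \<in> \<Omega> \<Longrightarrow> i < n \<Longrightarrow> lab (T p \<omega>) i = lab \<omega> (p i)"
    and good: "\<And>p \<omega> ys. p permutes {..<n} \<Longrightarrow> \<omega> \<in> \<Omega> \<Longrightarrow> C (T p \<omega>) \<Longrightarrow> length ys = n \<Longrightarrow>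
      mset (zip (sort_key key (map (lab \<omega>) [0..<n])) ys) = mset (zip (map (lab (T p \<omega>)) [0..<n]) xs) \<Longrightarrow> good \<omega> ys"
  shows "avg \<Omega> (\<lambda>\<omega>. pr {p. p permutes {..<n}} (\<lambda>p. \<not> good \<omega> (permute_list p xs))) \<le> pr \<Omega> (\<lambda>\<omega>. \<not> C \<omega>)"
proof -
  let ?P = "{p. p permutes {..<n}}"
  have fin: "finite ?P" "?P \<noteq> {}"
    using permutes_id[of "{..<n}"] by (auto simp: finite_permutations simp del: permutes_id)
  have "pr ?P (\<lambda>p. \<not> good \<omega> (permute_list p xs)) \<le> pr ?P (\<lambda>p. \<not> C (T p \<omega>))" if \<omega>: "\<omega> \<in> \<Omega>" for \<omega>
  proof -
    let ?L = "map (lab \<omega>) [0..<n]"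
    obtain q where q: "q permutes {..<n}" "permute_list q ?L = sort_key key ?L"
      using mset_eq_permutation[of "sort_key key ?L" ?L] by auto
    \<comment> \<open>Position \<open>i\<close> holds copy \<open>p i\<close> and receives the label
      of index \<open>q i\<close>, so copy \<open>j\<close> receives the label of index
      \<open>q (inv p j)\<close>. As \<open>p\<close> runs through all permutations, so does
      \<open>q \<circ> inv p\<close>.\<close>
    have bij: "bij_betw (\<lambda>p. q \<circ> inv p) ?P ?P"
    proof (rule bij_betw_byWitness[where f' = "\<lambda>r. inv r \<circ> q"])
      show "\<forall>a\<in>?P. inv (q \<circ> inv a) \<circ> q = a"
        using q(1) by (auto simp: o_inv_distrib permutes_bij bij_imp_bij_inv inv_inv_eq o_assoc[symmetric]
            permutes_inv_o)
      show "\<forall>a'\<in>?P. q \<circ> inv (inv a' \<circ> q) = a'"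
        using q(1) by (auto simp: o_inv_distrib permutes_bij bij_imp_bij_inv inv_inv_eq o_assoc
            permutes_inv_o)
    qed (use q(1) in \<open>auto intro: permutes_compose permutes_inv\<close>)
    have "good \<omega> (permute_list p xs)" if p: "p permutes {..<n}" and C: "C (T (q \<circ> inv p) \<omega>)" for p
    proof (rule good[OF _ \<omega> C])
      show r: "q \<circ> inv p permutes {..<n}"
        using p q by (intro permutes_compose permutes_inv)
      have L: "map (lab (T (q \<circ> inv p) \<omega>)) [0..<n] = permute_list (q \<circ> inv p) ?L"
        using r permutes_in_image[OF r] by (intro nth_equalityI) (auto simp: permute_list_def lab[OF r \<omega>])
      have "permute_list p (permute_list (q \<circ> inv p) ?L) = permute_list (q \<circ> inv p \<circ> p) ?L"
        using p by (subst permute_list_compose) auto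
      also have "q \<circ> inv p \<circ> p = q"
        using p by (simp add: o_assoc[symmetric] permutes_inv_o)
      finally have pp: "permute_list p (permute_list (q \<circ> inv p) ?L) = permute_list q ?L" .
      have "permute_list p (zip (permute_list (q \<circ> inv p) ?L) xs) =
          zip (permute_list p (permute_list (q \<circ> inv p) ?L)) (permute_list p xs)"
        using p by (intro permute_list_zip) (auto simp: n_def)
      also have "\<dots> = zip (sort_key key ?L) (permute_list p xs)"
        by (simp only: pp q(2))
      finally have "zip (sort_key key ?L) (permute_list p xs) =
          permute_list p (zip (permute_list (q \<circ> inv p) ?L) xs)" ..
      then show "mset (zip (sort_key key ?L) (permute_list p xs)) = mset (zip (map (lab (T (q \<circ> inv p) \<omega>)) [0..<n]) xs)"
        using p unfolding L by (simp add: n_def)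
    qed (simp add: n_def)
    then have "pr ?P (\<lambda>p. \<not> good \<omega> (permute_list p xs)) \<le> pr ?P (\<lambda>p. \<not> C (T (q \<circ> inv p) \<omega>))"
      by (intro pr_mono) auto
    also have "\<dots> = pr ?P (\<lambda>p. \<not> C (T p \<omega>))"
      unfolding pr_def using avg_bij[OF bij, of "\<lambda>p. of_bool (\<not> C (T p \<omega>))"] by simp
    finally show ?thesis .
  qed
  then have "avg \<Omega> (\<lambda>\<omega>. pr ?P (\<lambda>p. \<not> good \<omega> (permute_list p xs))) \<le> avg \<Omega> (\<lambda>\<omega>. pr ?P (\<lambda>p. \<not> C (T p \<omega>)))"
    by (rule avg_mono)
  also have "\<dots> = avg ?P (\<lambda>p. avg \<Omega> (\<lambda>\<omega>. of_bool (\<not> C (T p \<omega>))))"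
    unfolding pr_def by (rule avg_swap)
  also have "\<dots> = avg ?P (\<lambda>p. pr \<Omega> (\<lambda>\<omega>. \<not> C \<omega>))"
    unfolding pr_def by (intro avg_cong avg_bij[where f = "\<lambda>\<omega>. of_bool (\<not> C \<omega>)"] T) simp
  also have "\<dots> = pr \<Omega> (\<lambda>\<omega>. \<not> C \<omega>)"
    using fin by (rule avg_const)
  finally show ?thesis .
qed

text \<open>States are encoded injectively as words of length \<open>s\<close>; each transition
  decodes, steps and encodes again. All randomness sits in the initial state, and later transitions
  are deterministic.\<close>

lemma stream_alg_of_automaton:
  fixes step :: "'u \<Rightarrow> 'q \<Rightarrow> 'q" and out :: "'q \<Rightarrow> 'u set"
  assumes Q: "finite Q" "card Q \<le> 2 ^ s" "set_pmf I \<subseteq> Q"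
    and step: "\<And>x q. x \<in> U \<Longrightarrow> q \<in> Q \<Longrightarrow> step x q \<in> Q"
  shows "\<exists>A. uses_space U A s \<and>
    (\<forall>xs. set xs \<subseteq> U \<longrightarrow> answer A xs = map_pmf (\<lambda>q. out (fold step xs q)) I)"
proof -
  let ?W = "{w :: bool list. length w = s}"
  have W: "finite ?W" "card ?W = 2 ^ s"
    using finite_lists_length_eq[of "UNIV :: bool set" s] card_lists_length_eq[of "UNIV :: bool set" s] by auto
  obtain e where e: "inj_on e Q" "e ` Q \<subseteq> ?W"
    using card_le_inj[OF Q(1) W(1)] Q(2) W(2) by auto
  obtain q0 where q0: "q0 \<in> Q"
    using Q(3) set_pmf_not_empty[of I] by auto
  \<comment> \<open>Words that encode no state are read as \<open>q0\<close>: the width must be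
    preserved from every word of length \<open>s\<close>, not only from reachable ones.\<close>
  define dec where "dec w = (if w \<in> e ` Q then inv_into Q e w else q0)" for w
  have dec: "dec w \<in> Q" for w
    using q0 by (auto simp: dec_def inv_into_into)
  have dec_e: "dec (e q) = q" if "q \<in> Q" for q
    using that e(1) by (simp add: dec_def)
  define A where "A = \<lparr>start = map_pmf e I, update = \<lambda>x w. return_pmf (e (step x (dec w))),
    report = \<lambda>w. return_pmf (out (dec w))\<rparr>"
  have proc: "process A xs (e q) = return_pmf (e (fold step xs q)) \<and> fold step xs q \<in> Q"
    if "set xs \<subseteq> U" "q \<in> Q" for xs q
    using that
    by (induction xs arbitrary: q) (auto simp: A_def bind_return_pmf dec_e step)
  have "answer A xs = map_pmf (\<lambda>q. out (fold step xs q)) I" if "set xs \<subseteq> U" for xs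
  proof -
    have "answer A xs = I \<bind> (\<lambda>q. process A xs (e q) \<bind> report A)"
      by (simp add: answer_def A_def bind_map_pmf bind_assoc_pmf)
    also have "\<dots> = I \<bind> (\<lambda>q. return_pmf (out (fold step xs q)))"
    proof (rule bind_pmf_cong)
      fix q assume "q \<in> set_pmf I"
      then show "process A xs (e q) \<bind> report A = return_pmf (out (fold step xs q))"
        using Q(3) proc[OF that, of q] by (auto simp: bind_return_pmf dec_e A_def)
    qed simp
    finally show ?thesis
      by (simp add: map_pmf_def)
  qed
  moreover have "uses_space U A s"
    using e(2) Q(3) step dec by (fastforce simp: uses_space_def A_def image_subset_iff)
  ultimately show ?thesis
    by blast
qed

text \<open>The bridge from \<open>pmf\<close> to finite averages: order and seed are independent
  and uniform, so the pair is uniform on the product, and the two averages may be exchanged.\<close>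

lemma prob_uniform_pair:
  assumes "finite P" "P \<noteq> {}" "finite S" "S \<noteq> {}"
  shows "measure_pmf.prob (bind_pmf (pmf_of_set P) (\<lambda>p. map_pmf (g p) (pmf_of_set S))) G =
    1 - avg S (\<lambda>i. pr P (\<lambda>p. g p i \<notin> G))"
proof -
  have "bind_pmf (pmf_of_set P) (\<lambda>p. map_pmf (g p) (pmf_of_set S)) =
      map_pmf (\<lambda>(p, i). g p i) (pair_pmf (pmf_of_set P) (pmf_of_set S))"
    by (simp add: pair_pmf_def map_pmf_def bind_assoc_pmf bind_return_pmf)
  also have "pair_pmf (pmf_of_set P) (pmf_of_set S) = pmf_of_set (P \<times> S)"
    using assms by (intro pmf_eqI) (auto simp: pmf_pair indicator_def card_cartesian_product
        pmf_of_set[OF assms(2,1)] pmf_of_set[OF assms(4,3)])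
  finally have "measure_pmf.prob (bind_pmf (pmf_of_set P) (\<lambda>p. map_pmf (g p) (pmf_of_set S))) G =
      pr (P \<times> S) (\<lambda>(p, i). g p i \<in> G)"
    using assms pr_mem[of "P \<times> S" "{x. g (fst x) (snd x) \<in> G}"]
    by (simp add: measure_pmf_of_set vimage_def case_prod_unfold)
  also have "\<dots> = avg (P \<times> S) (\<lambda>x. 1 - of_bool (case x of (p, i) \<Rightarrow> g p i \<notin> G))"
    unfolding pr_def by (intro avg_cong) auto
  also have "\<dots> = 1 - avg P (\<lambda>p. avg S (\<lambda>i. of_bool (g p i \<notin> G)))"
    using assms by (simp add: avg_diff avg_const avg_Times)
  also have "avg P (\<lambda>p. avg S (\<lambda>i. of_bool (g p i \<notin> G))) = avg S (\<lambda>i. pr P (\<lambda>p. g p i \<notin> G))"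
    unfolding pr_def by (rule avg_swap)
  finally show ?thesis .
qed

declare split_paired_All [simp del] split_paired_Ex [simp del]

section \<open>The automaton that finds a repeated item\<close>

text \<open>
  A slot is a triple (pass, epoch, index), and the second component of \<open>Store\<close> and \<open>Probe\<close> is the
  short identifier. The state of the automaton consists of the current slot with the identifiers
  stored in it, of the register (epoch, candidate, count), and of the output list. A stale slot or
  register is recognised by its tag and overwritten, so that nothing has to be reset.
\<close>

datatype 'u event = Store "nat \<times> nat \<times> nat" nat | Probe "nat \<times> nat \<times> nat" nat 'u
  | Tally "nat \<times> nat" 'u | Skip

type_synonym 'u finder =
  "((nat \<times> nat \<times> nat) \<times> nat list) \<times> ((nat \<times> nat) \<times> 'u \<times> nat) option \<times> 'u list"

definition epoch :: "nat \<times> nat \<times> nat \<Rightarrow> nat \<times> nat" where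
  "epoch T = (fst T, fst (snd T))"

text \<open>Within an epoch the first match keeps the register. The tests against \<open>c\<close>
  and \<open>M\<close> bound the memory on every input, also in runs where the random choices are
  bad. Identifiers are stored without repetition, so \<open>c\<close> limits distinct
  identifiers.\<close>

fun react :: "nat \<Rightarrow> nat \<Rightarrow> real \<Rightarrow> 'u event \<Rightarrow> 'u finder \<Rightarrow> 'u finder" where
  "react c M \<tau> (Store T h) ((T0, S), r, out) =
    ((T, let S0 = if T0 = T then S else [] in if h \<in> set S0 \<or> c \<le> length S0 then S0 else h # S0), r, out)"
| "react c M \<tau> (Probe T h y) ((T0, S), r, out) =
    ((T0, S), if T0 = T \<and> h \<in> set S \<and> map_option fst r \<noteq> Some (epoch T) then Some (epoch T, y, 0) else r, out)"
| "react c M \<tau> (Tally E y) (b, None, out) = (b, None, out)"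
| "react c M \<tau> (Tally E y) (b, Some (E', z, k), out) =
    (if E' = E \<and> z = y
     then (b, Some (E, y, Suc k), if \<tau> \<le> real (Suc k) \<and> y \<notin> set out \<and> length out < M then y # out else out)
     else (b, Some (E', z, k), out))"
| "react c M \<tau> Skip st = st"

abbreviation finder_init :: "'u finder" where
  "finder_init \<equiv> (((0, 0, 0), []), None, [])"

lemma finder_cases:
  obtains T0 S r out where "(st :: 'u finder) = ((T0, S), r, out)"
  by (cases st) auto

text \<open>An invariant for arbitrary event sequences, sorted or not: whatever is held in the slot
  or register can be traced back to events with the same tag, and the count in the register never
  exceeds the true number of tallies.\<close>

lemma finder_sound:
  assumes "fold (react c M \<tau>) evs finder_init = ((T0, S), r, out)"
  shows "(\<forall>h\<in>set S. Store T0 h \<in> set evs) \<and>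
    (\<forall>E y k. r = Some (E, y, k) \<longrightarrow> k \<le> count_list evs (Tally E y) \<and>
       (\<exists>T h. epoch T = E \<and> Probe T h y \<in> set evs \<and> Store T h \<in> set evs)) \<and>
    distinct out \<and> length out \<le> M \<and> (\<forall>y\<in>set out. \<exists>E. \<tau> \<le> real (count_list evs (Tally E y)))"
  using assms
proof (induction evs arbitrary: T0 S r out rule: rev_induct)
  case Nil
  then show ?case
    by auto
next
  case (snoc v evs)
  obtain T0' S' r' out' where st: "fold (react c M \<tau>) evs finder_init = ((T0', S'), r', out')"
    by (rule finder_cases)
  note IH = snoc.IH[OF st]
  have eq: "react c M \<tau> v ((T0', S'), r', out') = ((T0, S), r, out)"
    using snoc.prems st by simp
  have I1: "\<forall>h\<in>set S'. Store T0' h \<in> set evs"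
    and I2: "\<And>E y k. r' = Some (E, y, k) \<Longrightarrow> k \<le> count_list evs (Tally E y)"
    and I3: "\<And>E y k. r' = Some (E, y, k) \<Longrightarrow>
      \<exists>T h. epoch T = E \<and> Probe T h y \<in> set evs \<and> Store T h \<in> set evs"
    and I4: "distinct out'" "length out' \<le> M"
    and I5: "\<And>y. y \<in> set out' \<Longrightarrow> \<exists>E. \<tau> \<le> real (count_list evs (Tally E y))"
    using IH by blast+
  let ?evs = "evs @ [v]"
  have S: "\<forall>h\<in>set S. Store T0 h \<in> set ?evs"
    using eq I1 by (cases v; cases r') (auto simp: Let_def split: if_splits)
  have r: "k \<le> count_list ?evs (Tally E y) \<and>
      (\<exists>T h. epoch T = E \<and> Probe T h y \<in> set ?evs \<and> Store T h \<in> set ?evs)"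
    if rk: "r = Some (E, y, k)" for E y k
  proof -
    consider "r' = Some (E, y, k)" | k' where "r' = Some (E, y, k')" "v = Tally E y" "k = Suc k'"
      | T h where "v = Probe T h y" "epoch T = E" "k = 0" "T0' = T" "h \<in> set S'"
      using eq rk by (cases v; cases r') (auto split: if_splits)
    then show ?thesis
    proof cases
      case 1
      then show ?thesis
        using I2[OF 1] I3[OF 1] by (auto simp: count_list_append)
    next
      case 2
      then show ?thesis
        using I2[OF 2(1)] I3[OF 2(1)] by (auto simp: count_list_append)
    next
      case 3
      then have "k \<le> count_list ?evs (Tally E y)" "epoch T = E" "Probe T h y \<in> set ?evs" "Store T h \<in> set ?evs"
        using I1 by auto
      then show ?thesis
        by blast
    qed
  qed
  have out: "distinct out \<and> length out \<le> M"
    using eq I4 by (cases v; cases r') (auto split: if_splits)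
  have o: "\<exists>E. \<tau> \<le> real (count_list ?evs (Tally E y))" if yo: "y \<in> set out" for y
  proof (cases "y \<in> set out'")
    case True
    then obtain E where "\<tau> \<le> real (count_list evs (Tally E y))"
      using I5 by blast
    then show ?thesis
      by (intro exI[of _ E]) (simp add: count_list_append)
  next
    case False
    have "out = out' \<or> (\<exists>E z k. v = Tally E z \<and> r' = Some (E, z, k) \<and> \<tau> \<le> real (Suc k) \<and> out = z # out')"
      using eq by (cases v; cases r') (auto split: if_splits)
    then obtain E k where v: "v = Tally E y" "r' = Some (E, y, k)" "\<tau> \<le> real (Suc k)"
      using False yo by auto
    then have "Suc k \<le> count_list ?evs (Tally E y)"
      using I2 by (simp add: count_list_append)
    then show ?thesis
      using v(3) by (intro exI[of _ E]) (meson of_nat_le_iff order_trans)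
  qed
  show ?case
    using S r out o by blast
qed

text \<open>The first stored identifier replaces a stale slot, and the capacity is never reached, so
  every identifier of the step is kept. Without any \<open>Store\<close> event the old slot stays,
  hence the case distinction.\<close>

lemma fold_react_Store:
  assumes "\<forall>v\<in>set B. v = Skip \<or> (\<exists>h. v = Store T h)" "T0 = T \<Longrightarrow> S = []"
    and "card {h. Store T h \<in> set B} \<le> c"
  shows "\<exists>S'. fold (react c M \<tau>) B ((T0, S), r, out) =
      (if \<exists>h. Store T h \<in> set B then (T, S') else (T0, S), r, out) \<and>
    distinct S' \<and> set S' = {h. Store T h \<in> set B}"
  using assms
proof (induction B rule: rev_induct)
  case Nil
  then show ?case
    by auto
next
  case (snoc v B)
  have fin: "finite {h. Store T h \<in> set xs}" for xs :: "'a event list"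
    by (rule finite_subset[of _ "(\<lambda>v. case v of Store T h \<Rightarrow> h | _ \<Rightarrow> 0) ` set xs"]) (auto intro: rev_image_eqI)
  have "card {h. Store T h \<in> set B} \<le> card {h. Store T h \<in> set (B @ [v])}"
    by (rule card_mono[OF fin]) auto
  then obtain S' where S': "fold (react c M \<tau>) B ((T0, S), r, out) =
      (if \<exists>h. Store T h \<in> set B then (T, S') else (T0, S), r, out)"
    "distinct S'" "set S' = {h. Store T h \<in> set B}"
    using snoc by auto
  consider "v = Skip" | h where "v = Store T h"
    using snoc.prems by auto
  then show ?case
  proof cases
    case 1
    then show ?thesis
      using S' by auto
  next
    case (2 h)
    have set': "{h. Store T h \<in> set (B @ [v])} = insert h (set S')"
      using 2 S' by auto
    have 3: "fold (react c M \<tau>) (B @ [v]) ((T0, S), r, out) =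
       ((T, if h \<in> set S' \<or> c \<le> length S' then S' else h # S'), r, out)"
      using S' 2 snoc.prems(2) by (auto simp: Let_def)
    have "length S' < c" if "h \<notin> set S'"
    proof -
      have "Suc (length S') = card (insert h (set S'))"
        using that S'(2) by (simp add: distinct_card)
      then show ?thesis
        using snoc.prems(3) set' by simp
    qed
    then show ?thesis
      using 2 3 S'(2) set' by (intro exI[of _ "if h \<in> set S' then S' else h # S'"]) auto
  qed
qed

text \<open>Only the epoch of the register is claimed, not its candidate; another item of the epoch
  may have come first. The second disjunct covers a register that is already taken, which later
  probes of the epoch leave alone, and it carries the induction.\<close>

lemma fold_react_Probe:
  assumes "\<forall>v\<in>set B. v = Skip \<or> (\<exists>h y. v = Probe T h y)"
  shows "\<exists>r'. fold (react c M \<tau>) B ((T0, S), r, out) = ((T0, S), r', out) \<and>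
    (T0 = T \<and> ((\<exists>h y. Probe T h y \<in> set B \<and> h \<in> set S) \<or> map_option fst r = Some (epoch T)) \<longrightarrow>
     map_option fst r' = Some (epoch T))"
  using assms
proof (induction B arbitrary: r)
  case (Cons v B)
  then consider "v = Skip" | h y where "v = Probe T h y"
    by auto
  then show ?case
  proof cases
    case 1
    then show ?thesis
      using Cons by auto
  next
    case (2 h y)
    let ?r = "if T0 = T \<and> h \<in> set S \<and> map_option fst r \<noteq> Some (epoch T) then Some (epoch T, y, 0) else r"
    have "\<forall>v\<in>set B. v = Skip \<or> (\<exists>h y. v = Probe T h y)"
      using Cons.prems by simp
    from Cons.IH[OF this, of ?r] obtain r' where
      r': "fold (react c M \<tau>) B ((T0, S), ?r, out) = ((T0, S), r', out)"
      "T0 = T \<and> ((\<exists>h y. Probe T h y \<in> set B \<and> h \<in> set S) \<or> map_option fst ?r = Some (epoch T)) \<Longrightarrow>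
        map_option fst r' = Some (epoch T)"
      by blast
    have "fold (react c M \<tau>) (v # B) ((T0, S), r, out) = ((T0, S), r', out)"
      using r'(1) 2 by simp
    moreover have "map_option fst r' = Some (epoch T)"
      if "T0 = T" "(\<exists>h y. Probe T h y \<in> set (v # B) \<and> h \<in> set S) \<or> map_option fst r = Some (epoch T)"
    proof (rule r'(2))
      have "map_option fst ?r = Some (epoch T)" if "h \<in> set S \<or> map_option fst r = Some (epoch T)"
        using that \<open>T0 = T\<close> by (cases "map_option fst r = Some (epoch T)") (simp_all, blast)
      then show "T0 = T \<and> ((\<exists>h y. Probe T h y \<in> set B \<and> h \<in> set S) \<or> map_option fst ?r = Some (epoch T))"
        using that 2 by (metis event.inject(2) set_ConsD)
    qed
    ultimately show ?thesis
      by blast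
  qed
qed auto

lemma react_out_mono:
  "set (snd (snd st)) \<subseteq> set (snd (snd (react c M \<tau> v st))) \<and>
   length (snd (snd st)) \<le> length (snd (snd (react c M \<tau> v st)))"
  by (cases "(c, M, \<tau>, v, st)" rule: react.cases) auto

lemma fold_react_out_mono:
  "set (snd (snd st)) \<subseteq> set (snd (snd (fold (react c M \<tau>) evs st))) \<and>
   length (snd (snd st)) \<le> length (snd (snd (fold (react c M \<tau>) evs st)))"
proof (induction evs arbitrary: st)
  case (Cons v evs)
  show ?case
    using Cons[of "react c M \<tau> v st"] react_out_mono[of st c M \<tau> v] by auto
qed auto

text \<open>Probes of the same epoch cannot displace the candidate, so later slots of the epoch may
  interleave with the counting. The alternative of a full output list is excluded later by counting
  the items that can be reported.\<close>

lemma fold_react_Tally: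
  assumes "\<forall>T h y. Probe T h y \<in> set B \<longrightarrow> epoch T = E" "0 < \<tau>"
  shows "\<exists>b' k' out'. fold (react c M \<tau>) B (b, Some (E, x, k), out) = (b', Some (E, x, k'), out') \<and>
    count_list B (Tally E x) \<le> k' \<and>
    (\<tau> \<le> real (count_list B (Tally E x)) \<longrightarrow> x \<in> set out' \<or> M \<le> length out')"
  using assms
proof (induction B rule: rev_induct)
  case Nil
  then show ?case
    by auto
next
  case (snoc v B)
  have "\<forall>T h y. Probe T h y \<in> set B \<longrightarrow> epoch T = E"
    using snoc.prems(1) by (simp del: split_paired_All)
  from snoc.IH[OF this snoc.prems(2)] obtain b' k' out' where
    st': "fold (react c M \<tau>) B (b, Some (E, x, k), out) = (b', Some (E, x, k'), out')"
    and k': "count_list B (Tally E x) \<le> k'"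
      "\<tau> \<le> real (count_list B (Tally E x)) \<longrightarrow> x \<in> set out' \<or> M \<le> length out'"
    by blast
  obtain T0 S where st: "fold (react c M \<tau>) B (b, Some (E, x, k), out) = ((T0, S), Some (E, x, k'), out')"
    using st' by (cases b') blast
  show ?case
  proof (cases "v = Tally E x")
    case True
    have "count_list (B @ [v]) (Tally E x) \<le> Suc k'"
      using k'(1) True by (simp add: count_list_append)
    moreover from this have "\<tau> \<le> real (Suc k')" if "\<tau> \<le> real (count_list (B @ [v]) (Tally E x))"
      using that by (meson of_nat_le_iff order_trans)
    moreover let ?o = "if \<tau> \<le> real (Suc k') \<and> x \<notin> set out' \<and> length out' < M then x # out' else out'"
    have "fold (react c M \<tau>) (B @ [v]) (b, Some (E, x, k), out) = ((T0, S), Some (E, x, Suc k'), ?o)"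
      using st True by simp
    moreover have "x \<in> set ?o \<or> M \<le> length ?o" if "\<tau> \<le> real (Suc k')"
      using that by auto
    ultimately show ?thesis
      by blast
  next
    case False
    have "count_list (B @ [v]) (Tally E x) = count_list B (Tally E x)"
      using False by (simp add: count_list_append)
    moreover have "\<exists>b'. react c M \<tau> v ((T0, S), Some (E, x, k'), out') = (b', Some (E, x, k'), out')"
      using False snoc.prems(1) by (cases v; cases T0) auto
    then obtain b'' where "fold (react c M \<tau>) (B @ [v]) (b, Some (E, x, k), out) = (b'', Some (E, x, k'), out')"
      using st by auto
    ultimately show ?thesis
      using k' by metis
  qed
qed

text \<open>\<open>B\<close> and \<open>P\<close> are the store and probe step of slot
  \<open>T\<close>, \<open>A\<close> is what precedes them, \<open>V\<close> the rest of the epoch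
  and \<open>Z\<close> the remainder. After \<open>P\<close> the register belongs to the epoch; by
  \<open>finder_sound\<close> its candidate stems from a matching pair, and \<open>match\<close>
  leaves only \<open>x\<close>.\<close>

lemma finder_complete:
  assumes evs: "evs = A @ B @ P @ V @ Z"
    and A: "\<And>h. Store T h \<notin> set A"
    and B: "\<forall>v\<in>set B. v = Skip \<or> (\<exists>h. v = Store T h)"
    and P: "\<forall>v\<in>set P. v = Skip \<or> (\<exists>h y. v = Probe T h y)"
    and V: "\<forall>T' h y. Probe T' h y \<in> set V \<longrightarrow> epoch T' = epoch T"
    and x: "Store T hx \<in> set B" "Probe T hx x \<in> set P" "card {h. Store T h \<in> set B} \<le> c"
    and match: "\<And>T' h y. epoch T' = epoch T \<Longrightarrow> Probe T' h y \<in> set evs \<Longrightarrow> Store T' h \<in> set evs \<Longrightarrow> y = x"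
    and \<tau>: "0 < \<tau>" "\<tau> \<le> real (count_list V (Tally (epoch T) x))"
  shows "x \<in> set (snd (snd (fold (react c M \<tau>) evs finder_init))) \<or>
    M \<le> length (snd (snd (fold (react c M \<tau>) evs finder_init)))"
proof -
  obtain T0 S r out where stA: "fold (react c M \<tau>) A finder_init = ((T0, S), r, out)"
    by (rule finder_cases)
  have S0: "S = []" if "T0 = T"
    using finder_sound[OF stA] A that by (cases S) auto
  have ex: "\<exists>h. Store T h \<in> set B"
    using x(1) by blast
  obtain S' where a: "fold (react c M \<tau>) B ((T0, S), r, out) =
      (if \<exists>h. Store T h \<in> set B then (T, S') else (T0, S), r, out)"
    and "set S' = {h. Store T h \<in> set B}"
    using fold_react_Store[OF B S0 x(3), where M = M and \<tau> = \<tau> and r = r and out = out] by blast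
  then have S': "fold (react c M \<tau>) B ((T0, S), r, out) = ((T, S'), r, out)"
    "set S' = {h. Store T h \<in> set B}"
    using ex by simp_all
  obtain r' where r': "fold (react c M \<tau>) P ((T, S'), r, out) = ((T, S'), r', out)"
    "map_option fst r' = Some (epoch T)"
    using fold_react_Probe[OF P, of c M \<tau> T S' r out] x S'(2) by blast
  have stP: "fold (react c M \<tau>) (A @ B @ P) finder_init = ((T, S'), r', out)"
    using stA S' r' by simp
  obtain y k where yk: "r' = Some (epoch T, y, k)"
    using r'(2) by auto
  have "y = x"
  proof -
    obtain T' h where "epoch T' = epoch T" "Probe T' h y \<in> set (A @ B @ P)" "Store T' h \<in> set (A @ B @ P)"
      using finder_sound[OF stP] yk by blast
    then show ?thesis
      using match[of T' h y] evs by auto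
  qed
  obtain b' k' out' where V': "fold (react c M \<tau>) V ((T, S'), r', out) = (b', Some (epoch T, x, k'), out')"
    "x \<in> set out' \<or> M \<le> length out'"
    using fold_react_Tally[OF V \<tau>(1), of c M "(T, S')" x k out] \<tau>(2) yk \<open>y = x\<close> by blast
  have "fold (react c M \<tau>) evs finder_init = fold (react c M \<tau>) Z (b', Some (epoch T, x, k'), out')"
    using evs stP V'(1) by simp
  then show ?thesis
    using V'(2) fold_react_out_mono[of "(b', Some (epoch T, x, k'), out')" c M \<tau> Z] by auto
qed

section \<open>Running the automaton on a labelled stream\<close>

text \<open>
  A label \<open>(\<delta>, e, r, k)\<close> consists of a phase \<open>\<delta>\<close>, an epoch \<open>e\<close>, a step \<open>r\<close> within the epoch, and a
  thinning mark \<open>k\<close>. The steps \<open>2 * l\<close> and \<open>2 * l + 1\<close> store and probe in slot \<open>l < L\<close>, restricted to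
  copies with \<open>k < \<theta>\<close>; the steps \<open>r \<ge> 2 * L\<close> count occurrences of the candidate.
\<close>

type_synonym label = "nat \<times> nat \<times> nat \<times> nat"

text \<open>A list, to be compared lexicographically. The thinning mark is left out: it decides
  whether a copy takes part, not when.\<close>

definition schedule_key :: "label \<Rightarrow> nat list" where
  "schedule_key lb = (case lb of (\<delta>, e, r, k) \<Rightarrow> [\<delta>, e, r])"

definition stores :: "nat \<Rightarrow> nat \<times> nat \<Rightarrow> nat \<times> nat \<times> nat \<Rightarrow> bool" where
  "stores \<theta> s p \<longleftrightarrow> (\<exists>k<\<theta>. p = (fst s, 2 * snd s, k))"

definition probes :: "nat \<Rightarrow> nat \<times> nat \<Rightarrow> nat \<times> nat \<times> nat \<Rightarrow> bool" where
  "probes \<theta> s p \<longleftrightarrow> (\<exists>k<\<theta>. p = (fst s, 2 * snd s + 1, k))"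

definition tallies :: "nat \<Rightarrow> nat \<Rightarrow> nat \<times> nat \<times> nat \<Rightarrow> bool" where
  "tallies L e p \<longleftrightarrow> (\<exists>r k. 2 * L \<le> r \<and> p = (e, r, k))"

definition event_of :: "nat \<Rightarrow> nat \<Rightarrow> ('u \<Rightarrow> (nat \<times> nat) \<times> nat) \<Rightarrow> label \<Rightarrow> 'u \<Rightarrow> 'u event" where
  "event_of L \<theta> g lb y = (case lb of (\<delta>, e, r, k) \<Rightarrow>
     if r < 2 * L then
       if k < \<theta> \<and> fst (g y) = (e, r div 2)
       then if even r then Store (\<delta>, e, r div 2) (snd (g y)) else Probe (\<delta>, e, r div 2) (snd (g y)) y
       else Skip
     else Tally (\<delta>, e) y)"

text \<open>
  Sufficient for \<open>x\<close> to be reported in the pass on the copies \<open>J\<close>, whatever the order of the copies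
  with equal schedule keys. The last but one condition says that no other item is ever matched in
  the epoch of \<open>x\<close>, so that the register stays free for \<open>x\<close>.
\<close>

definition found ::
  "nat \<Rightarrow> nat \<Rightarrow> nat \<Rightarrow> real \<Rightarrow> 'u list \<Rightarrow> nat set \<Rightarrow> 'u \<Rightarrow> (nat \<Rightarrow> nat \<times> nat \<times> nat) \<Rightarrow> ('u \<Rightarrow> (nat \<times> nat) \<times> nat) \<Rightarrow> bool"
  where
  "found L c \<theta> \<tau> xs J x p g \<longleftrightarrow>
    (\<exists>j\<in>J. xs ! j = x \<and> stores \<theta> (fst (g x)) (p j)) \<and>
    (\<exists>j\<in>J. xs ! j = x \<and> probes \<theta> (fst (g x)) (p j)) \<and>
    card {j \<in> J. xs ! j \<noteq> x \<and> fst (g (xs ! j)) = fst (g x) \<and> stores \<theta> (fst (g x)) (p j)} < c \<and>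
    \<not> (\<exists>i\<in>J. \<exists>j\<in>J. xs ! i \<noteq> x \<and> fst (fst (g (xs ! i))) = fst (fst (g x)) \<and>
         g (xs ! j) = g (xs ! i) \<and> probes \<theta> (fst (g (xs ! i))) (p i) \<and> stores \<theta> (fst (g (xs ! i))) (p j)) \<and>
    \<tau> \<le> real (card {j \<in> J. xs ! j = x \<and> tallies L (fst (fst (g x))) (p j)})"

lemma event_of_eq_Store:
  "event_of L \<theta> g lb y = Store (\<delta>, e, l) h \<longleftrightarrow>
    l < L \<and> fst lb = \<delta> \<and> stores \<theta> (e, l) (snd lb) \<and> g y = ((e, l), h)"
proof -
  obtain \<delta>' e' r k where lb: "lb = (\<delta>', e', r, k)"
    by (metis prod_cases4)
  have even: "even r \<and> r div 2 = l \<longleftrightarrow> r = 2 * l"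
    by presburger
  have "event_of L \<theta> g lb y = Store (\<delta>, e, l) h \<longleftrightarrow> r < 2 * L \<and> k < \<theta> \<and> fst (g y) = (e', r div 2) \<and>
      (even r \<and> r div 2 = l) \<and> \<delta>' = \<delta> \<and> e' = e \<and> snd (g y) = h"
    by (auto simp: event_of_def lb)
  also have "\<dots> \<longleftrightarrow> l < L \<and> fst lb = \<delta> \<and> stores \<theta> (e, l) (snd lb) \<and> g y = ((e, l), h)"
    unfolding even by (auto simp: stores_def lb prod_eq_iff)
  finally show ?thesis .
qed

lemma event_of_eq_Probe:
  "event_of L \<theta> g lb y = Probe (\<delta>, e, l) h z \<longleftrightarrow>
    l < L \<and> fst lb = \<delta> \<and> probes \<theta> (e, l) (snd lb) \<and> g y = ((e, l), h) \<and> y = z"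
proof -
  obtain \<delta>' e' r k where lb: "lb = (\<delta>', e', r, k)"
    by (metis prod_cases4)
  have odd: "odd r \<and> r div 2 = l \<longleftrightarrow> r = 2 * l + 1"
    by presburger
  have "event_of L \<theta> g lb y = Probe (\<delta>, e, l) h z \<longleftrightarrow> r < 2 * L \<and> k < \<theta> \<and> fst (g y) = (e', r div 2) \<and>
      (odd r \<and> r div 2 = l) \<and> \<delta>' = \<delta> \<and> e' = e \<and> snd (g y) = h \<and> y = z"
    by (auto simp: event_of_def lb)
  also have "\<dots> \<longleftrightarrow> l < L \<and> fst lb = \<delta> \<and> probes \<theta> (e, l) (snd lb) \<and> g y = ((e, l), h) \<and> y = z"
    unfolding odd by (auto simp: probes_def lb prod_eq_iff)
  finally show ?thesis .
qed

lemma event_of_eq_Tally: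
  "event_of L \<theta> g lb y = Tally (\<delta>, e) z \<longleftrightarrow> fst lb = \<delta> \<and> tallies L e (snd lb) \<and> y = z"
  by (cases lb) (auto simp: event_of_def tallies_def)

lemma length_filter_mset_zip:
  assumes "mset zs = mset (zip (map lab [0..<length xs]) xs)"
  shows "length (filter Q zs) = card {j. j < length xs \<and> Q (lab j, xs ! j)}"
proof -
  have "length (filter Q zs) = size (filter_mset Q (mset zs))"
    by (metis mset_filter size_mset)
  also have "\<dots> = length (filter Q (zip (map lab [0..<length xs]) xs))"
    unfolding assms by (metis mset_filter size_mset)
  also have "\<dots> = card {j. j < length xs \<and> Q (lab j, xs ! j)}"
    by (auto simp: length_filter_conv_card intro!: arg_cong[of _ _ card])
  finally show ?thesis .
qed

lemma count_list_map_filter: "count_list (map f ys) v = length (filter (\<lambda>z. f z = v) ys)"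
  by (induction ys) auto

text \<open>Splits off the lowest class; iteration cuts a sorted stream into consecutive
  blocks.\<close>

lemma sorted_filter_split:
  fixes cl :: "'a \<Rightarrow> nat"
  assumes "sorted (map cl zs)"
  shows "filter (\<lambda>z. k \<le> cl z) zs = filter (\<lambda>z. cl z = k) zs @ filter (\<lambda>z. Suc k \<le> cl z) zs"
  using assms
proof (induction zs)
  case (Cons a zs)
  show ?case
  proof (cases "k < cl a")
    case True
    then have "filter (\<lambda>z. cl z = k) zs = []" "filter (\<lambda>z. k \<le> cl z) zs = zs" "filter (\<lambda>z. Suc k \<le> cl z) zs = zs"
      using Cons.prems by (fastforce simp: filter_empty_conv filter_id_conv)+
    then show ?thesis
      using True by simp
  qed (use Cons in auto)
qed auto

section \<open>One scan over a sorted labelled stream\<close>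

locale scan =
  fixes D L c M m :: nat
    and \<theta> :: "int list \<Rightarrow> nat" and \<tau> :: "int list \<Rightarrow> real"
    and sg :: "nat \<Rightarrow> 'u \<Rightarrow> int" and g :: "nat \<Rightarrow> 'u \<Rightarrow> (nat \<times> nat) \<times> nat"
begin

text \<open>\<open>\<theta>\<close> and \<open>\<tau>\<close> are recomputed from the counters at
  each step. Since the counters no longer change once the sketching phases are over, both are
  constant during the passes.\<close>

definition absorb :: "label \<times> 'u \<Rightarrow> int list \<times> 'u finder \<Rightarrow> int list \<times> 'u finder" where
  "absorb z s = (if fst (fst z) < D then (map (\<lambda>k. fst s ! k + sg k (snd z)) [0..<m], snd s)
     else (fst s, react c M (\<tau> (fst s)) (event_of L (\<theta> (fst s)) (g (fst (fst z))) (fst z) (snd z)) (snd s)))"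

lemma fold_absorb_sketch:
  assumes "\<forall>z\<in>set zs. fst (fst z) < D" "length a = m"
  shows "fold absorb zs (a, st) = (map (\<lambda>k. a ! k + (\<Sum>z\<leftarrow>zs. sg k (snd z))) [0..<m], st)"
  using assms
proof (induction zs arbitrary: a)
  case Nil
  then show ?case
    by (auto intro: nth_equalityI)
next
  case (Cons z zs)
  then show ?case
    by (simp add: absorb_def[of z] add.assoc)
qed

lemma fold_absorb_find:
  assumes "\<forall>z\<in>set zs. \<not> fst (fst z) < D"
  shows "fold absorb zs (a, st) = (a, fold (react c M (\<tau> a))
    (map (\<lambda>z. event_of L (\<theta> a) (g (fst (fst z))) (fst z) (snd z)) zs) st)"
  using assms by (induction zs arbitrary: st) (auto simp: absorb_def)

context
  fixes zs :: "(label \<times> 'u) list" and xs :: "'u list" and lab :: "nat \<Rightarrow> label" and a :: "int list"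
  assumes zs: "mset zs = mset (zip (map lab [0..<length xs]) xs)"
    and sorted: "sorted (map (\<lambda>z. schedule_key (fst z)) zs)"
    and a: "a = map (\<lambda>k. \<Sum>j<length xs. of_bool (fst (lab j) < D) * sg k (xs ! j)) [0..<m]"
begin

definition evs :: "'u event list" where
  "evs = map (\<lambda>z. event_of L (\<theta> a) (g (fst (fst z))) (fst z) (snd z)) (filter (\<lambda>z. \<not> fst (fst z) < D) zs)"

lemma fold_absorb_sorted:
  "fold absorb zs (replicate m 0, finder_init) = (a, fold (react c M (\<tau> a)) evs finder_init)"
proof -
  \<comment> \<open>The phase leads the key, so all sketching copies come before all copies of the
    passes.\<close>
  let ?cl = "\<lambda>z. if fst (fst z) < D then 0 else 1 :: nat"
  have srt: "sorted (map ?cl zs)"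
    using sorted unfolding sorted_map
    by (rule sorted_wrt_mono_rel[rotated]) (auto simp: schedule_key_def split: if_splits)
  have c0: "filter (\<lambda>z. ?cl z = 0) zs = filter (\<lambda>z. fst (fst z) < D) zs"
    and c1: "filter (\<lambda>z. Suc 0 \<le> ?cl z) zs = filter (\<lambda>z. \<not> fst (fst z) < D) zs"
    by (auto intro!: filter_cong)
  from sorted_filter_split[OF srt, of 0]
  have "filter (\<lambda>z. 0 \<le> ?cl z) zs =
      filter (\<lambda>z. fst (fst z) < D) zs @ filter (\<lambda>z. \<not> fst (fst z) < D) zs"
    unfolding c0 c1 .
  then have split: "zs = filter (\<lambda>z. fst (fst z) < D) zs @ filter (\<lambda>z. \<not> fst (fst z) < D) zs"
    by simp
  have "(\<Sum>z\<leftarrow>filter (\<lambda>z. fst (fst z) < D) zs. sg k (snd z)) =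
      (\<Sum>j<length xs. of_bool (fst (lab j) < D) * sg k (xs ! j))" for k
  proof -
    have "(\<Sum>z\<leftarrow>filter (\<lambda>z. fst (fst z) < D) zs. sg k (snd z)) =
        (\<Sum>z\<leftarrow>zs. of_bool (fst (fst z) < D) * sg k (snd z))"
      by (induction zs) auto
    also have "\<dots> = (\<Sum>z\<in>#mset zs. of_bool (fst (fst z) < D) * sg k (snd z))"
      by (simp only: mset_map[symmetric] sum_mset_sum_list)
    also have "\<dots> = (\<Sum>z\<leftarrow>zip (map lab [0..<length xs]) xs. of_bool (fst (fst z) < D) * sg k (snd z))"
      by (simp only: zs mset_map[symmetric] sum_mset_sum_list)
    also have "\<dots> = (\<Sum>j<length xs. of_bool (fst (lab j) < D) * sg k (xs ! j))"
      by (simp add: sum_list_sum_nth lessThan_atLeast0)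
    finally show ?thesis .
  qed
  then have "fold absorb (filter (\<lambda>z. fst (fst z) < D) zs) (replicate m 0, finder_init) = (a, finder_init)"
    by (subst fold_absorb_sketch) (auto simp: a)
  then show ?thesis
    by (subst split, subst fold_append) (simp add: fold_absorb_find evs_def)
qed

lemma evs_memD:
  assumes "v \<in> set evs"
  obtains j where "j < length xs" "\<not> fst (lab j) < D"
    "v = event_of L (\<theta> a) (g (fst (lab j))) (lab j) (xs ! j)"
proof -
  obtain z where z: "z \<in> set zs" "\<not> fst (fst z) < D" "v = event_of L (\<theta> a) (g (fst (fst z))) (fst z) (snd z)"
    using assms by (auto simp: evs_def)
  then have "z \<in> set (zip (map lab [0..<length xs]) xs)"
    using zs by (metis set_mset_mset)
  then obtain j where "j < length xs" "z = (lab j, xs ! j)"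
    by (auto simp: set_zip)
  then show ?thesis
    using that z by auto
qed

lemma count_list_evs_Tally:
  "count_list evs (Tally (\<delta>, e) y) \<le>
    card {j. j < length xs \<and> fst (lab j) = \<delta> \<and> \<not> \<delta> < D \<and> tallies L e (snd (lab j)) \<and> xs ! j = y}"
  unfolding evs_def count_list_map_filter filter_filter length_filter_mset_zip[OF zs]
  by (intro card_mono) (auto simp: event_of_eq_Tally)

text \<open>No tally carries a sketching phase, so a report attributed to such a phase would need
  \<open>\<tau> a \<le> 0\<close>. This is the last disjunct, which a positive threshold rules
  out.\<close>

lemma out_sound:
  assumes "y \<in> set (snd (snd (fold (react c M (\<tau> a)) evs finder_init)))"
  shows "\<exists>\<delta> e. \<not> \<delta> < D \<and> \<tau> a \<le>
    real (card {j. j < length xs \<and> fst (lab j) = \<delta> \<and> tallies L e (snd (lab j)) \<and> xs ! j = y}) \<or> \<tau> a \<le> 0"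
proof -
  obtain T0 S r out where st: "fold (react c M (\<tau> a)) evs finder_init = ((T0, S), r, out)"
    by (rule finder_cases)
  obtain E where E: "\<tau> a \<le> real (count_list evs (Tally E y))"
    using finder_sound[OF st] assms st by auto
  obtain \<delta> e where \<delta>: "E = (\<delta>, e)"
    by (cases E)
  show ?thesis
  proof (cases "\<delta> < D")
    case True
    then have "count_list evs (Tally E y) = 0"
      using count_list_evs_Tally[of \<delta> e y] \<delta> by simp
    then show ?thesis
      using E by simp
  next
    case False
    then have "\<tau> a \<le> real (card {j. j < length xs \<and> fst (lab j) = \<delta> \<and> tallies L e (snd (lab j)) \<and> xs ! j = y})"
      using E count_list_evs_Tally[of \<delta> e y] unfolding \<delta> by simp
    then show ?thesis
      using False by blast
  qed
qed

lemma out_bounded: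
  "distinct (snd (snd (fold (react c M (\<tau> a)) evs finder_init)))"
  by (rule finder_cases[of "fold (react c M (\<tau> a)) evs finder_init"]) (use finder_sound in fastforce)

text \<open>The sorted stream is cut at the two steps of the slot of \<open>x\<close>, and the
  conditions in \<open>found\<close> about copies are translated into conditions about the resulting
  event blocks.\<close>

lemma out_complete:
  assumes \<delta>: "\<not> \<delta> < D" and lL: "snd (fst (g \<delta> x)) < L" and \<tau>: "0 < \<tau> a"
    and found: "found L c (\<theta> a) (\<tau> a) xs {j. j < length xs \<and> fst (lab j) = \<delta>} x (\<lambda>j. snd (lab j)) (g \<delta>)"
  shows "x \<in> set (snd (snd (fold (react c M (\<tau> a)) evs finder_init))) \<or>
    M \<le> length (snd (snd (fold (react c M (\<tau> a)) evs finder_init)))"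
proof -
  obtain e l hx where gx: "g \<delta> x = ((e, l), hx)"
    by (metis prod.exhaust)
  let ?J = "{j. j < length xs \<and> fst (lab j) = \<delta>}"
  let ?T = "(\<delta>, e, l)"
  \<comment> \<open>\<open>sp u v i\<close> is 0 below \<open>v\<close>, 4 above \<open>v\<close>,
    and \<open>i\<close> at \<open>v\<close>. Nested over phase and epoch it gives five classes: 0
    before the store step, 1 the store step, 2 the probe step, 3 the rest of the epoch, 4
    later.\<close>
  define sp where "sp u v i = (if u < v then 0 else if v < u then 4 else i)" for u v i :: nat
  define cl :: "label \<times> 'u \<Rightarrow> nat" where "cl z = (case fst z of (\<delta>', e', r, _) \<Rightarrow>
    sp \<delta>' \<delta> (sp e' e (if r < 2 * l then 0 else if r = 2 * l then 1 else if r = 2 * l + 1 then 2 else 3)))" for z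
  have sp: "sp u v i \<le> sp u' v i'" if "u < u' \<or> u = u' \<and> i \<le> i'" "i \<le> 4" for u u' v i i'
    using that by (auto simp: sp_def)
  have sp4: "i \<le> 4 \<Longrightarrow> sp u v i \<le> 4" for u v i
    by (auto simp: sp_def)
  define ev :: "label \<times> 'u \<Rightarrow> 'u event" where
    "ev z = event_of L (\<theta> a) (g (fst (fst z))) (fst z) (snd z)" for z
  define Y where "Y = filter (\<lambda>z. \<not> fst (fst z) < D) zs"
  have mono: "cl z \<le> cl z'" if "schedule_key (fst z) \<le> schedule_key (fst z')" for z z' :: "label \<times> 'u"
  proof -
    obtain d1 e1 r1 k1 d2 e2 r2 k2 where z: "fst z = (d1, e1, r1, k1)" "fst z' = (d2, e2, r2, k2)"
      by (metis prod_cases4)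
    have "d1 < d2 \<or> d1 = d2 \<and> (e1 < e2 \<or> e1 = e2 \<and> r1 \<le> r2)"
      using that z by (auto simp: schedule_key_def)
    then show ?thesis
      unfolding cl_def z prod.case by (intro sp sp4) (auto intro!: sp)
  qed
  have "sorted_wrt (\<lambda>z z'. schedule_key (fst z) \<le> schedule_key (fst z')) Y"
    using sorted unfolding Y_def sorted_map by (intro sorted_wrt_filter)
  then have sortedY: "sorted (map cl Y)"
    unfolding sorted_map by (rule sorted_wrt_mono_rel[rotated]) (use mono in auto)
  define F where "F i = filter (\<lambda>z. cl z = i) Y" for i
  have le4: "cl z \<le> 4" for z
    by (auto simp: cl_def intro!: sp4 split: prod.split)
  then have "filter (\<lambda>z. 5 \<le> cl z) Y = []"
    by (auto simp: filter_empty_conv) (metis Suc_n_not_le_n eval_nat_numeral(3) order_trans)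
  then have Y: "Y = F 0 @ F 1 @ F 2 @ F 3 @ F 4"
    using sorted_filter_split[OF sortedY, of 0] sorted_filter_split[OF sortedY, of 1]
      sorted_filter_split[OF sortedY, of 2] sorted_filter_split[OF sortedY, of 3]
      sorted_filter_split[OF sortedY, of 4]
    by (simp add: F_def numeral_eq_Suc)
  have cl1: "cl z = 1 \<longleftrightarrow> (\<exists>k. fst z = (\<delta>, e, 2 * l, k))" for z
    by (cases "fst z") (auto simp: cl_def sp_def)
  have cl2: "cl z = 2 \<longleftrightarrow> (\<exists>k. fst z = (\<delta>, e, 2 * l + 1, k))" for z
    by (cases "fst z") (auto simp: cl_def sp_def)
  have cl3: "cl z = 3 \<longleftrightarrow> (\<exists>r k. fst z = (\<delta>, e, r, k) \<and> 2 * l + 1 < r)" for z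
    by (cases "fst z") (auto simp: cl_def sp_def)
  have lL': "l < L"
    using lL gx by simp
  show ?thesis
  proof (rule finder_complete[where T = ?T and hx = hx])
    show "evs = map ev (F 0) @ map ev (F 1) @ map ev (F 2) @ map ev (F 3) @ map ev (F 4)"
      unfolding evs_def ev_def[symmetric] Y_def[symmetric] by (subst Y) simp
    show "Store ?T h \<notin> set (map ev (F 0))" for h
    proof
      assume "Store ?T h \<in> set (map ev (F 0))"
      then obtain z where "z \<in> set (F 0)" and z: "ev z = Store ?T h"
        by (metis imageE set_map)
      then have "cl z = 0"
        by (simp add: F_def)
      then show False
        using z cl1[of z] by (cases "fst z") (auto simp: ev_def event_of_eq_Store stores_def)
    qed
    show "\<forall>v\<in>set (map ev (F 1)). v = Skip \<or> (\<exists>h. v = Store ?T h)"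
    proof
      fix v assume "v \<in> set (map ev (F 1))"
      then obtain z where "v = ev z" "cl z = 1"
        by (auto simp: F_def)
      then show "v = Skip \<or> (\<exists>h. v = Store ?T h)"
        using lL' cl1[of z] by (auto simp: ev_def event_of_def)
    qed
    show "\<forall>v\<in>set (map ev (F 2)). v = Skip \<or> (\<exists>h y. v = Probe ?T h y)"
    proof
      fix v assume "v \<in> set (map ev (F 2))"
      then obtain z where "v = ev z" "cl z = 2"
        by (auto simp: F_def)
      then show "v = Skip \<or> (\<exists>h y. v = Probe ?T h y)"
        using lL' cl2[of z] by (auto simp: ev_def event_of_def)
    qed
    show "\<forall>T' h y. Probe T' h y \<in> set (map ev (F 3)) \<longrightarrow> epoch T' = epoch ?T"
    proof (intro allI impI)
      fix T' h y assume "Probe T' h y \<in> set (map ev (F 3))"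
      then obtain z where "z \<in> set (F 3)" and z: "ev z = Probe T' h y"
        by (metis imageE set_map)
      then have "cl z = 3"
        by (simp add: F_def)
      then show "epoch T' = epoch ?T"
        using z cl3[of z] by (cases T') (auto simp: ev_def event_of_eq_Probe probes_def epoch_def)
    qed
    have in_Y: "(lab j, xs ! j) \<in> set Y" if "j \<in> ?J" for j
    proof -
      have "(lab j, xs ! j) \<in> set (zip (map lab [0..<length xs]) xs)"
        using that by (auto simp: set_zip intro!: exI[of _ j])
      then have "(lab j, xs ! j) \<in> set zs"
        using zs by (metis set_mset_mset)
      then show ?thesis
        using that \<delta> by (simp add: Y_def)
    qed
    show "Store ?T hx \<in> set (map ev (F 1))"
    proof -
      obtain j where j: "j \<in> ?J" "xs ! j = x" "stores (\<theta> a) (e, l) (snd (lab j))"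
        using found gx by (auto simp: found_def)
      then obtain k where k: "lab j = (\<delta>, e, 2 * l, k)"
        by (cases "lab j") (auto simp: stores_def)
      have "cl (lab j, xs ! j) = 1"
        by (subst cl1) (simp add: k)
      moreover have "ev (lab j, xs ! j) = Store ?T hx"
        using j lL' gx by (simp add: ev_def event_of_eq_Store event_of_eq_Probe)
      ultimately show ?thesis
        using in_Y[OF j(1)] by (force simp: F_def)
    qed
    show "Probe ?T hx x \<in> set (map ev (F 2))"
    proof -
      obtain j where j: "j \<in> ?J" "xs ! j = x" "probes (\<theta> a) (e, l) (snd (lab j))"
        using found gx by (auto simp: found_def)
      then obtain k where k: "lab j = (\<delta>, e, 2 * l + 1, k)"
        by (cases "lab j") (auto simp: probes_def)
      have "cl (lab j, xs ! j) = 2"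
        by (subst cl2) (simp add: k)
      moreover have "ev (lab j, xs ! j) = Probe ?T hx x"
        using j lL' gx by (simp add: ev_def event_of_eq_Store event_of_eq_Probe)
      ultimately show ?thesis
        using in_Y[OF j(1)] by (force simp: F_def)
    qed
    have evs_eq: "evs = map ev Y"
      unfolding evs_def ev_def Y_def ..
    have StoreD: "\<exists>j\<in>?J. stores (\<theta> a) (e', l') (snd (lab j)) \<and> g \<delta> (xs ! j) = ((e', l'), h)"
      if "Store (\<delta>, e', l') h \<in> set evs" for e' l' h
      using that by (elim evs_memD) (metis (mono_tags, lifting) event_of_eq_Store mem_Collect_eq)
    show "card {h. Store ?T h \<in> set (map ev (F 1))} \<le> c"
    proof -
      let ?K = "{j \<in> ?J. xs ! j \<noteq> x \<and> fst (g \<delta> (xs ! j)) = (e, l) \<and> stores (\<theta> a) (e, l) (snd (lab j))}"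
      \<comment> \<open>All copies of \<open>x\<close> share the identifier \<open>hx\<close>; the
        strict inequality in \<open>found\<close> leaves room for this one.\<close>
      have "{h. Store ?T h \<in> set (map ev (F 1))} \<subseteq> insert hx ((\<lambda>j. snd (g \<delta> (xs ! j))) ` ?K)"
      proof
        fix h assume "h \<in> {h. Store ?T h \<in> set (map ev (F 1))}"
        then have "Store ?T h \<in> set evs"
          by (auto simp: evs_eq F_def)
        then obtain j where "j \<in> ?J" "stores (\<theta> a) (e, l) (snd (lab j))" "g \<delta> (xs ! j) = ((e, l), h)"
          using StoreD by blast
        then show "h \<in> insert hx ((\<lambda>j. snd (g \<delta> (xs ! j))) ` ?K)"
          using gx by (cases "xs ! j = x") (auto intro!: image_eqI[of _ _ j])
      qed
      then have "card {h. Store ?T h \<in> set (map ev (F 1))} \<le> card (insert hx ((\<lambda>j. snd (g \<delta> (xs ! j))) ` ?K))"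
        by (intro card_mono) auto
      also have "\<dots> \<le> Suc (card ?K)"
        using card_image_le[of ?K "\<lambda>j. snd (g \<delta> (xs ! j))"] by (auto intro: card_insert_le_m1 simp: card_insert_if)
      also have "\<dots> \<le> c"
        using found gx by (simp add: found_def)
      finally show ?thesis .
    qed
    show "y = x" if T': "epoch T' = epoch ?T" and P: "Probe T' h y \<in> set evs" and S: "Store T' h \<in> set evs" for T' h y
    proof -
      obtain l' where l': "T' = (\<delta>, e, l')"
        using T' by (cases T') (auto simp: epoch_def)
      obtain i where i: "i \<in> ?J" "probes (\<theta> a) (e, l') (snd (lab i))" "g \<delta> (xs ! i) = ((e, l'), h)" "xs ! i = y"
        using P unfolding l' by (elim evs_memD) (metis (mono_tags, lifting) event_of_eq_Probe mem_Collect_eq)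
      obtain j where j: "j \<in> ?J" "stores (\<theta> a) (e, l') (snd (lab j))" "g \<delta> (xs ! j) = ((e, l'), h)"
        using StoreD S unfolding l' by blast
      show ?thesis
      proof (rule ccontr)
        assume "y \<noteq> x"
        then have "\<exists>i\<in>?J. \<exists>j\<in>?J. xs ! i \<noteq> x \<and> fst (fst (g \<delta> (xs ! i))) = fst (fst (g \<delta> x)) \<and>
         g \<delta> (xs ! j) = g \<delta> (xs ! i) \<and> probes (\<theta> a) (fst (g \<delta> (xs ! i))) (snd (lab i)) \<and>
         stores (\<theta> a) (fst (g \<delta> (xs ! i))) (snd (lab j))"
          using i j gx by (intro bexI[OF _ i(1)] bexI[OF _ j(1)]) auto
        then show False
          using found unfolding found_def by blast
      qed
    qed
    \<comment> \<open>Because of \<open>l < L\<close>, every counting step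
      \<open>2 * L \<le> r\<close> comes after the probe step \<open>2 * l + 1\<close>, hence falls
      into class 3.\<close>
    have "{j. j < length xs \<and> fst (lab j) = \<delta> \<and> xs ! j = x \<and> tallies L e (snd (lab j))} \<subseteq>
      {j. j < length xs \<and> (ev (lab j, xs ! j) = Tally (epoch ?T) x \<and> cl (lab j, xs ! j) = 3 \<and> \<not> fst (lab j) < D)}"
      using lL' \<delta> by (auto simp: ev_def epoch_def event_of_eq_Tally tallies_def cl3 prod_eq_iff)
    then have "card {j. j < length xs \<and> fst (lab j) = \<delta> \<and> xs ! j = x \<and> tallies L e (snd (lab j))} \<le>
      count_list (map ev (F 3)) (Tally (epoch ?T) x)"
      unfolding F_def Y_def count_list_map_filter filter_filter length_filter_mset_zip[OF zs]
      by (intro card_mono) (auto simp: conj_ac)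
    then show "\<tau> a \<le> real (count_list (map ev (F 3)) (Tally (epoch ?T) x))"
      using found gx by (auto simp: found_def intro: order_trans)
  qed (rule \<tau>)
qed

end

end

section \<open>Failure probability of one pass\<close>

lemma pr_PiE_all:
  assumes "finite I" "finite A" "A \<noteq> {}" "K \<subseteq> I"
  shows "pr (PiE I (\<lambda>_. A)) (\<lambda>\<omega>. \<forall>j\<in>K. P (\<omega> j)) = pr A P ^ card K"
proof -
  have "pr (PiE I (\<lambda>_. A)) (\<lambda>\<omega>. \<forall>j\<in>K. P (\<omega> j)) =
      avg (PiE I (\<lambda>_. A)) (\<lambda>\<omega>. \<Prod>j\<in>I. if j \<in> K then of_bool (P (\<omega> j)) else 1)"
    unfolding pr_def
  proof (intro avg_cong)
    fix \<omega>
    have "finite K"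
      using assms finite_subset by blast
    then have "of_bool (\<forall>j\<in>K. P (\<omega> j)) = (\<Prod>j\<in>K. of_bool (P (\<omega> j)) :: real)"
      by (induction K) auto
    also have "\<dots> = (\<Prod>j\<in>I. if j \<in> K then of_bool (P (\<omega> j)) else 1)"
      using assms by (intro prod.mono_neutral_cong_left) auto
    finally show "of_bool (\<forall>j\<in>K. P (\<omega> j)) = (\<Prod>j\<in>I. if j \<in> K then of_bool (P (\<omega> j)) else 1 :: real)" .
  qed
  also have "\<dots> = (\<Prod>j\<in>I. avg A (\<lambda>a. if j \<in> K then of_bool (P a) else 1))"
    using assms by (intro avg_PiE_prod[where f = "\<lambda>j a. if j \<in> K then of_bool (P a) else 1"]) auto
  also have "\<dots> = (\<Prod>j\<in>I. if j \<in> K then pr A P else 1)"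
    using assms by (intro prod.cong) (auto simp: pr_def avg_const)
  also have "\<dots> = (\<Prod>j\<in>K. pr A P)"
    using assms by (intro prod.mono_neutral_cong_right) auto
  finally show ?thesis
    by simp
qed

lemma pr_not: "finite S \<Longrightarrow> S \<noteq> {} \<Longrightarrow> pr S (\<lambda>x. \<not> P x) = 1 - pr S P"
  using avg_diff[of S "\<lambda>_. 1" "\<lambda>x. of_bool (P x)"] by (simp add: pr_def avg_const of_bool_not_iff)

lemma of_nat_card_filter: "finite J \<Longrightarrow> real (card {j \<in> J. P j}) = (\<Sum>j\<in>J. of_bool (P j))"
  by (simp add: Int_def of_bool_def sum.If_cases)

text \<open>\<open>J\<close> consists of the copies assigned to this pass. Labels are nevertheless
  drawn for all \<open>n\<close> copies, which makes the space of labels independent of the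
  assignment of phases.\<close>

locale pass =
  fixes Ep L n H :: nat and U :: "'u set" and xs :: "'u list" and J :: "nat set"
  assumes pos: "0 < Ep" "0 < L" "0 < n" "0 < H"
    and U: "finite U" and J: "J \<subseteq> {..<n}" and xsU: "\<And>j. j \<in> J \<Longrightarrow> xs ! j \<in> U"
begin

definition "A = {..<Ep} \<times> {..<4 * L} \<times> {..<n}"
definition "B = ({..<Ep} \<times> {..<L}) \<times> {..<H}"
definition "PA = PiE {..<n} (\<lambda>_. A)"
definition "PB = PiE U (\<lambda>_. B)"
text \<open>The probability that a given copy takes part in a given store step, and likewise in a
  given probe step: one of \<open>Ep\<close> epochs, one of \<open>4 * L\<close> steps, and a mark
  below \<open>\<theta>\<close> out of \<open>n\<close>.\<close>

definition t :: "nat \<Rightarrow> real" where "t \<theta> = real \<theta> / (real Ep * (4 * real L) * real n)"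

lemma fin: "finite A" "A \<noteq> {}" "finite B" "B \<noteq> {}" "finite PA" "PA \<noteq> {}" "finite PB" "PB \<noteq> {}" "finite J"
proof -
  show AB: "finite A" "A \<noteq> {}" "finite B" "B \<noteq> {}"
    using pos by (auto simp: A_def B_def lessThan_empty_iff)
  show "finite PA" "PA \<noteq> {}" "finite PB" "PB \<noteq> {}"
    using AB U finite_PiE_nonempty[of "{..<n}" "\<lambda>_. A"] finite_PiE_nonempty[of U "\<lambda>_. B"]
    by (auto simp: PA_def PB_def)
  show "finite J"
    using J finite_subset by blast
qed

lemma cards: "card A = Ep * (4 * L) * n" "card B = Ep * L * H"
  by (simp_all add: A_def B_def card_cartesian_product)

lemma pr_stores:
  assumes "s \<in> {..<Ep} \<times> {..<L}" "\<theta> \<le> n"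
  shows "pr A (stores \<theta> s) = t \<theta>"
proof -
  have "A \<inter> {p. stores \<theta> s p} = {fst s} \<times> {2 * snd s} \<times> {..<\<theta>}"
    using assms by (auto simp: A_def stores_def)
  then show ?thesis
    using fin pr_mem[of A "{p. stores \<theta> s p}"] by (simp add: cards t_def card_cartesian_product)
qed

lemma pr_probes:
  assumes "s \<in> {..<Ep} \<times> {..<L}" "\<theta> \<le> n"
  shows "pr A (probes \<theta> s) = t \<theta>"
proof -
  have "A \<inter> {p. probes \<theta> s p} = {fst s} \<times> {2 * snd s + 1} \<times> {..<\<theta>}"
    using assms by (auto simp: A_def probes_def)
  then show ?thesis
    using fin pr_mem[of A "{p. probes \<theta> s p}"] by (simp add: cards t_def card_cartesian_product)
qed

lemma pr_tallies:
  assumes "e < Ep"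
  shows "pr A (tallies L e) = 1 / (2 * real Ep)"
proof -
  have "A \<inter> {p. tallies L e p} = {e} \<times> {2 * L..<4 * L} \<times> {..<n}"
    using assms by (auto simp: A_def tallies_def)
  then show ?thesis
    using fin pr_mem[of A "{p. tallies L e p}"] pos
    by (simp add: cards card_cartesian_product field_simps)
qed

lemma pr_slot: "s \<in> {..<Ep} \<times> {..<L} \<Longrightarrow> pr B (\<lambda>b. fst b = s) = 1 / (real Ep * real L)"
proof -
  assume "s \<in> {..<Ep} \<times> {..<L}"
  then have "B \<inter> {b. fst b = s} = {s} \<times> {..<H}"
    by (auto simp: B_def)
  then show ?thesis
    using fin pr_mem[of B "{b. fst b = s}"] pos by (simp add: cards card_cartesian_product)
qed

lemma pr_epoch: "e < Ep \<Longrightarrow> pr B (\<lambda>b. fst (fst b) = e) = 1 / real Ep"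
proof -
  assume "e < Ep"
  then have "B \<inter> {b. fst (fst b) = e} = ({e} \<times> {..<L}) \<times> {..<H}"
    by (auto simp: B_def)
  then show ?thesis
    using fin pr_mem[of B "{b. fst (fst b) = e}"] pos by (simp add: cards card_cartesian_product)
qed

lemma pr_point: "b0 \<in> B \<Longrightarrow> pr B (\<lambda>b. b = b0) = 1 / (real Ep * real L * real H)"
proof -
  assume "b0 \<in> B"
  then have "B \<inter> {b. b = b0} = {b0}"
    by auto
  then show ?thesis
    using fin pr_mem[of B "{b. b = b0}"] by (simp add: cards)
qed

lemma PB_slot: "g \<in> PB \<Longrightarrow> y \<in> U \<Longrightarrow> g y \<in> B \<and> fst (g y) \<in> {..<Ep} \<times> {..<L} \<and> fst (fst (g y)) < Ep \<and> snd (fst (g y)) < L"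
  using PiE_mem[of g U "\<lambda>_. B" y] unfolding PB_def by (auto simp: B_def)

lemma t_bounds: "\<theta> \<le> n \<Longrightarrow> 0 \<le> t \<theta> \<and> t \<theta> \<le> 1"
  using pr_stores[of "(0, 0)" \<theta>] pr_le_1[of A "stores \<theta> (0, 0)"] pr_nonneg[of A "stores \<theta> (0, 0)"] pos by auto

lemma pr_none:
  assumes "pr A P = q" "0 \<le> q" "q \<le> 1"
  shows "pr PA (\<lambda>p. \<not> (\<exists>j\<in>J. xs ! j = x \<and> P (p j))) \<le> exp (- q * real (card {j \<in> J. xs ! j = x}))"
proof -
  let ?K = "{j \<in> J. xs ! j = x}"
  have "pr PA (\<lambda>p. \<not> (\<exists>j\<in>J. xs ! j = x \<and> P (p j))) = pr PA (\<lambda>p. \<forall>j\<in>?K. \<not> P (p j))"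
    by (intro pr_cong) auto
  also have "\<dots> = (1 - q) ^ card ?K"
    unfolding PA_def using fin J pr_not[of A P] assms by (subst pr_PiE_all) auto
  also have "\<dots> \<le> exp (- q) ^ card ?K"
    using assms exp_ge_add_one_self[of "- q"] by (intro power_mono) auto
  also have "\<dots> = exp (- q * real (card ?K))"
    by (simp add: exp_of_nat_mult[symmetric] mult.commute)
  finally show ?thesis .
qed

text \<open>Markov's inequality: a copy of another item is hashed to the slot of \<open>x\<close>
  with probability \<open>1 / (Ep * L)\<close> and independently stores there with probability
  \<open>t \<theta>\<close>.\<close>

lemma pr_crowded:
  assumes "\<theta> \<le> n" "0 < c" "x \<in> U"
  shows "pr (PA \<times> PB) (\<lambda>(p, g). \<not> card {j \<in> J. xs ! j \<noteq> x \<and> fst (g (xs ! j)) = fst (g x) \<and> stores \<theta> (fst (g x)) (p j)} < c)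
    \<le> real (card J) * t \<theta> / (real Ep * real L) / real c"
proof -
  let ?N = "\<lambda>p g. card {j \<in> J. xs ! j \<noteq> x \<and> fst (g (xs ! j)) = fst (g x) \<and> stores \<theta> (fst (g x)) (p j)}"
  have "pr (PA \<times> PB) (\<lambda>(p, g). \<not> ?N p g < c) = pr (PA \<times> PB) (\<lambda>z. real c \<le> real (?N (fst z) (snd z)))"
    by (intro pr_cong) auto
  also have "\<dots> \<le> avg (PA \<times> PB) (\<lambda>z. real (?N (fst z) (snd z))) / real c"
    using assms by (intro pr_markov) auto
  also have "avg (PA \<times> PB) (\<lambda>z. real (?N (fst z) (snd z))) = avg PB (\<lambda>g. avg PA (\<lambda>p. real (?N p g)))"
    by (simp add: avg_Times avg_swap[of PA])
  also have "\<dots> = avg PB (\<lambda>g. \<Sum>j\<in>J. of_bool (xs ! j \<noteq> x \<and> fst (g (xs ! j)) = fst (g x)) * t \<theta>)"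
  proof (intro avg_cong)
    fix g assume g: "g \<in> PB"
    have "avg PA (\<lambda>p. real (?N p g)) =
        (\<Sum>j\<in>J. avg PA (\<lambda>p. of_bool (xs ! j \<noteq> x \<and> fst (g (xs ! j)) = fst (g x)) * of_bool (stores \<theta> (fst (g x)) (p j))))"
      unfolding avg_sum[symmetric] using fin by (simp add: of_nat_card_filter of_bool_conj mult.assoc)
    also have "\<dots> = (\<Sum>j\<in>J. of_bool (xs ! j \<noteq> x \<and> fst (g (xs ! j)) = fst (g x)) * t \<theta>)"
    proof (intro sum.cong refl)
      fix j assume j: "j \<in> J"
      have "avg PA (\<lambda>p. of_bool (stores \<theta> (fst (g x)) (p j))) = pr A (stores \<theta> (fst (g x)))"
        unfolding PA_def pr_def using fin J j by (intro avg_PiE_1[where F = "\<lambda>a. of_bool (stores \<theta> (fst (g x)) a)"]) auto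
      also have "\<dots> = t \<theta>"
        using PB_slot[OF g \<open>x \<in> U\<close>] assms by (intro pr_stores) auto
      finally show "avg PA (\<lambda>p. of_bool (xs ! j \<noteq> x \<and> fst (g (xs ! j)) = fst (g x)) * of_bool (stores \<theta> (fst (g x)) (p j))) =
          of_bool (xs ! j \<noteq> x \<and> fst (g (xs ! j)) = fst (g x)) * t \<theta>"
        by (simp add: avg_cmult)
    qed
    finally show "avg PA (\<lambda>p. real (?N p g)) = (\<Sum>j\<in>J. of_bool (xs ! j \<noteq> x \<and> fst (g (xs ! j)) = fst (g x)) * t \<theta>)" .
  qed
  also have "\<dots> = (\<Sum>j\<in>J. avg PB (\<lambda>g. of_bool (xs ! j \<noteq> x \<and> fst (g (xs ! j)) = fst (g x))) * t \<theta>)"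
    by (simp add: avg_sum avg_cmult_right)
  also have "\<dots> \<le> (\<Sum>j\<in>J. 1 / (real Ep * real L) * t \<theta>)"
  proof (intro sum_mono mult_right_mono)
    fix j assume j: "j \<in> J"
    show "avg PB (\<lambda>g. of_bool (xs ! j \<noteq> x \<and> fst (g (xs ! j)) = fst (g x))) \<le> 1 / (real Ep * real L)"
    proof (cases "xs ! j = x")
      case False
      have "avg PB (\<lambda>g. of_bool (fst (g (xs ! j)) = fst (g x))) =
          avg B (\<lambda>a. avg B (\<lambda>b. of_bool (fst b = fst a)))"
        unfolding PB_def using fin U False assms xsU[OF j]
        by (intro avg_PiE_2[where F = "\<lambda>a b. of_bool (fst b = fst a)" and i = x]) auto
      also have "\<dots> = avg B (\<lambda>a. 1 / (real Ep * real L))"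
        using pr_slot by (intro avg_cong) (auto simp: pr_def B_def)
      finally show ?thesis
        using False fin by (simp add: avg_const)
    qed simp
  qed (use t_bounds[OF assms(1)] in simp)
  also have "\<dots> = real (card J) * t \<theta> / (real Ep * real L)"
    by simp
  finally show ?thesis
    using assms by (simp add: divide_right_mono)
qed

text \<open>A union bound over pairs of a probing copy \<open>i\<close> and a storing copy
  \<open>j\<close>, with \<open>t \<theta>\<close> for each by independence. The three terms are:
  \<open>j\<close> has the item of \<open>i\<close>, which only has to share the epoch of
  \<open>x\<close>; \<open>j\<close> is a copy of \<open>x\<close>, so the hash values collide;
  \<open>j\<close> has a third item, which requires both a collision and the epoch of
  \<open>x\<close>.\<close>

lemma pr_false_match:
  assumes "\<theta> \<le> n" "x \<in> U"
  shows "pr (PA \<times> PB) (\<lambda>(p, g). \<exists>i\<in>J. \<exists>j\<in>J. xs ! i \<noteq> x \<and> fst (fst (g (xs ! i))) = fst (fst (g x)) \<and>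
         g (xs ! j) = g (xs ! i) \<and> probes \<theta> (fst (g (xs ! i))) (p i) \<and> stores \<theta> (fst (g (xs ! i))) (p j))
    \<le> (t \<theta>)\<^sup>2 * ((\<Sum>i\<in>J. real (card {j \<in> J. xs ! j = xs ! i})) / real Ep
       + real (card J) * real (card {j \<in> J. xs ! j = x}) / (real Ep * real L * real H)
       + (real (card J))\<^sup>2 / (real Ep * (real Ep * real L * real H)))"
proof -
  let ?Q = "\<lambda>i j g. xs ! i \<noteq> x \<and> fst (fst (g (xs ! i))) = fst (fst (g x)) \<and> g (xs ! j) = g (xs ! i)"
  let ?R = "\<lambda>i j g p. probes \<theta> (fst (g (xs ! i))) (p i) \<and> stores \<theta> (fst (g (xs ! i))) (p j)"
  let ?b = "\<lambda>i j. (t \<theta>)\<^sup>2 * (of_bool (xs ! j = xs ! i) / real Ep + of_bool (xs ! j = x) / (real Ep * real L * real H)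
      + 1 / (real Ep * (real Ep * real L * real H)))"
  have one: "pr (PA \<times> PB) (\<lambda>(p, g). ?Q i j g \<and> ?R i j g p) \<le> ?b i j" if ij: "i \<in> J" "j \<in> J" for i j
  proof (cases "xs ! i = x")
    case True
    then show ?thesis
      by (simp add: pr_def case_prod_unfold)
  next
    case False
    have R: "pr PA (?R i j g) \<le> (t \<theta>)\<^sup>2" if g: "g \<in> PB" for g
    proof (cases "i = j")
      \<comment> \<open>One copy cannot do both, since store steps are even and probe steps are
        odd.\<close>
      case True
      have "pr PA (?R i j g) \<le> pr PA (\<lambda>_. False)"
        using True by (intro pr_mono) (auto simp: probes_def stores_def)
      also have "pr PA (\<lambda>_. False) = 0"
        by (simp add: pr_def)
      finally show ?thesis
        by (rule order_trans) simp
    next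
      case False
      let ?s = "fst (g (xs ! i))"
      have "pr PA (?R i j g) = avg A (\<lambda>a. avg A (\<lambda>b. of_bool (probes \<theta> ?s a \<and> stores \<theta> ?s b)))"
        unfolding PA_def pr_def using fin J False ij
        by (intro avg_PiE_2[where F = "\<lambda>a b. of_bool (probes \<theta> ?s a \<and> stores \<theta> ?s b)"]) auto
      also have "\<dots> = pr A (probes \<theta> ?s) * pr A (stores \<theta> ?s)"
        by (simp add: of_bool_conj avg_cmult avg_cmult_right pr_def)
      also have "\<dots> = (t \<theta>)\<^sup>2"
        using PB_slot[OF g xsU[OF ij(1)]] assms by (simp add: pr_stores pr_probes power2_eq_square)
      finally show ?thesis
        by simp
    qed
    have "pr (PA \<times> PB) (\<lambda>(p, g). ?Q i j g \<and> ?R i j g p) = avg PB (\<lambda>g. of_bool (?Q i j g) * pr PA (?R i j g))"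
      unfolding pr_def avg_Times avg_swap[of PA] by (simp add: of_bool_conj avg_cmult mult.assoc)
    also have "\<dots> \<le> avg PB (\<lambda>g. of_bool (?Q i j g) * (t \<theta>)\<^sup>2)"
      using R by (intro avg_mono mult_left_mono) auto
    also have "\<dots> = (t \<theta>)\<^sup>2 * pr PB (?Q i j)"
      by (simp add: avg_cmult_right pr_def)
    also have "pr PB (?Q i j) \<le> of_bool (xs ! j = xs ! i) / real Ep + of_bool (xs ! j = x) / (real Ep * real L * real H)
      + 1 / (real Ep * (real Ep * real L * real H))"
    proof -
      consider "xs ! j = xs ! i" | "xs ! j = x" | "xs ! j \<noteq> xs ! i" "xs ! j \<noteq> x"
        by blast
      then show ?thesis
      proof cases
        case 1
        have "pr PB (?Q i j) = avg B (\<lambda>a. avg B (\<lambda>b. of_bool (fst (fst b) = fst (fst a))))"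
          unfolding PB_def pr_def using fin U False assms xsU ij 1
          by (subst avg_PiE_2[symmetric, where I = U and i = x and j = "xs ! i"]) auto
        also have "\<dots> = avg B (\<lambda>a. 1 / real Ep)"
          using pr_epoch by (intro avg_cong) (auto simp: pr_def B_def)
        finally show ?thesis
          using fin 1 by (simp add: avg_const)
      next
        case 2
        have "pr PB (?Q i j) \<le> pr PB (\<lambda>g. g (xs ! i) = g x)"
          by (intro pr_mono) (use 2 in auto)
        also have "\<dots> = avg B (\<lambda>a. avg B (\<lambda>b. of_bool (b = a)))"
          unfolding PB_def pr_def using fin U False assms xsU ij
          by (subst avg_PiE_2[symmetric, where I = U and i = x and j = "xs ! i"]) auto
        also have "\<dots> = avg B (\<lambda>a. 1 / (real Ep * real L * real H))"
          using pr_point by (intro avg_cong) (auto simp: pr_def)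
        finally show ?thesis
          using fin 2 by (simp add: avg_const add_increasing add_increasing2)
      next
        case 3
        have "pr PB (?Q i j) = avg B (\<lambda>a. avg B (\<lambda>b. avg B (\<lambda>d. of_bool (fst (fst b) = fst (fst a) \<and> d = b))))"
          unfolding PB_def pr_def using fin U False assms xsU ij 3
          by (subst avg_PiE_3[symmetric, where I = U and i = x and j = "xs ! i" and k = "xs ! j"]) auto
        also have "\<dots> = avg B (\<lambda>a. avg B (\<lambda>b. of_bool (fst (fst b) = fst (fst a)) * (1 / (real Ep * real L * real H))))"
          using pr_point by (intro avg_cong) (simp add: of_bool_conj avg_cmult pr_def)
        also have "\<dots> = avg B (\<lambda>a. 1 / real Ep * (1 / (real Ep * real L * real H)))"
        proof (rule avg_cong)
          fix a assume "a \<in> B"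
          then have "fst (fst a) < Ep"
            by (auto simp: B_def)
          then show "avg B (\<lambda>b. of_bool (fst (fst b) = fst (fst a)) * (1 / (real Ep * real L * real H))) =
              1 / real Ep * (1 / (real Ep * real L * real H))"
            using pr_epoch[of "fst (fst a)"] by (simp only: avg_cmult_right pr_def)
        qed
        finally show ?thesis
          using fin 3 by (simp add: avg_const)
      qed
    qed
    finally show ?thesis
      by (simp add: mult_left_mono)
  qed
  have "pr (PA \<times> PB) (\<lambda>(p, g). \<exists>i\<in>J. \<exists>j\<in>J. xs ! i \<noteq> x \<and> fst (fst (g (xs ! i))) = fst (fst (g x)) \<and>
         g (xs ! j) = g (xs ! i) \<and> probes \<theta> (fst (g (xs ! i))) (p i) \<and> stores \<theta> (fst (g (xs ! i))) (p j))
      \<le> (\<Sum>i\<in>J. pr (PA \<times> PB) (\<lambda>z. \<exists>j\<in>J. ?Q i j (snd z) \<and> ?R i j (snd z) (fst z)))"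
    using pr_Bex[OF fin(9), of "PA \<times> PB" "\<lambda>i z. \<exists>j\<in>J. ?Q i j (snd z) \<and> ?R i j (snd z) (fst z)"]
    by (simp add: case_prod_unfold conj_assoc)
  also have "\<dots> \<le> (\<Sum>i\<in>J. \<Sum>j\<in>J. ?b i j)"
  proof (intro sum_mono order_trans[OF pr_Bex[OF fin(9)]])
    fix i j assume "i \<in> J" "j \<in> J"
    then show "pr (PA \<times> PB) (\<lambda>z. ?Q i j (snd z) \<and> ?R i j (snd z) (fst z)) \<le> ?b i j"
      using one[of i j] by (simp add: case_prod_unfold)
  qed
  also have "\<dots> = (t \<theta>)\<^sup>2 * ((\<Sum>i\<in>J. real (card {j \<in> J. xs ! j = xs ! i})) / real Ep
       + real (card J) * real (card {j \<in> J. xs ! j = x}) / (real Ep * real L * real H)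
       + (real (card J))\<^sup>2 / (real Ep * (real Ep * real L * real H)))"
    using fin by (simp add: of_nat_card_filter sum.distrib sum_distrib_left[symmetric]
        sum_divide_distrib[symmetric] power2_eq_square)
  finally show ?thesis .
qed

text \<open>Chebyshev's inequality for a count with mean f/(2 Ep), where f is the number of copies
  of \<open>x\<close> in \<open>J\<close>, and variance at most that mean.\<close>

lemma pr_few_tallies:
  assumes "e < Ep" "\<tau> < real (card {j \<in> J. xs ! j = x}) / (2 * real Ep)"
  shows "pr PA (\<lambda>p. \<not> \<tau> \<le> real (card {j \<in> J. xs ! j = x \<and> tallies L e (p j)})) \<le>
    (real (card {j \<in> J. xs ! j = x}) / (2 * real Ep)) / (real (card {j \<in> J. xs ! j = x}) / (2 * real Ep) - \<tau>)\<^sup>2"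
proof -
  let ?\<nu> = "real (card {j \<in> J. xs ! j = x}) / (2 * real Ep)"
  let ?w = "\<lambda>j. of_bool (j \<in> J \<and> xs ! j = x) :: real"
  have sum_w: "(\<Sum>j<n. ?w j) = real (card {j \<in> J. xs ! j = x})"
  proof -
    have "{j. j < n \<and> j \<in> J \<and> xs ! j = x} = {j \<in> J. xs ! j = x}"
      using J by auto
    then show ?thesis
      using of_nat_card_filter[of "{..<n}" "\<lambda>j. j \<in> J \<and> xs ! j = x"] by simp
  qed
  have "pr PA (\<lambda>p. \<not> \<tau> \<le> real (card {j \<in> J. xs ! j = x \<and> tallies L e (p j)})) \<le>
      pr PA (\<lambda>p. ?\<nu> - \<tau> \<le> \<bar>(\<Sum>j<n. ?w j * of_bool (tallies L e (p j))) - pr A (tallies L e) * (\<Sum>j<n. ?w j)\<bar>)"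
  proof (intro pr_mono)
    fix p assume "\<not> \<tau> \<le> real (card {j \<in> J. xs ! j = x \<and> tallies L e (p j)})"
    moreover have "(\<Sum>j<n. ?w j * of_bool (tallies L e (p j))) = real (card {j \<in> J. xs ! j = x \<and> tallies L e (p j)})"
    proof -
      have "(\<Sum>j<n. ?w j * of_bool (tallies L e (p j))) = (\<Sum>j<n. of_bool (j \<in> J \<and> xs ! j = x \<and> tallies L e (p j)))"
        by (intro sum.cong) auto
      also have "\<dots> = real (card {j \<in> {..<n}. j \<in> J \<and> xs ! j = x \<and> tallies L e (p j)})"
        by (subst of_nat_card_filter) auto
      also have "{j \<in> {..<n}. j \<in> J \<and> xs ! j = x \<and> tallies L e (p j)} = {j \<in> J. xs ! j = x \<and> tallies L e (p j)}"
        using J by auto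
      finally show ?thesis .
    qed
    ultimately show "?\<nu> - \<tau> \<le> \<bar>(\<Sum>j<n. ?w j * of_bool (tallies L e (p j))) - pr A (tallies L e) * (\<Sum>j<n. ?w j)\<bar>"
      unfolding sum_w pr_tallies[OF assms(1)] by simp
  qed
  also have "\<dots> \<le> pr A (tallies L e) * (\<Sum>j<n. (?w j)\<^sup>2) / (?\<nu> - \<tau>)\<^sup>2"
    unfolding PA_def using fin assms by (intro pr_weighted_count_deviation) auto
  also have "(\<Sum>j<n. (?w j)\<^sup>2) = (\<Sum>j<n. ?w j)"
    by (intro sum.cong) auto
  finally show ?thesis
    unfolding sum_w pr_tallies[OF assms(1)] by simp
qed

text \<open>A union bound over the conditions of \<open>found\<close>; the absence of a storing and
  of a probing copy of \<open>x\<close> gives the two exponentials. Conditions that involve only the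
  slot of \<open>x\<close> and the labels are bounded for each fixed hash function.\<close>

lemma pr_not_found:
  defines "f x \<equiv> real (card {j \<in> J. xs ! j = x})"
  assumes "\<theta> \<le> n" "0 < c" "x \<in> U" "\<tau> < f x / (2 * real Ep)"
  shows "pr (PA \<times> PB) (\<lambda>(p, g). \<not> found L c \<theta> \<tau> xs J x p g) \<le>
    2 * exp (- t \<theta> * f x) + real (card J) * t \<theta> / (real Ep * real L) / real c +
    (t \<theta>)\<^sup>2 * ((\<Sum>i\<in>J. f (xs ! i)) / real Ep + real (card J) * f x / (real Ep * real L * real H)
       + (real (card J))\<^sup>2 / (real Ep * (real Ep * real L * real H))) +
    (f x / (2 * real Ep)) / (f x / (2 * real Ep) - \<tau>)\<^sup>2"
proof -
  let ?E1 = "\<lambda>(p, g). \<not> (\<exists>j\<in>J. xs ! j = x \<and> stores \<theta> (fst (g x)) (p j))"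
  let ?E2 = "\<lambda>(p, g). \<not> (\<exists>j\<in>J. xs ! j = x \<and> probes \<theta> (fst (g x)) (p j))"
  let ?E3 = "\<lambda>(p, g). \<not> card {j \<in> J. xs ! j \<noteq> x \<and> fst (g (xs ! j)) = fst (g x) \<and> stores \<theta> (fst (g x)) (p j)} < c"
  let ?E4 = "\<lambda>(p, g). \<exists>i\<in>J. \<exists>j\<in>J. xs ! i \<noteq> x \<and> fst (fst (g (xs ! i))) = fst (fst (g x)) \<and>
         g (xs ! j) = g (xs ! i) \<and> probes \<theta> (fst (g (xs ! i))) (p i) \<and> stores \<theta> (fst (g (xs ! i))) (p j)"
  let ?E5 = "\<lambda>(p, g). \<not> \<tau> \<le> real (card {j \<in> J. xs ! j = x \<and> tallies L (fst (fst (g x))) (p j)})"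
  have cond: "pr (PA \<times> PB) P \<le> q" if "\<And>g. g \<in> PB \<Longrightarrow> pr PA (\<lambda>p. P (p, g)) \<le> q" for P q
  proof -
    have "pr (PA \<times> PB) P = avg PB (\<lambda>g. pr PA (\<lambda>p. P (p, g)))"
      unfolding pr_def avg_Times by (rule avg_swap)
    also have "\<dots> \<le> q"
      using fin that by (intro avg_le_const) auto
    finally show ?thesis .
  qed
  have 1: "pr (PA \<times> PB) ?E1 \<le> exp (- t \<theta> * f x)"
    unfolding f_def using pr_none pr_stores PB_slot t_bounds assms by (intro cond) auto
  have 2: "pr (PA \<times> PB) ?E2 \<le> exp (- t \<theta> * f x)"
    unfolding f_def using pr_none pr_probes PB_slot t_bounds assms by (intro cond) auto
  have 5: "pr (PA \<times> PB) ?E5 \<le> (f x / (2 * real Ep)) / (f x / (2 * real Ep) - \<tau>)\<^sup>2"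
  proof (rule cond)
    fix g assume "g \<in> PB"
    then show "pr PA (\<lambda>p. ?E5 (p, g)) \<le> (f x / (2 * real Ep)) / (f x / (2 * real Ep) - \<tau>)\<^sup>2"
      using PB_slot[of g x] assms(4,5) pr_few_tallies[of "fst (fst (g x))" \<tau> x] unfolding f_def by auto
  qed
  have "pr (PA \<times> PB) (\<lambda>(p, g). \<not> found L c \<theta> \<tau> xs J x p g) \<le>
      pr (PA \<times> PB) (\<lambda>z. ?E1 z \<or> ?E2 z \<or> ?E3 z \<or> ?E4 z \<or> ?E5 z)"
    by (intro pr_mono) (auto simp: found_def)
  also have "\<dots> \<le> pr (PA \<times> PB) ?E1 + (pr (PA \<times> PB) ?E2 + (pr (PA \<times> PB) ?E3 + (pr (PA \<times> PB) ?E4 + pr (PA \<times> PB) ?E5)))"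
    by (intro order_trans[OF pr_disj] add_left_mono order_refl)
  finally show ?thesis
    using 1 2 5 pr_crowded[OF assms(2-4)] pr_false_match[OF assms(2,4)] unfolding f_def by linarith
qed

end

section \<open>Sketching the second moment\<close>

text \<open>The random-sign linear sketch of Alon, Matias and Szegedy. The signs are fully
  independent, which is affordable because they are read off the public seed.\<close>

definition sketch :: "'u set \<Rightarrow> ('u \<Rightarrow> real) \<Rightarrow> ('u \<Rightarrow> int) \<Rightarrow> real" where
  "sketch U c s = (\<Sum>y\<in>U. real_of_int (s y) * c y)"

abbreviation signs :: "'u set \<Rightarrow> ('u \<Rightarrow> int) set" where
  "signs U \<equiv> PiE U (\<lambda>_. {-1, 1})"

lemma avg_signs: "avg {-1, 1 :: int} f = (f (-1) + f 1) / 2"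
  by (simp add: avg_def)

text \<open>Induction on the universe: averaging over the sign of the new item removes odd powers of
  its weight. For the fourth moment, 6 times the mixed term is exactly what the square of the new
  sum provides, and 3 times the fourth power of the weight leaves slack.\<close>

lemma sketch_moments:
  assumes "finite U"
  shows "avg (signs U) (\<lambda>s. (sketch U c s)\<^sup>2) = (\<Sum>y\<in>U. (c y)\<^sup>2) \<and>
    avg (signs U) (\<lambda>s. sketch U c s ^ 4) \<le> 3 * (\<Sum>y\<in>U. (c y)\<^sup>2)\<^sup>2"
  using assms
proof (induction U)
  case empty
  then show ?case
    by (simp add: sketch_def avg_def)
next
  case (insert x U)
  have eq: "sketch (insert x U) c (fun_upd s x a) = real_of_int a * c x + sketch U c s" for s a
  proof -
    have "(\<Sum>y\<in>U. real_of_int (fun_upd s x a y) * c y) = sketch U c s"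
      unfolding sketch_def using insert.hyps by (intro sum.cong) auto
    then show ?thesis
      using insert.hyps by (simp add: sketch_def)
  qed
  have ne: "finite (signs U)" "signs U \<noteq> {}"
    using insert.hyps finite_PiE_nonempty[of U "\<lambda>_. {-1, 1 :: int}"] by auto
  have half: "avg (signs (insert x U)) F =
      avg (signs U) (\<lambda>s. (F (fun_upd s x (-1)) + F (fun_upd s x 1)) / 2)" for F :: "_ \<Rightarrow> real"
    unfolding avg_PiE_insert[OF insert.hyps(2)] by (subst avg_swap) (simp add: avg_signs)
  have "avg (signs (insert x U)) (\<lambda>s. (sketch (insert x U) c s)\<^sup>2) = avg (signs U) (\<lambda>s. (c x)\<^sup>2 + (sketch U c s)\<^sup>2)"
    unfolding half eq by (intro avg_cong) (simp add: power2_eq_square algebra_simps)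
  then have 2: "avg (signs (insert x U)) (\<lambda>s. (sketch (insert x U) c s)\<^sup>2) = (\<Sum>y\<in>insert x U. (c y)\<^sup>2)"
    using insert ne by (simp add: avg_add avg_const)
  have "avg (signs (insert x U)) (\<lambda>s. sketch (insert x U) c s ^ 4) =
      avg (signs U) (\<lambda>s. (c x)^4 + 6 * (c x)\<^sup>2 * (sketch U c s)\<^sup>2 + sketch U c s ^ 4)"
    unfolding half eq by (intro avg_cong) (simp add: power4_eq_xxxx power2_eq_square algebra_simps)
  also have "\<dots> = (c x)^4 + 6 * (c x)\<^sup>2 * (\<Sum>y\<in>U. (c y)\<^sup>2) + avg (signs U) (\<lambda>s. sketch U c s ^ 4)"
    using insert ne by (simp add: avg_add avg_const avg_cmult)
  also have "\<dots> \<le> (c x)^4 + 6 * (c x)\<^sup>2 * (\<Sum>y\<in>U. (c y)\<^sup>2) + 3 * (\<Sum>y\<in>U. (c y)\<^sup>2)\<^sup>2"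
    using insert by simp
  also have "\<dots> \<le> 3 * ((c x)\<^sup>2 + (\<Sum>y\<in>U. (c y)\<^sup>2))\<^sup>2"
    using zero_le_square[of "c x * c x"] by (simp add: power2_eq_square power4_eq_xxxx algebra_simps)
  finally show ?case
    using 2 insert.hyps by simp
qed

text \<open>The squared sketch has mean \<open>F\<close> and variance at most
  \<open>2 * F\<^sup>2\<close>; Chebyshev's inequality at distance \<open>m * F / 2\<close> gives
  \<open>8 / m\<close>, which is \<open>1 / 40\<close> for 320 counters.\<close>

lemma sketch_average:
  fixes c :: "'u \<Rightarrow> real" and U :: "'u set"
  defines "F \<equiv> \<Sum>y\<in>U. (c y)\<^sup>2"
  assumes U: "finite U" and pos: "0 < m" "0 < F"
  shows "pr (PiE {..<m} (\<lambda>_. signs U)) (\<lambda>sg. real m * F / 2 \<le> \<bar>(\<Sum>k<m. (sketch U c (sg k))\<^sup>2) - real m * F\<bar>)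
    \<le> 8 / real m"
proof -
  have ne: "finite (signs U)" "signs U \<noteq> {}"
    using U finite_PiE_nonempty[of U "\<lambda>_. {-1, 1 :: int}"] by auto
  let ?X = "\<lambda>s. (sketch U c s)\<^sup>2 - F"
  have m: "avg (signs U) ?X = 0"
    using sketch_moments[OF U, of c] ne by (simp add: avg_diff avg_const F_def)
  have "avg (signs U) (\<lambda>s. (?X s)\<^sup>2) = avg (signs U) (\<lambda>s. sketch U c s ^ 4 - (2 * F) * (sketch U c s)\<^sup>2 + F\<^sup>2)"
    by (intro avg_cong) (simp add: power2_eq_square power4_eq_xxxx algebra_simps)
  also have "\<dots> = avg (signs U) (\<lambda>s. sketch U c s ^ 4) - F\<^sup>2"
    using sketch_moments[OF U, of c] ne
    by (simp add: avg_add avg_diff avg_const avg_cmult F_def) (simp add: power2_eq_square)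
  also have "\<dots> \<le> 2 * F\<^sup>2"
    using sketch_moments[OF U, of c] by (simp add: F_def)
  finally have v: "avg (signs U) (\<lambda>s. (?X s)\<^sup>2) \<le> 2 * F\<^sup>2" .
  have "pr (PiE {..<m} (\<lambda>_. signs U)) (\<lambda>sg. real m * F / 2 \<le> \<bar>\<Sum>k<m. ?X (sg k)\<bar>)
      \<le> (\<Sum>k<m. 2 * F\<^sup>2) / (real m * F / 2)\<^sup>2"
    using m v pos ne by (intro pr_chebyshev) auto
  also have "(\<Sum>k<m. 2 * F\<^sup>2) / (real m * F / 2)\<^sup>2 = 8 / real m"
    using pos by (simp add: power2_eq_square field_simps)
  finally show ?thesis
    by (simp add: sum_subtractf)
qed

section \<open>Frequencies of the stream and their random splitting into phases\<close>

locale stream_counts =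
  fixes xs :: "'u list" and U :: "'u set" and n :: nat
  assumes U: "finite U" and xs: "set xs \<subseteq> U" "length xs = n" and n: "0 < n"
begin

definition f :: "'u \<Rightarrow> real" where "f y = real (card {j \<in> {..<n}. xs ! j = y})"
definition F2 :: real where "F2 = (\<Sum>y\<in>U. (f y)\<^sup>2)"

lemma f_nonneg: "0 \<le> f y"
  by (simp add: f_def)

lemma f_count: "f y = real (count (mset xs) y)"
  by (simp add: f_def count_mset count_list_eq_length_filter length_filter_conv_card xs eq_commute[of y])

lemma sum_by_item: "(\<Sum>j<n. h (xs ! j) * w j) = (\<Sum>y\<in>U. h y * (\<Sum>j<n. of_bool (xs ! j = y) * (w j :: real)))"
proof -
  have "(\<Sum>j<n. h (xs ! j) * w j) = (\<Sum>j<n. \<Sum>y\<in>U. of_bool (xs ! j = y) * (h y * w j))"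
  proof (intro sum.cong refl)
    fix j assume "j \<in> {..<n}"
    then have "xs ! j \<in> U"
      using xs by (auto dest: nth_mem)
    have "(\<Sum>y\<in>U. of_bool (xs ! j = y) * (h y * w j)) = (\<Sum>y\<in>{xs ! j}. of_bool (xs ! j = y) * (h y * w j))"
      using U \<open>xs ! j \<in> U\<close> by (intro sum.mono_neutral_right) auto
    then show "h (xs ! j) * w j = (\<Sum>y\<in>U. of_bool (xs ! j = y) * (h y * w j))"
      by simp
  qed
  also have "\<dots> = (\<Sum>y\<in>U. h y * (\<Sum>j<n. of_bool (xs ! j = y) * w j))"
    unfolding sum_distrib_left by (subst sum.swap) (intro sum.cong refl, simp)
  finally show ?thesis .
qed

lemma f_alt: "f y = (\<Sum>j<n. of_bool (xs ! j = y))"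
  unfolding f_def by (simp add: Int_def of_bool_def sum.If_cases)

lemma sum_h: "(\<Sum>j<n. h (xs ! j)) = (\<Sum>y\<in>U. h y * f y)" for h :: "'u \<Rightarrow> real"
  using sum_by_item[of h "\<lambda>_. 1"] by (simp add: f_alt)

lemma sum_f: "(\<Sum>y\<in>U. f y) = real n"
  using sum_h[of "\<lambda>_. 1"] by simp

lemma n_le_F2: "real n \<le> F2"
proof -
  have "f y \<le> (f y)\<^sup>2" for y
    unfolding f_def power2_eq_square of_nat_mult[symmetric] of_nat_le_iff by (rule le_square)
  then show ?thesis
    unfolding F2_def sum_f[symmetric] by (intro sum_mono)
qed

lemma F2_pos: "0 < F2"
  using n_le_F2 n by simp

lemma f_le_sqrt_F2: "f y \<le> sqrt F2"
proof (cases "y \<in> U")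
  case True
  then have "(f y)\<^sup>2 \<le> F2"
    unfolding F2_def using U by (intro member_le_sum) auto
  then show ?thesis
    by (simp add: real_le_rsqrt)
next
  case False
  then have "{j \<in> {..<n}. xs ! j = y} = {}"
    using xs by (auto dest: nth_mem)
  then show ?thesis
    using F2_pos unfolding f_def by (metis card.empty less_eq_real_def of_nat_0 real_sqrt_ge_0_iff)
qed

lemma F2_le: "F2 \<le> (real n)\<^sup>2"
proof -
  have "f y \<le> real n" for y
  proof -
    have "card {j \<in> {..<n}. xs ! j = y} \<le> card {..<n}"
      by (intro card_mono) auto
    then show ?thesis
      by (simp add: f_def)
  qed
  then have "F2 \<le> (\<Sum>y\<in>U. f y * real n)"
    unfolding F2_def power2_eq_square by (intro sum_mono mult_left_mono f_nonneg)
  also have "\<dots> = (real n)\<^sup>2"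
    by (simp add: sum_distrib_right[symmetric] sum_f power2_eq_square)
  finally show ?thesis .
qed

text \<open>This third moment is the variance proxy for the split. Compared with the square of
  \<open>F2\<close> it saves a factor sqrt \<open>F2\<close>, hence at least sqrt n.\<close>

lemma sum_f_cubed: "(\<Sum>j<n. (f (xs ! j))\<^sup>2) \<le> F2 * sqrt F2"
proof -
  have "(\<Sum>j<n. (f (xs ! j))\<^sup>2) = (\<Sum>y\<in>U. (f y)\<^sup>2 * f y)"
    by (rule sum_h)
  also have "\<dots> \<le> (\<Sum>y\<in>U. (f y)\<^sup>2 * sqrt F2)"
    by (intro sum_mono mult_left_mono f_le_sqrt_F2) auto
  finally show ?thesis
    by (simp add: F2_def sum_distrib_right)
qed

context
  fixes D :: nat
  assumes D: "0 < D"
begin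

definition part :: "(nat \<Rightarrow> nat) \<Rightarrow> 'u \<Rightarrow> real" where
  "part \<delta> y = (\<Sum>j<n. of_bool (xs ! j = y) * of_bool (\<delta> j < D))"

definition F0 :: "(nat \<Rightarrow> nat) \<Rightarrow> real" where "F0 \<delta> = (\<Sum>y\<in>U. (part \<delta> y)\<^sup>2)"

lemma F0_le: "F0 \<delta> \<le> F2"
  unfolding F0_def F2_def
proof (intro sum_mono power_mono)
  show "part \<delta> y \<le> f y" for y
    unfolding part_def f_alt by (intro sum_mono) auto
  show "0 \<le> part \<delta> y" for y
    unfolding part_def by (intro sum_nonneg) auto
qed

text \<open>
  From \<open>p\<^sup>2 \<ge> f * p - f\<^sup>2 / 4\<close>, which makes the lower bound linear in the independent phases \<open>\<delta> j\<close>.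
\<close>

lemma F0_ge: "(\<Sum>j<n. f (xs ! j) * of_bool (\<delta> j < D)) - F2 / 4 \<le> F0 \<delta>"
proof -
  have "f y * part \<delta> y - (f y)\<^sup>2 / 4 \<le> (part \<delta> y)\<^sup>2" for y
    using zero_le_power2[of "part \<delta> y - f y / 2"] by (simp add: power2_eq_square algebra_simps)
  then have "(\<Sum>y\<in>U. f y * part \<delta> y - (f y)\<^sup>2 / 4) \<le> F0 \<delta>"
    unfolding F0_def by (intro sum_mono)
  moreover have "(\<Sum>y\<in>U. f y * part \<delta> y) = (\<Sum>j<n. f (xs ! j) * of_bool (\<delta> j < D))"
    unfolding part_def sum_by_item[symmetric] ..
  ultimately show ?thesis
    by (simp add: sum_subtractf F2_def sum_divide_distrib)
qed

abbreviation "assignments \<equiv> PiE {..<n} (\<lambda>_. {..<2 * D})"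

text \<open>The linear lower bound for \<open>F0\<close> has mean \<open>F2 / 2 - F2 / 4\<close>, so
  a value below \<open>F2 / 8\<close> forces a deviation of at least \<open>F2 / 8\<close>.\<close>

lemma pr_F0_small: "pr assignments (\<lambda>\<delta>. F0 \<delta> < F2 / 8) \<le> 32 / sqrt (real n)"
proof -
  let ?P = "\<lambda>d. d < D"
  have half: "pr {..<2 * D} ?P = 1 / 2"
  proof -
    have "{..<2 * D} \<inter> {d. d < D} = {..<D}"
      by auto
    then show ?thesis
      using pr_mem[of "{..<2 * D}" "{d. d < D}"] D by simp
  qed
  have ne: "{..<2 * D} \<noteq> {}"
    using D by (simp add: lessThan_empty_iff)
  have "pr assignments (\<lambda>\<delta>. F0 \<delta> < F2 / 8) \<le>
     pr assignments (\<lambda>\<delta>. F2 / 8 \<le> \<bar>(\<Sum>j<n. f (xs ! j) * of_bool (\<delta> j < D)) - pr {..<2 * D} ?P * (\<Sum>j<n. f (xs ! j))\<bar>)"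
  proof (intro pr_mono)
    fix \<delta> assume "F0 \<delta> < F2 / 8"
    moreover have "(\<Sum>j<n. f (xs ! j)) = F2"
      by (simp add: sum_h F2_def power2_eq_square)
    ultimately show "F2 / 8 \<le> \<bar>(\<Sum>j<n. f (xs ! j) * of_bool (\<delta> j < D)) - pr {..<2 * D} ?P * (\<Sum>j<n. f (xs ! j))\<bar>"
      using F0_ge[of \<delta>] F2_pos by (simp add: half)
  qed
  also have "\<dots> \<le> pr {..<2 * D} ?P * (\<Sum>j<n. (f (xs ! j))\<^sup>2) / (F2 / 8)\<^sup>2"
    using F2_pos ne by (intro pr_weighted_count_deviation) auto
  also have "\<dots> \<le> 1 / 2 * (F2 * sqrt F2) / (F2 / 8)\<^sup>2"
    unfolding half by (intro divide_right_mono mult_left_mono sum_f_cubed) auto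
  also have "\<dots> = 32 * (sqrt F2 / F2)"
    using F2_pos by (simp add: power2_eq_square field_simps)
  also have "sqrt F2 / F2 = 1 / sqrt F2"
    using F2_pos by (simp add: field_simps)
  also have "32 * (1 / sqrt F2) \<le> 32 / sqrt (real n)"
    using n_le_F2 n by (simp add: frac_le)
  finally show ?thesis
    by simp
qed

lemma pr_point_assignment: "d < 2 * D \<Longrightarrow> pr {..<2 * D} (\<lambda>e. e = d) = 1 / (2 * real D)"
proof -
  assume "d < 2 * D"
  then have "{..<2 * D} \<inter> {e. e = d} = {d}"
    by auto
  then show ?thesis
    using pr_mem[of "{..<2 * D}" "{e. e = d}"] by simp
qed

lemma pr_part_deviation:
  assumes "d < 2 * D" "0 < s" "finite K" "K \<subseteq> {..<n}"
  shows "pr assignments (\<lambda>\<delta>. s \<le> \<bar>real (card {j \<in> K. \<delta> j = d}) - real (card K) / (2 * real D)\<bar>)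
    \<le> real (card K) / (2 * real D) / s\<^sup>2"
proof -
  have ne: "{..<2 * D} \<noteq> {}"
    using D by (simp add: lessThan_empty_iff)
  let ?w = "\<lambda>j. of_bool (j \<in> K) :: real"
  have w: "(\<Sum>j<n. ?w j * g j) = (\<Sum>j\<in>K. g j)" for g :: "nat \<Rightarrow> real"
  proof -
    have "(\<Sum>j\<in>K. g j) = (\<Sum>j\<in>K. ?w j * g j)"
      by (intro sum.cong) auto
    also have "\<dots> = (\<Sum>j<n. ?w j * g j)"
      using assms by (intro sum.mono_neutral_left) auto
    finally show ?thesis ..
  qed
  have "pr assignments (\<lambda>\<delta>. s \<le> \<bar>(\<Sum>j<n. ?w j * of_bool (\<delta> j = d)) - pr {..<2 * D} (\<lambda>e. e = d) * (\<Sum>j<n. ?w j)\<bar>)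
      \<le> pr {..<2 * D} (\<lambda>e. e = d) * (\<Sum>j<n. (?w j)\<^sup>2) / s\<^sup>2"
    using assms ne by (intro pr_weighted_count_deviation) auto
  moreover have "(\<Sum>j<n. ?w j) = real (card K)" "(\<Sum>j<n. (?w j)\<^sup>2) = real (card K)"
    using w[of "\<lambda>_. 1"] by (simp_all add: power2_eq_square flip: of_bool_conj)
  moreover have "(\<Sum>j\<in>K. of_bool (\<delta> j = d)) = real (card {j \<in> K. \<delta> j = d})" for \<delta> :: "nat \<Rightarrow> nat"
    using assms by (simp add: Int_def of_bool_def sum.If_cases)
  ultimately show ?thesis
    using assms by (simp add: w pr_point_assignment)
qed

end

end

section \<open>The complete scheme\<close>

lemma found_cong:
  assumes "\<And>j. j \<in> J \<Longrightarrow> p j = p' j"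
  shows "found L c \<theta> \<tau> xs J x p g = found L c \<theta> \<tau> xs J x p' g"
proof -
  have 1: "{j \<in> J. xs ! j \<noteq> x \<and> fst (g (xs ! j)) = fst (g x) \<and> stores \<theta> (fst (g x)) (p j)} =
      {j \<in> J. xs ! j \<noteq> x \<and> fst (g (xs ! j)) = fst (g x) \<and> stores \<theta> (fst (g x)) (p' j)}"
    using assms by auto
  have 2: "{j \<in> J. xs ! j = x \<and> tallies L (fst (fst (g x))) (p j)} =
      {j \<in> J. xs ! j = x \<and> tallies L (fst (fst (g x))) (p' j)}"
    using assms by auto
  show ?thesis
    unfolding found_def 1 2 using assms by simp
qed

lemma exp_minus_4: "exp (-4 :: real) \<le> 1 / 16"
proof -
  have "(2 :: real) \<le> exp 1"
    using exp_ge_add_one_self[of 1] by simp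
  then have "(2 :: real) ^ 4 \<le> exp 1 ^ 4"
    by (intro power_mono) auto
  also have "\<dots> = exp 4"
    by (simp flip: exp_of_nat_mult)
  finally show ?thesis
    by (simp add: exp_minus field_simps)
qed

text \<open>Taking logarithms, this amounts to \<open>ln 2 \<ge> 2 / 3\<close>. It is the final
  estimate of an exponential moment bound with base 2 for a count whose mean is at most half of
  \<open>s\<close>.\<close>

lemma exp_half_div_powr_le: "0 \<le> (s :: real) \<Longrightarrow> exp (s / 2) / 2 powr s \<le> 2 powr (- s / 4)"
proof -
  assume s: "0 \<le> s"
  have "(2 / 3 :: real) \<le> ln 2"
    using ln2_ge_two_thirds by simp
  then have "s / 2 \<le> 3 / 4 * s * ln 2"
    using mult_left_mono[of "2 / 3" "ln 2" "3 / 4 * s"] s by simp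
  then show ?thesis
    by (simp add: powr_def exp_diff[symmetric] algebra_simps)
qed

text \<open>
  The phases \<open>\<delta> < D\<close> together form the sketching half of the stream; the phases \<open>D \<le> \<delta> < 2 * D\<close> are
  the passes. Each pass has \<open>Ep\<close> epochs with \<open>L\<close> slots of capacity \<open>c\<close> and identifiers below \<open>H\<close>; at
  most \<open>M\<close> items are reported, and the sketch has \<open>m\<close> counters.
\<close>

locale scheme =
  fixes U :: "'u set" and n D L Ep H c M m :: nat and \<epsilon> :: real
  assumes U: "finite U"
    and pos: "1 < n" "0 < D" "0 < Ep" "0 < H" "54 \<le> L" "0 < \<epsilon>" "\<epsilon> \<le> 1" and m: "m = 320"
    and G1: "480 * real D * (real Ep * real L) \<le> sqrt (\<epsilon> * real n)"
    and G2: "sqrt (\<epsilon> * real n) \<le> 960 * real D * (real Ep * real L)"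
    and c: "1152000 * real D / \<epsilon> \<le> real c"
    and Ep: "576000 * (real D)\<^sup>2 / \<epsilon> \<le> real Ep"
    and H: "40 * (real c)\<^sup>2 * real L \<le> real H"
    and M: "256 / \<epsilon> < real M"
    and small_sketch: "32 / sqrt (real n) \<le> 1 / 1000"
    and small_load: "real D * (2 * real D / real n) \<le> 1 / 1000"
    and small_heavy: "1 / \<epsilon> * (real D * (128 * real D / sqrt (\<epsilon> * real n))) \<le> 1 / 1000"
    and small_tally: "real (card U) * (real D * (real Ep * 2 powr (- 3 * real L))) \<le> 1 / 1000"
    and small_miss: "1 / \<epsilon> * (1 / 2) ^ D \<le> 1 / 100"
begin

lemma L_pos: "0 < L"
  using pos by simp

definition Phi :: "int list \<Rightarrow> real" where
  "Phi a = (\<Sum>k<m. (real_of_int (a ! k))\<^sup>2) / real m"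

text \<open>With r = sqrt (\<open>\<epsilon> * Phi a\<close>), this makes the probability of storing
  lie between 15 D/r and 30 D/r. A heavy hitter, with about f/(2 D) copies in a pass, then expects
  more than four copies in its store step and in its probe step.\<close>

definition \<theta> :: "int list \<Rightarrow> nat" where
  "\<theta> a = nat \<lceil>real n * (60 * real D * (real Ep * real L) / sqrt (\<epsilon> * Phi a))\<rceil>"

text \<open>An item of frequency f has an expected count of f/(4 D Ep). The threshold lies below
  this value for heavy hitters even if \<open>Phi\<close> overestimates by 2. If \<open>Phi\<close>
  underestimates by 16 it is still sqrt (\<open>\<epsilon> * F2\<close>)/(32 D Ep), twice the mean
  for f = sqrt (\<open>\<epsilon> * F2\<close>)/16. The square of this 16 is the 256 of the
  theorem.\<close>

definition \<tau> :: "int list \<Rightarrow> real" where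
  "\<tau> a = sqrt (\<epsilon> * Phi a) / (8 * real D * real Ep)"

section \<open>The space of coins and its symmetry under relabelling of the copies\<close>

type_synonym 'v coins = "(nat \<Rightarrow> nat) \<times> (nat \<Rightarrow> 'v \<Rightarrow> int) \<times>
  (nat \<Rightarrow> (nat \<Rightarrow> nat \<times> nat \<times> nat) \<times> ('v \<Rightarrow> (nat \<times> nat) \<times> nat))"

abbreviation "DS \<equiv> PiE {..<n} (\<lambda>_. {..<2 * D})"
abbreviation "SG \<equiv> PiE {..<m} (\<lambda>_. signs U)"
abbreviation "PA \<equiv> pass.PA Ep L n"
abbreviation "PB \<equiv> pass.PB Ep L H U"
abbreviation "PS \<equiv> PiE {D..<2 * D} (\<lambda>_. PA \<times> PB)"

definition coins :: "'u coins set" where "coins = DS \<times> SG \<times> PS"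

fun lab :: "'u coins \<Rightarrow> nat \<Rightarrow> label" where
  "lab (\<delta>, sg, ps) j = (\<delta> j, if \<delta> j < D then (0, 0, 0) else fst (ps (\<delta> j)) j)"

definition hashes :: "'u coins \<Rightarrow> nat \<Rightarrow> 'u \<Rightarrow> (nat \<times> nat) \<times> nat" where
  "hashes \<omega> d = snd (snd (snd \<omega>) d)"

text \<open>Only data attached to copies are permuted. Signs and hash values belong to items and
  stay, so the processing of a given labelled item does not change.\<close>

fun shuffle :: "(nat \<Rightarrow> nat) \<Rightarrow> 'u coins \<Rightarrow> 'u coins" where
  "shuffle p (\<delta>, sg, ps) = (\<delta> \<circ> p, sg, \<lambda>d\<in>{D..<2 * D}. (fst (ps d) \<circ> p, snd (ps d)))"

lemma pass_coins: "pass Ep L n H U xs {j. j < n \<and> \<delta> j = d}" if "set xs \<subseteq> U" "length xs = n" for xs \<delta> and d :: nat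
  using that pos U L_pos by unfold_locales (auto dest: nth_mem)

lemma pass_empty: "pass Ep L n H U [] {}"
  using pos U L_pos by unfold_locales auto

lemmas PA_def = pass.PA_def[OF pass_empty] and PB_def = pass.PB_def[OF pass_empty]
  and A_def = pass.A_def[OF pass_empty] and B_def = pass.B_def[OF pass_empty]

lemma fin: "finite DS" "DS \<noteq> {}" "finite SG" "SG \<noteq> {}" "finite PA" "PA \<noteq> {}" "finite PB" "PB \<noteq> {}"
  "finite PS" "PS \<noteq> {}" "finite coins" "coins \<noteq> {}"
proof -
  show 1: "finite DS" "DS \<noteq> {}"
    using pos finite_PiE_nonempty[of "{..<n}" "\<lambda>_. {..<2 * D}"] by (auto simp: lessThan_empty_iff)
  have "finite (signs U)" "signs U \<noteq> {}"
    using U finite_PiE_nonempty[of U "\<lambda>_. {-1, 1 :: int}"] by auto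
  then show 2: "finite SG" "SG \<noteq> {}"
    using finite_PiE_nonempty[of "{..<m}" "\<lambda>_. signs U"] by auto
  show 3: "finite PA" "PA \<noteq> {}" "finite PB" "PB \<noteq> {}"
    using pass.fin[OF pass_empty] by auto
  show 4: "finite PS" "PS \<noteq> {}"
    using 3 finite_PiE_nonempty[of "{D..<2 * D}" "\<lambda>_. PA \<times> PB"] by auto
  show "finite coins" "coins \<noteq> {}"
    using 1 2 4 unfolding coins_def by auto
qed

lemma shuffle_in_coins:
  assumes p: "p permutes {..<n}" and \<omega>: "\<omega> \<in> coins"
  shows "shuffle p \<omega> \<in> coins"
proof -
  obtain \<delta> sg ps where w: "\<omega> = (\<delta>, sg, ps)"
    by (metis prod_cases3)
  have comp: "q \<circ> p \<in> PiE {..<n} (\<lambda>_. X)" if "q \<in> PiE {..<n} (\<lambda>_. X)" for q :: "nat \<Rightarrow> 'x" and X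
    using that permutes_in_image[OF p] permutes_not_in[OF p] by (auto simp: PiE_def extensional_def)
  have "fst (ps d) \<circ> p \<in> PA \<and> snd (ps d) \<in> PB" if "d \<in> {D..<2 * D}" for d
  proof -
    have "ps d \<in> PA \<times> PB"
      using \<omega> PiE_mem[OF _ that, of ps "\<lambda>_. PA \<times> PB"] unfolding w coins_def by blast
    then have mem: "fst (ps d) \<in> PA" "snd (ps d) \<in> PB"
      by (auto simp: mem_Times_iff)
    then show ?thesis
      using comp unfolding PA_def by blast
  qed
  then show ?thesis
    using \<omega> comp unfolding w coins_def by auto
qed

lemma shuffle_shuffle:
  assumes "\<omega> \<in> coins" "p \<circ> q = id"
  shows "shuffle q (shuffle p \<omega>) = \<omega>"
proof -
  obtain \<delta> sg ps where w: "\<omega> = (\<delta>, sg, ps)"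
    by (metis prod_cases3)
  have "(\<lambda>d\<in>{D..<2 * D}. (fst ((\<lambda>d\<in>{D..<2 * D}. (fst (ps d) \<circ> p, snd (ps d))) d) \<circ> q,
      snd ((\<lambda>d\<in>{D..<2 * D}. (fst (ps d) \<circ> p, snd (ps d))) d))) = (\<lambda>d\<in>{D..<2 * D}. ps d)"
    using assms(2) by (auto simp: restrict_def fun_eq_iff prod_eq_iff)
  also have "\<dots> = ps"
    using assms(1) unfolding w coins_def by (auto intro!: restrict_PiE_iff[THEN iffD1] PiE_restrict)
  finally show ?thesis
    using assms(2) by (simp add: w comp_assoc)
qed

lemma bij_shuffle:
  assumes p: "p permutes {..<n}"
  shows "bij_betw (shuffle p) coins coins"
proof (rule bij_betw_byWitness[where f' = "shuffle (inv p)"])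
  show "\<forall>\<omega>\<in>coins. shuffle (inv p) (shuffle p \<omega>) = \<omega>" "\<forall>\<omega>\<in>coins. shuffle p (shuffle (inv p) \<omega>) = \<omega>"
    using p by (auto intro!: shuffle_shuffle simp: permutes_inv_o)
  show "shuffle p ` coins \<subseteq> coins" "shuffle (inv p) ` coins \<subseteq> coins"
    using p shuffle_in_coins permutes_inv by blast+
qed

lemma lab_shuffle:
  assumes p: "p permutes {..<n}" and "\<omega> \<in> coins" "j < n"
  shows "lab (shuffle p \<omega>) j = lab \<omega> (p j)"
proof -
  obtain \<delta> sg ps where w: "\<omega> = (\<delta>, sg, ps)"
    by (metis prod_cases3)
  have "p j < n"
    using permutes_in_image[OF p] assms by auto
  then have "\<delta> (p j) < 2 * D"
    using assms unfolding w coins_def by auto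
  then show ?thesis
    by (simp add: w)
qed

lemma signs_shuffle: "fst (snd (shuffle p \<omega>)) = fst (snd \<omega>)"
  by (cases \<omega>) simp

lemma hashes_shuffle:
  assumes "\<omega> \<in> coins"
  shows "hashes (shuffle p \<omega>) = hashes \<omega>"
proof
  fix d
  obtain \<delta> sg ps where w: "\<omega> = (\<delta>, sg, ps)"
    by (metis prod_cases3)
  have "ps d = undefined" if "d \<notin> {D..<2 * D}"
    using assms that unfolding w coins_def by (auto simp: PiE_def extensional_def)
  then show "hashes (shuffle p \<omega>) d = hashes \<omega> d"
    unfolding w hashes_def by (auto simp: restrict_def)
qed

end

section \<open>Failure probabilities for a fixed stream\<close>

locale scheme_stream = scheme U n D L Ep H c M m \<epsilon> + S: stream_counts xs U n
  for U :: "'u set" and n D L Ep H c M m :: nat and \<epsilon> :: real and xs :: "'u list"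
begin

definition counters :: "(nat \<Rightarrow> nat) \<Rightarrow> (nat \<Rightarrow> 'u \<Rightarrow> int) \<Rightarrow> int list" where
  "counters \<delta> sg = map (\<lambda>k. \<Sum>j<n. of_bool (\<delta> j < D) * sg k (xs ! j)) [0..<m]"

lemma Phi_counters: "real m * Phi (counters \<delta> sg) = (\<Sum>k<m. (sketch U (S.part D \<delta>) (sg k))\<^sup>2)"
proof -
  have "real_of_int (counters \<delta> sg ! k) = sketch U (S.part D \<delta>) (sg k)" if "k < m" for k
  proof -
    have "real_of_int (counters \<delta> sg ! k) = (\<Sum>j<n. real_of_int (sg k (xs ! j)) * of_bool (\<delta> j < D))"
      using that by (simp add: counters_def mult.commute)
    also have "\<dots> = (\<Sum>y\<in>U. real_of_int (sg k y) * S.part D \<delta> y)"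
      unfolding S.part_def[OF pos(2)] by (rule S.sum_by_item)
    finally show ?thesis
      by (simp add: sketch_def)
  qed
  moreover have "0 < m"
    using m by simp
  ultimately show ?thesis
    by (simp add: Phi_def)
qed

text \<open>Sketching only half of the copies may cost a factor 8 in the second moment, and the
  sketch itself may be off by one half: this gives \<open>F2 / 16\<close> from below and 3/2
  \<open>F2\<close>, rounded to 2 \<open>F2\<close>, from above.\<close>

definition estimate_ok :: "int list \<Rightarrow> bool" where
  "estimate_ok a \<longleftrightarrow> S.F2 / 16 \<le> Phi a \<and> Phi a \<le> 2 * S.F2"

lemma pr_estimate:
  "pr (DS \<times> SG) (\<lambda>(\<delta>, sg). \<not> estimate_ok (counters \<delta> sg)) \<le> 1 / 1000 + 1 / 40"
proof -
  let ?bad = "\<lambda>\<delta> sg. real m * S.F0 D \<delta> / 2 \<le> \<bar>(\<Sum>k<m. (sketch U (S.part D \<delta>) (sg k))\<^sup>2) - real m * S.F0 D \<delta>\<bar>"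
  have one: "pr SG (\<lambda>sg. \<not> estimate_ok (counters \<delta> sg)) \<le> of_bool (S.F0 D \<delta> < S.F2 / 8) + 1 / 40" for \<delta>
  proof (cases "S.F0 D \<delta> < S.F2 / 8")
    case True
    then show ?thesis
      using pr_le_1[of SG "\<lambda>sg. \<not> estimate_ok (counters \<delta> sg)"] by simp
  next
    case False
    have F0: "0 < S.F0 D \<delta>"
      using False S.F2_pos by simp
    have "pr SG (\<lambda>sg. \<not> estimate_ok (counters \<delta> sg)) \<le> pr SG (?bad \<delta>)"
    proof (rule pr_mono)
      fix sg assume *: "\<not> estimate_ok (counters \<delta> sg)"
      show "?bad \<delta> sg"
      proof (rule ccontr)
        assume "\<not> ?bad \<delta> sg"
        then have "\<bar>real m * Phi (counters \<delta> sg) - real m * S.F0 D \<delta>\<bar> < real m * S.F0 D \<delta> / 2"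
          unfolding Phi_counters by simp
        then have "\<bar>Phi (counters \<delta> sg) - S.F0 D \<delta>\<bar> < S.F0 D \<delta> / 2"
          using m by (simp add: abs_if split: if_splits)
        then show False
          using * False S.F0_le[OF pos(2), of \<delta>] unfolding estimate_ok_def by (auto simp: abs_if split: if_splits)
      qed
    qed
    also have "\<dots> \<le> 8 / real m"
      using sketch_average[OF U, of m "S.part D \<delta>"] F0 m unfolding S.F0_def[OF pos(2)] by simp
    finally show ?thesis
      using False m by simp
  qed
  have "pr (DS \<times> SG) (\<lambda>(\<delta>, sg). \<not> estimate_ok (counters \<delta> sg)) \<le>
      avg DS (\<lambda>\<delta>. of_bool (S.F0 D \<delta> < S.F2 / 8) + 1 / 40)"
    unfolding pr_Times prod.case by (intro avg_mono one)
  also have "\<dots> = pr DS (\<lambda>\<delta>. S.F0 D \<delta> < S.F2 / 8) + 1 / 40"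
    using fin by (simp add: avg_add avg_const pr_def)
  also have "\<dots> \<le> 1 / 1000 + 1 / 40"
    using S.pr_F0_small[OF pos(2)] small_sketch by simp
  finally show ?thesis .
qed

definition heavy :: "'u set" where "heavy = {x \<in> U. \<epsilon> * S.F2 \<le> (S.f x)\<^sup>2}"

lemma card_heavy: "real (card heavy) \<le> 1 / \<epsilon>"
proof -
  have "real (card heavy) * (\<epsilon> * S.F2) = (\<Sum>x\<in>heavy. \<epsilon> * S.F2)"
    by simp
  also have "\<dots> \<le> (\<Sum>x\<in>heavy. (S.f x)\<^sup>2)"
    by (intro sum_mono) (auto simp: heavy_def)
  also have "\<dots> \<le> S.F2"
    unfolding S.F2_def using U by (intro sum_mono2) (auto simp: heavy_def)
  finally show ?thesis
    using pos S.F2_pos by (simp add: field_simps)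
qed

text \<open>A pass may have twice its mean load, and a heavy hitter may deviate by an eighth of its
  mean. Chebyshev's inequality suffices for this, since only 1/\<epsilon> items and \<open>D\<close>
  passes are involved; light items are too many and are treated by exponential moments.\<close>

definition loaded_ok :: "(nat \<Rightarrow> nat) \<Rightarrow> bool" where
  "loaded_ok \<delta> \<longleftrightarrow> (\<forall>d\<in>{D..<2 * D}. real (card {j. j < n \<and> \<delta> j = d}) \<le> real n / real D \<and>
    (\<forall>x\<in>heavy. \<bar>real (card {j. j < n \<and> \<delta> j = d \<and> xs ! j = x}) - S.f x / (2 * real D)\<bar> \<le> S.f x / (16 * real D)))"

lemma heavy_f: "x \<in> heavy \<Longrightarrow> sqrt (\<epsilon> * S.F2) \<le> S.f x \<and> sqrt (\<epsilon> * real n) \<le> S.f x \<and> 0 < S.f x"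
proof -
  assume x: "x \<in> heavy"
  then have 1: "sqrt (\<epsilon> * S.F2) \<le> S.f x"
    using S.f_nonneg by (intro real_le_lsqrt) (auto simp: heavy_def)
  moreover have "sqrt (\<epsilon> * real n) \<le> sqrt (\<epsilon> * S.F2)"
    using S.n_le_F2 pos by simp
  moreover have "0 < sqrt (\<epsilon> * real n)"
    using pos by simp
  ultimately show ?thesis
    by linarith
qed

lemma pr_load: "pr DS (\<lambda>\<delta>. \<not> loaded_ok \<delta>) \<le> 2 / 1000"
proof -
  let ?bad1 = "\<lambda>d \<delta>. real n / (2 * real D) \<le> \<bar>real (card {j \<in> {..<n}. \<delta> j = d}) - real (card {..<n}) / (2 * real D)\<bar>"
  let ?K = "\<lambda>x. {j \<in> {..<n}. xs ! j = x}"
  let ?bad2 = "\<lambda>d x \<delta>. S.f x / (16 * real D) \<le> \<bar>real (card {j \<in> ?K x. \<delta> j = d}) - real (card (?K x)) / (2 * real D)\<bar>"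
  have fin_heavy: "finite heavy"
    using U by (auto simp: heavy_def)
  have "pr DS (\<lambda>\<delta>. \<not> loaded_ok \<delta>) \<le>
      pr DS (\<lambda>\<delta>. (\<exists>d\<in>{D..<2 * D}. ?bad1 d \<delta>) \<or> (\<exists>x\<in>heavy. \<exists>d\<in>{D..<2 * D}. ?bad2 d x \<delta>))"
  proof (rule pr_mono)
    fix \<delta> assume *: "\<not> loaded_ok \<delta>"
    show "(\<exists>d\<in>{D..<2 * D}. ?bad1 d \<delta>) \<or> (\<exists>x\<in>heavy. \<exists>d\<in>{D..<2 * D}. ?bad2 d x \<delta>)"
    proof (rule ccontr)
      assume "\<not> ?thesis"
      then have 1: "\<And>d. d \<in> {D..<2 * D} \<Longrightarrow> \<not> ?bad1 d \<delta>"
        and 2: "\<And>d x. x \<in> heavy \<Longrightarrow> d \<in> {D..<2 * D} \<Longrightarrow> \<not> ?bad2 d x \<delta>"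
        by blast+
      have "real (card {j. j < n \<and> \<delta> j = d}) \<le> real n / real D" if "d \<in> {D..<2 * D}" for d
        using 1[OF that] by (simp add: abs_if field_simps split: if_splits)
      moreover have "\<bar>real (card {j. j < n \<and> \<delta> j = d \<and> xs ! j = x}) - S.f x / (2 * real D)\<bar> \<le> S.f x / (16 * real D)"
        if "x \<in> heavy" "d \<in> {D..<2 * D}" for x d
      proof -
        have "{j \<in> ?K x. \<delta> j = d} = {j. j < n \<and> \<delta> j = d \<and> xs ! j = x}"
          by auto
        then show ?thesis
          using 2[OF that] by (simp add: S.f_def)
      qed
      ultimately show False
        using * unfolding loaded_ok_def by blast
    qed
  qed
  also have "\<dots> \<le> pr DS (\<lambda>\<delta>. \<exists>d\<in>{D..<2 * D}. ?bad1 d \<delta>) + pr DS (\<lambda>\<delta>. \<exists>x\<in>heavy. \<exists>d\<in>{D..<2 * D}. ?bad2 d x \<delta>)"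
    by (rule pr_disj)
  also have "pr DS (\<lambda>\<delta>. \<exists>d\<in>{D..<2 * D}. ?bad1 d \<delta>) \<le> real (card {D..<2 * D}) * (2 * real D / real n)"
  proof (rule pr_Bex_le)
    fix d assume "d \<in> {D..<2 * D}"
    then have "pr DS (?bad1 d) \<le> real (card {..<n}) / (2 * real D) / (real n / (2 * real D))\<^sup>2"
      using pos by (intro S.pr_part_deviation[OF pos(2)]) auto
    also have "\<dots> = 2 * real D / real n"
      using pos by (simp add: power2_eq_square field_simps)
    finally show "pr DS (?bad1 d) \<le> 2 * real D / real n" .
  qed simp
  also have "real (card {D..<2 * D}) * (2 * real D / real n) \<le> 1 / 1000"
    using small_load by simp
  also have "pr DS (\<lambda>\<delta>. \<exists>x\<in>heavy. \<exists>d\<in>{D..<2 * D}. ?bad2 d x \<delta>) \<le>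
      real (card heavy) * (real (card {D..<2 * D}) * (128 * real D / sqrt (\<epsilon> * real n)))"
  proof (intro pr_Bex_le fin_heavy)
    fix x d assume x: "x \<in> heavy" and d: "d \<in> {D..<2 * D}"
    have fx: "0 < S.f x" "sqrt (\<epsilon> * real n) \<le> S.f x"
      using heavy_f[OF x] by auto
    have "pr DS (?bad2 d x) \<le> real (card (?K x)) / (2 * real D) / (S.f x / (16 * real D))\<^sup>2"
      using pos fx d by (intro S.pr_part_deviation[OF pos(2)]) auto
    also have "\<dots> = 128 * real D / S.f x"
      using pos fx by (simp add: S.f_def[symmetric, unfolded lessThan_iff] power2_eq_square field_simps)
    also have "\<dots> \<le> 128 * real D / sqrt (\<epsilon> * real n)"
      using fx pos by (intro divide_left_mono mult_pos_pos) auto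
    finally show "pr DS (?bad2 d x) \<le> 128 * real D / sqrt (\<epsilon> * real n)" .
  qed simp
  also have "real (card heavy) * (real (card {D..<2 * D}) * (128 * real D / sqrt (\<epsilon> * real n))) \<le>
      1 / \<epsilon> * (real D * (128 * real D / sqrt (\<epsilon> * real n)))"
    using card_heavy pos by (intro mult_mono) auto
  also have "\<dots> \<le> 1 / 1000"
    by (rule small_heavy)
  finally show ?thesis
    by simp
qed

text \<open>The bound is the least value that \<open>\<tau>\<close> can take when the estimate is
  right, so the event does not depend on the signs.\<close>

definition miscounted :: "'u \<Rightarrow> nat \<Rightarrow> nat \<Rightarrow> (nat \<Rightarrow> nat) \<Rightarrow> (nat \<Rightarrow> nat \<times> nat \<times> nat) \<Rightarrow> bool" where
  "miscounted y d e \<delta> p \<longleftrightarrow> sqrt (\<epsilon> * S.F2) / (32 * real D * real Ep) \<le>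
     real (card {j \<in> {..<n}. \<delta> j = d \<and> tallies L e (p j) \<and> xs ! j = y})"

text \<open>An exponential moment bound with base 2, taken jointly over phases and labels: each copy
  of \<open>y\<close> is counted with probability 1/(4 D Ep), so the mean is at most half of the
  threshold. Exponential decay in \<open>L\<close> is what a union bound over the universe
  requires.\<close>

lemma pr_miscounted:
  assumes y: "S.f y \<le> sqrt (\<epsilon> * S.F2) / 16" and d: "d < 2 * D" and e: "e < Ep"
  shows "avg DS (\<lambda>\<delta>. pr PA (miscounted y d e \<delta>)) \<le> 2 powr (- 3 * real L)"
proof -
  interpret P: pass Ep L n H U "[]" "{}"
    by (rule pass_empty)
  let ?s = "sqrt (\<epsilon> * S.F2) / (32 * real D * real Ep)"
  let ?N = "\<lambda>\<delta> p. card {j \<in> {..<n}. \<delta> j = d \<and> tallies L e (p j) \<and> xs ! j = y}"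
  let ?q = "1 / (2 * real D)"
  have D2: "{..<2 * D} \<noteq> {}"
    using pos by (simp add: lessThan_empty_iff)
  have power_N: "(2 :: real) ^ ?N \<delta> p = (\<Prod>j<n. if xs ! j = y \<and> tallies L e (p j) then (if \<delta> j = d then 2 else 1) else 1)" for \<delta> p
  proof -
    have "(2 :: real) ^ ?N \<delta> p = (\<Prod>j\<in>{j \<in> {..<n}. \<delta> j = d \<and> tallies L e (p j) \<and> xs ! j = y}. 2)"
      by simp
    also have "\<dots> = (\<Prod>j<n. if xs ! j = y \<and> tallies L e (p j) then (if \<delta> j = d then 2 else 1) else 1)"
      by (intro prod.mono_neutral_cong_left) auto
    finally show ?thesis .
  qed
  \<comment> \<open>Averaging first over the phases, for fixed labels, leaves a product of functions
    of single labels, to which the product formula applies again.\<close>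
  have inner: "avg DS (\<lambda>\<delta>. 2 ^ ?N \<delta> p) = (\<Prod>j<n. if xs ! j = y then 1 + of_bool (tallies L e (p j)) * ?q else 1)" for p
  proof -
    have "avg DS (\<lambda>\<delta>. 2 ^ ?N \<delta> p) =
        (\<Prod>j<n. avg {..<2 * D} (\<lambda>k. if xs ! j = y \<and> tallies L e (p j) then (if k = d then 2 else 1) else 1))"
      unfolding power_N using D2
      by (intro avg_PiE_prod[where f = "\<lambda>j k. if xs ! j = y \<and> tallies L e (p j) then (if k = d then 2 else 1) else 1"]) auto
    also have "\<dots> = (\<Prod>j<n. if xs ! j = y then 1 + of_bool (tallies L e (p j)) * ?q else 1)"
    proof (intro prod.cong refl)
      fix j
      have "avg {..<2 * D} (\<lambda>k. if k = d then 2 else 1) = avg {..<2 * D} (\<lambda>k. 1 + of_bool (k = d))"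
        by (intro avg_cong) auto
      also have "\<dots> = 1 + ?q"
        using S.pr_point_assignment[OF pos(2) d] D2 by (simp add: avg_add avg_const pr_def)
      finally show "avg {..<2 * D} (\<lambda>k. if xs ! j = y \<and> tallies L e (p j) then (if k = d then 2 else 1) else 1) =
          (if xs ! j = y then 1 + of_bool (tallies L e (p j)) * ?q else 1)"
        using D2 by (simp add: avg_const)
    qed
    finally show ?thesis .
  qed
  have "avg DS (\<lambda>\<delta>. avg PA (\<lambda>p. 2 ^ ?N \<delta> p)) = avg PA (\<lambda>p. avg DS (\<lambda>\<delta>. 2 ^ ?N \<delta> p))"
    by (rule avg_swap)
  also have "\<dots> = avg PA (\<lambda>p. \<Prod>j<n. if xs ! j = y then 1 + of_bool (tallies L e (p j)) * ?q else 1)"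
    unfolding inner ..
  also have "\<dots> = (\<Prod>j<n. avg P.A (\<lambda>b. if xs ! j = y then 1 + of_bool (tallies L e b) * ?q else 1))"
    unfolding P.PA_def using P.fin
    by (intro avg_PiE_prod[where f = "\<lambda>j b. if xs ! j = y then 1 + of_bool (tallies L e b) * ?q else 1"]) auto
  also have "\<dots> = (\<Prod>j<n. if xs ! j = y then 1 + 1 / (4 * real D * real Ep) else 1)"
  proof (intro prod.cong refl)
    fix j
    have "avg P.A (\<lambda>b. 1 + of_bool (tallies L e b) * ?q) = 1 + pr P.A (tallies L e) * ?q"
      by (simp only: avg_add avg_const[OF P.fin(1,2)] avg_cmult_right pr_def)
    then show "avg P.A (\<lambda>b. if xs ! j = y then 1 + of_bool (tallies L e b) * ?q else 1) =
        (if xs ! j = y then 1 + 1 / (4 * real D * real Ep) else 1)"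
      using P.fin P.pr_tallies[OF e] by (auto simp: avg_const)
  qed
  also have "\<dots> = (1 + 1 / (4 * real D * real Ep)) ^ card {j \<in> {..<n}. xs ! j = y}"
    by (simp add: prod.If_cases Int_def)
  also have "\<dots> \<le> exp (1 / (4 * real D * real Ep)) ^ card {j \<in> {..<n}. xs ! j = y}"
    by (intro power_mono exp_ge_add_one_self) (simp add: add_nonneg_nonneg)
  also have "\<dots> = exp (S.f y * (1 / (4 * real D * real Ep)))"
    by (simp add: S.f_def exp_of_nat_mult[symmetric])
  also have "\<dots> \<le> exp (?s / 2)"
  proof -
    have "S.f y * (1 / (4 * real D * real Ep)) \<le> sqrt (\<epsilon> * S.F2) / 16 * (1 / (4 * real D * real Ep))"
      using y by (intro mult_right_mono) auto
    then show ?thesis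
      by simp
  qed
  finally have E: "avg DS (\<lambda>\<delta>. avg PA (\<lambda>p. 2 ^ ?N \<delta> p)) \<le> exp (?s / 2)" .
  \<comment> \<open>This is the condition \<open>G1\<close>, as 480/32 = 15; it makes the threshold
    grow with the number of slots.\<close>
  have "15 * real L \<le> ?s"
  proof -
    have "480 * real D * (real Ep * real L) \<le> sqrt (\<epsilon> * S.F2)"
      using G1 S.n_le_F2 pos by (intro order_trans[OF G1]) simp
    then show ?thesis
      using pos by (simp add: field_simps)
  qed
  then have s: "0 \<le> ?s" "- ?s / 4 \<le> - 3 * real L"
    by auto
  have "avg DS (\<lambda>\<delta>. pr PA (miscounted y d e \<delta>)) \<le> avg DS (\<lambda>\<delta>. avg PA (\<lambda>p. 2 ^ ?N \<delta> p) / 2 powr ?s)"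
  proof (rule avg_mono)
    fix \<delta>
    have "pr PA (miscounted y d e \<delta>) \<le> pr PA (\<lambda>p. 2 powr ?s \<le> 2 ^ ?N \<delta> p)"
    proof (rule pr_mono)
      fix p assume "miscounted y d e \<delta> p"
      then have "2 powr ?s \<le> 2 powr real (?N \<delta> p)"
        unfolding miscounted_def by (intro powr_mono) auto
      then show "2 powr ?s \<le> 2 ^ ?N \<delta> p"
        by (simp add: powr_realpow)
    qed
    also have "\<dots> \<le> avg PA (\<lambda>p. 2 ^ ?N \<delta> p) / 2 powr ?s"
      by (intro pr_markov) auto
    finally show "pr PA (miscounted y d e \<delta>) \<le> avg PA (\<lambda>p. 2 ^ ?N \<delta> p) / 2 powr ?s" .
  qed
  also have "\<dots> = avg DS (\<lambda>\<delta>. avg PA (\<lambda>p. 2 ^ ?N \<delta> p)) / 2 powr ?s"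
    using avg_cmult_right[of DS _ "1 / 2 powr ?s"] by simp
  also have "\<dots> \<le> exp (?s / 2) / 2 powr ?s"
    by (intro divide_right_mono E) simp
  also have "\<dots> \<le> 2 powr (- ?s / 4)"
    by (rule exp_half_div_powr_le) (use s in simp)
  also have "\<dots> \<le> 2 powr (- 3 * real L)"
    by (intro powr_mono s) simp
  finally show ?thesis .
qed

text \<open>For fixed phases and signs, the error terms are 2/16 for storing and probing, 1/10 for
  an overfull slot, 3/40 for false matches and 1/10 for too low a count, which add up to less than
  1/2.\<close>

lemma pr_pass_fails:
  assumes ok: "estimate_ok a" and load: "loaded_ok \<delta>" and d: "d \<in> {D..<2 * D}" and x: "x \<in> heavy"
  shows "pr (PA \<times> PB) (\<lambda>(p, g). \<not> found L c (\<theta> a) (\<tau> a) xs {j. j < n \<and> \<delta> j = d} x p g) \<le> 1 / 2"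
proof -
  let ?J = "{j. j < n \<and> \<delta> j = d}"
  interpret P: pass Ep L n H U xs ?J
    using pass_coins[of xs \<delta> d] S.xs by simp
  define r where "r = sqrt (\<epsilon> * Phi a)"
  define G where "G = real Ep * real L"
  define fJ where "fJ = real (card {j \<in> ?J. xs ! j = x})"
  define NJ where "NJ = real (card ?J)"
  define v where "v = real n * (60 * real D * G / r)"
  define s where "s = sqrt (\<epsilon> * real n)"
  let ?f = "S.f x" and ?D = "real D"
  have D1: "1 \<le> ?D" and Ep1: "1 \<le> real Ep" and L54: "54 \<le> real L" and n2: "2 \<le> real n" and G0: "54 \<le> G"
    using pos unfolding G_def by (auto intro: order_trans[OF _ mult_mono[of 1 _ 54]])
  have xU: "x \<in> U"
    using x by (simp add: heavy_def)
  have Phi: "S.F2 / 16 \<le> Phi a" "Phi a \<le> 2 * S.F2"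
    using ok by (auto simp: estimate_ok_def)
  have s0: "0 < s" "s\<^sup>2 = \<epsilon> * real n"
    using pos by (auto simp: s_def)
  have r2: "r\<^sup>2 = \<epsilon> * Phi a" "0 \<le> r"
    using pos Phi S.F2_pos by (auto simp: r_def)
  have r_lo: "s / 4 \<le> r" "sqrt (\<epsilon> * S.F2) / 4 \<le> r"
  proof -
    have "(sqrt (\<epsilon> * S.F2) / 4)\<^sup>2 = \<epsilon> * (S.F2 / 16)"
      using pos S.F2_pos by (simp add: power_divide)
    also have "\<dots> \<le> r\<^sup>2"
      unfolding r2 using pos Phi by (intro mult_left_mono) auto
    finally show 1: "sqrt (\<epsilon> * S.F2) / 4 \<le> r"
      using r2(2) by (rule power2_le_imp_le)
    have "s \<le> sqrt (\<epsilon> * S.F2)"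
      unfolding s_def using S.n_le_F2 pos by simp
    then show "s / 4 \<le> r"
      using 1 by simp
  qed
  have r0: "0 < r"
    using r_lo s0 by linarith
  have r2F: "r\<^sup>2 \<le> 2 * (\<epsilon> * S.F2)"
    unfolding r2 using pos mult_left_mono[OF Phi(2), of \<epsilon>] by simp
  \<comment> \<open>99/70 is a rational slightly above the square root of 2.\<close>
  have f_ge: "r \<le> 99 / 70 * ?f"
  proof (rule power2_le_imp_le)
    have "r\<^sup>2 \<le> 2 * ?f\<^sup>2"
      using r2F x by (simp add: heavy_def)
    also have "\<dots> \<le> (99 / 70 * ?f)\<^sup>2"
      by (simp add: power_mult_distrib power2_eq_square mult_right_mono)
    finally show "r\<^sup>2 \<le> (99 / 70 * ?f)\<^sup>2" .
  qed (use S.f_nonneg in simp)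
  have r_n: "r \<le> 2 * real n"
  proof (rule power2_le_imp_le)
    have "\<epsilon> * S.F2 \<le> 1 * (real n)\<^sup>2"
      using pos S.F2_le S.F2_pos by (intro mult_mono) auto
    show "r\<^sup>2 \<le> (2 * real n)\<^sup>2"
    proof -
      have "(2 * real n)\<^sup>2 = 4 * (real n)\<^sup>2"
        by (simp add: power_mult_distrib)
      moreover have "(0 :: real) \<le> (real n)\<^sup>2"
        by simp
      ultimately show ?thesis
        using r2F \<open>\<epsilon> * S.F2 \<le> 1 * (real n)\<^sup>2\<close> by linarith
    qed
  qed simp
  \<comment> \<open>\<open>G1\<close> together with r \<ge> s/4. It makes the thinning rate at most
    1/2, so that the rounded-up \<open>\<theta> a\<close> is still at most \<open>n\<close>.\<close>
  have DG: "120 * ?D * G \<le> r"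
    using G1 r_lo(1) unfolding s_def[symmetric] G_def by simp
  have v1: "1 \<le> v"
  proof -
    have "54 \<le> ?D * G"
      using mult_mono[of 1 ?D 54 G] D1 G0 by simp
    have "r \<le> real n * (60 * ?D * G)"
    proof -
      have "2 \<le> 60 * ?D * G"
        using \<open>54 \<le> ?D * G\<close> unfolding mult.assoc by linarith
      then have "real n * 2 \<le> real n * (60 * ?D * G)"
        by (intro mult_left_mono) auto
      then show ?thesis
        using r_n by linarith
    qed
    then show ?thesis
      using r0 by (simp add: v_def field_simps)
  qed
  have vn: "v \<le> real n / 2"
  proof -
    have "60 * ?D * G / r \<le> 1 / 2"
      using DG r0 by (simp add: field_simps)
    then show ?thesis
      unfolding v_def using mult_left_mono[of _ "1 / 2" "real n"] by fastforce
  qed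
  have \<theta>: "v \<le> real (\<theta> a)" "real (\<theta> a) \<le> 2 * v" "\<theta> a \<le> n"
  proof -
    have eq: "\<theta> a = nat \<lceil>v\<rceil>"
      by (simp add: \<theta>_def v_def G_def r_def)
    have "real (nat \<lceil>v\<rceil>) = real_of_int \<lceil>v\<rceil>"
      using v1 by simp
    moreover have "v \<le> real_of_int \<lceil>v\<rceil>" "real_of_int \<lceil>v\<rceil> \<le> v + 1"
      by linarith+
    ultimately have "v \<le> real (\<theta> a)" "real (\<theta> a) \<le> v + 1"
      unfolding eq by linarith+
    then show "v \<le> real (\<theta> a)" "real (\<theta> a) \<le> 2 * v"
      using v1 by auto
    have "real (\<theta> a) \<le> real n"
      using \<open>real (\<theta> a) \<le> v + 1\<close> vn n2 by linarith
    then show "\<theta> a \<le> n"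
      by simp
  qed
  define t where "t = P.t (\<theta> a)"
  have t: "15 * ?D / r \<le> t" "t \<le> 30 * ?D / r"
  proof -
    have t_eq: "t = real (\<theta> a) / (4 * G * real n)"
      by (simp add: t_def P.t_def G_def algebra_simps)
    have "v / (4 * G * real n) = 15 * ?D / r"
      using G0 n2 by (simp add: v_def field_simps)
    moreover have "v / (4 * G * real n) \<le> t" "t \<le> (2 * v) / (4 * G * real n)"
      unfolding t_eq using \<theta>(1,2) G0 n2 by (intro divide_right_mono; simp)+
    moreover have "(2 * v) / (4 * G * real n) = 2 * (v / (4 * G * real n))"
      by simp
    ultimately show "15 * ?D / r \<le> t" "t \<le> 30 * ?D / r"
      by simp_all
  qed
  have t0: "0 \<le> t"
    using t(1) r0 D1 by (smt (verit) divide_nonneg_pos)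
  have J: "NJ \<le> real n / ?D" "\<bar>fJ - ?f / (2 * ?D)\<bar> \<le> ?f / (16 * ?D)"
  proof -
    have "{j \<in> ?J. xs ! j = x} = {j. j < n \<and> \<delta> j = d \<and> xs ! j = x}"
      by auto
    then show "NJ \<le> real n / ?D" "\<bar>fJ - ?f / (2 * ?D)\<bar> \<le> ?f / (16 * ?D)"
      using load d x unfolding loaded_ok_def NJ_def fJ_def by auto
  qed
  have fJ: "7 * ?f / (16 * ?D) \<le> fJ" "fJ \<le> ?f"
  proof -
    have "?f / (2 * ?D) = 8 * ?f / (16 * ?D)"
      by simp
    then show "7 * ?f / (16 * ?D) \<le> fJ"
      using J(2) by (simp add: abs_le_iff diff_divide_distrib[symmetric] field_simps)
    have "card {j \<in> ?J. xs ! j = x} \<le> card {j \<in> {..<n}. xs ! j = x}"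
      by (intro card_mono) auto
    then show "fJ \<le> ?f"
      by (simp add: fJ_def S.f_def)
  qed
  have fJ0: "0 \<le> fJ" and NJ0: "0 \<le> NJ"
    by (simp_all add: fJ_def NJ_def)
  have b1: "exp (- t * fJ) \<le> 1 / 16"
  proof -
    have "4 \<le> 105 / 16 * (70 / 99 :: real)"
      by simp
    also have "\<dots> \<le> 105 / 16 * (?f / r)"
      using f_ge r0 by (intro mult_left_mono) (auto simp: field_simps)
    also have "\<dots> = (15 * ?D / r) * (7 * ?f / (16 * ?D))"
      using D1 by simp
    also have "\<dots> \<le> t * fJ"
      using t fJ t0 S.f_nonneg[of x] by (intro mult_mono) auto
    finally have "exp (- t * fJ) \<le> exp (-4)"
      by simp
    then show ?thesis
      using exp_minus_4 by (rule order_trans)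
  qed
  have c1: "115200 * ?D / \<epsilon> \<le> real c / 10" and c0: "0 < real c"
  proof -
    show "115200 * ?D / \<epsilon> \<le> real c / 10"
      using c by simp
    have "0 < 115200 * ?D / \<epsilon>"
      using pos by simp
    then show "0 < real c"
      using \<open>115200 * ?D / \<epsilon> \<le> real c / 10\<close> by linarith
  qed
  define b where "b = NJ * t / G"
  have b: "0 \<le> b" "b \<le> real c / 10"
  proof -
    show "0 \<le> b"
      using NJ0 t0 G0 by (simp add: b_def)
    \<comment> \<open>From \<open>G2\<close> and r \<ge> s/4. The expected load of a slot becomes at
      most 115200 D/\<epsilon>, a tenth of the lower bound demanded of \<open>c\<close>.\<close>
    have rG: "\<epsilon> * real n / (3840 * ?D) \<le> r * G"
    proof -
      have "s / (960 * ?D) \<le> G"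
        using G2 D1 unfolding s_def[symmetric] G_def[symmetric] by (simp add: field_simps)
      then have "s / 4 * (s / (960 * ?D)) \<le> r * G"
        using r_lo s0 r0 D1 by (intro mult_mono) auto
      also have "s / 4 * (s / (960 * ?D)) = s\<^sup>2 / (3840 * ?D)"
        by (simp add: power2_eq_square)
      finally show ?thesis
        by (simp add: s0)
    qed
    have "b \<le> (real n / ?D) * (30 * ?D / r) / G"
      unfolding b_def using J t t0 NJ0 G0 by (intro divide_right_mono mult_mono) auto
    also have "\<dots> = 30 * real n / (r * G)"
      using D1 by simp
    also have "\<dots> \<le> 30 * real n / (\<epsilon> * real n / (3840 * ?D))"
      using rG pos r0 G0 by (intro divide_left_mono) auto
    also have "\<dots> = 115200 * ?D / \<epsilon>"
      using pos by (simp add: field_simps)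
    finally show "b \<le> real c / 10"
      using c1 by simp
  qed
  have b2: "NJ * t / (real Ep * real L) / real c \<le> 1 / 10"
  proof -
    have "b / real c \<le> real c / 10 / real c"
      using b c0 by (intro divide_right_mono) auto
    also have "\<dots> = 1 / 10"
      using c0 by simp
    finally show ?thesis
      unfolding b_def G_def .
  qed
  have ratio: "q / h \<le> 1 / 40" if "q \<le> h / 40" "0 < h" for q h :: real
    using that by (simp add: divide_le_eq)
  have H0: "0 < real H"
    using pos by simp
  \<comment> \<open>Bounds the expected number of copy pairs of one item that match in a pass;
    \<open>Ep\<close> is required to be 40 times this bound.\<close>
  have t2: "t\<^sup>2 * S.F2 \<le> 14400 * ?D\<^sup>2 / \<epsilon>"
  proof -
    have "t\<^sup>2 \<le> (30 * ?D / r)\<^sup>2"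
      using t t0 by (intro power_mono) auto
    also have "\<dots> = 900 * ?D\<^sup>2 / r\<^sup>2"
      by (simp add: power_divide power_mult_distrib)
    also have "\<dots> \<le> 900 * ?D\<^sup>2 / (\<epsilon> * (S.F2 / 16))"
    proof (rule divide_left_mono)
      show "\<epsilon> * (S.F2 / 16) \<le> r\<^sup>2"
        unfolding r2 using pos Phi by (intro mult_left_mono) auto
      show "0 < r\<^sup>2 * (\<epsilon> * (S.F2 / 16))"
        using pos S.F2_pos r0 by simp
    qed simp
    finally have "t\<^sup>2 * S.F2 \<le> 900 * ?D\<^sup>2 / (\<epsilon> * (S.F2 / 16)) * S.F2"
      using S.F2_pos by (intro mult_right_mono) auto
    then show ?thesis
      using S.F2_pos pos by (simp add: field_simps)
  qed
  have b3: "t\<^sup>2 * ((\<Sum>i\<in>?J. real (card {j \<in> ?J. xs ! j = xs ! i})) / real Ep) \<le> 1 / 40"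
  proof -
    have "(\<Sum>i\<in>?J. real (card {j \<in> ?J. xs ! j = xs ! i})) \<le> (\<Sum>i\<in>?J. S.f (xs ! i))"
      unfolding S.f_def by (intro sum_mono of_nat_mono card_mono) auto
    also have "\<dots> \<le> (\<Sum>i<n. S.f (xs ! i))"
      using S.f_nonneg by (intro sum_mono2) auto
    also have "\<dots> = S.F2"
      by (simp add: S.sum_h S.F2_def power2_eq_square)
    finally have "t\<^sup>2 * ((\<Sum>i\<in>?J. real (card {j \<in> ?J. xs ! j = xs ! i})) / real Ep) \<le> t\<^sup>2 * (S.F2 / real Ep)"
      by (intro mult_left_mono divide_right_mono) auto
    also have "\<dots> \<le> (14400 * ?D\<^sup>2 / \<epsilon>) / real Ep"
      unfolding times_divide_eq_right[of "t\<^sup>2"] by (intro divide_right_mono t2) simp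
    also have "\<dots> \<le> 1 / 40"
    proof (rule ratio)
      have "576000 * ?D\<^sup>2 / \<epsilon> = 40 * (14400 * ?D\<^sup>2 / \<epsilon>)"
        by simp
      then show "14400 * ?D\<^sup>2 / \<epsilon> \<le> real Ep / 40"
        using Ep by linarith
    qed (use Ep1 in simp)
    finally show ?thesis .
  qed
  have tf: "t * fJ \<le> real c"
  proof -
    have eps_sqrt: "\<epsilon> \<le> sqrt \<epsilon>"
      using pos by (intro real_le_rsqrt) (simp add: power2_eq_square mult_le_one mult_left_le)
    have "t * fJ \<le> (30 * ?D / r) * sqrt S.F2"
      using t fJ fJ0 t0 S.f_le_sqrt_F2[of x] r0 D1 by (intro mult_mono) auto
    also have "\<dots> \<le> (30 * ?D / (sqrt (\<epsilon> * S.F2) / 4)) * sqrt S.F2"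
      using r_lo r0 pos S.F2_pos by (intro mult_right_mono divide_left_mono) auto
    also have "\<dots> = 120 * ?D / sqrt \<epsilon>"
      using S.F2_pos pos by (simp add: real_sqrt_mult field_simps)
    also have "\<dots> \<le> 120 * ?D / \<epsilon>"
      using eps_sqrt pos by (intro divide_left_mono) auto
    also have "\<dots> \<le> 1152000 * ?D / \<epsilon>"
      using pos by (intro divide_right_mono) auto
    finally show ?thesis
      using c by simp
  qed
  have cH: "real c * real c * 40 \<le> real H" "real c * real c * 40 * real L \<le> real H"
  proof -
    show "real c * real c * 40 * real L \<le> real H"
      using H by (simp add: power2_eq_square mult_ac)
    moreover have "real c * real c * 40 * 1 \<le> real c * real c * 40 * real L"
      using L54 by (intro mult_left_mono) auto
    ultimately show "real c * real c * 40 \<le> real H"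
      by linarith
  qed
  have b4: "t\<^sup>2 * (NJ * fJ / (real Ep * real L * real H)) \<le> 1 / 40"
  proof -
    have "t\<^sup>2 * (NJ * fJ / (real Ep * real L * real H)) = b * (t * fJ) / real H"
      by (simp add: b_def G_def power2_eq_square)
    also have "\<dots> \<le> (real c / 10) * real c / real H"
      using b tf t0 fJ0 by (intro divide_right_mono mult_mono) auto
    also have "\<dots> \<le> 1 / 40"
    proof (rule ratio)
      have "real c / 10 * real c = real c * real c / 10" "0 \<le> real c * real c"
        by simp_all
      then show "real c / 10 * real c \<le> real H / 40"
        using cH(1) by linarith
    qed (rule H0)
    finally show ?thesis .
  qed
  have b5: "t\<^sup>2 * (NJ\<^sup>2 / (real Ep * (real Ep * real L * real H))) \<le> 1 / 40"
  proof -
    have "t\<^sup>2 * (NJ\<^sup>2 / (real Ep * (real Ep * real L * real H))) = b * b * real L / real H"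
      using L54 by (simp add: b_def G_def power2_eq_square mult_ac)
    also have "\<dots> \<le> (real c / 10) * (real c / 10) * real L / real H"
      using b by (intro divide_right_mono mult_right_mono mult_mono) auto
    also have "\<dots> \<le> 1 / 40"
    proof (rule ratio)
      have "real c / 10 * (real c / 10) * real L = (real c * real c * real L) / 100"
        "real c * real c * 40 * real L = 40 * (real c * real c * real L)" "0 \<le> real c * real c * real L"
        by simp_all
      then show "real c / 10 * (real c / 10) * real L \<le> real H / 40"
        using cH(2) by linarith
    qed (rule H0)
    finally show ?thesis .
  qed
  define \<nu> where "\<nu> = fJ / (2 * real Ep)"
  have \<tau>: "\<tau> a = r / (8 * ?D * real Ep)"
    by (simp add: \<tau>_def r_def)
  have \<tau>\<nu>: "9 / 8 * \<tau> a \<le> \<nu>"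
  proof -
    have "9 / 8 * \<tau> a \<le> 9 / 8 * (99 / 70 * ?f / (8 * ?D * real Ep))"
      unfolding \<tau> using f_ge by (intro mult_left_mono divide_right_mono) auto
    also have "\<dots> \<le> 7 * ?f / (16 * ?D) / (2 * real Ep)"
      using S.f_nonneg[of x] D1 Ep1 by (simp add: divide_simps)
    also have "\<dots> \<le> \<nu>"
      unfolding \<nu>_def using fJ by (intro divide_right_mono) auto
    finally show ?thesis .
  qed
  \<comment> \<open>Here the requirement of 54 slots enters: 15 * 54 = 810, and the variance bound
    below equals 81/\<nu>, which has to be at most 1/10.\<close>
  have \<tau>L: "810 \<le> \<tau> a"
  proof -
    have "15 * real L = 120 * ?D * G / (8 * ?D * real Ep)"
      using D1 Ep1 by (simp add: G_def)
    also have "\<dots> \<le> \<tau> a"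
      unfolding \<tau> using DG by (intro divide_right_mono) auto
    finally show ?thesis
      using L54 by linarith
  qed
  have \<nu>0: "911 \<le> \<nu>"
    using \<tau>L \<tau>\<nu> by linarith
  have b6: "\<nu> / (\<nu> - \<tau> a)\<^sup>2 \<le> 1 / 10"
  proof -
    have "(\<nu> / 9)\<^sup>2 \<le> (\<nu> - \<tau> a)\<^sup>2"
      using \<tau>\<nu> \<nu>0 by (intro power_mono) auto
    then have "\<nu> / (\<nu> - \<tau> a)\<^sup>2 \<le> \<nu> / (\<nu> / 9)\<^sup>2"
      using \<nu>0 \<tau>\<nu> \<tau>L by (intro divide_left_mono) auto
    also have "\<dots> = 81 / \<nu>"
      using \<nu>0 by (simp add: power2_eq_square)
    also have "\<dots> \<le> 1 / 10"
      using \<nu>0 by (simp add: divide_le_eq)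
    finally show ?thesis .
  qed
  have "pr (PA \<times> PB) (\<lambda>(p, g). \<not> found L c (\<theta> a) (\<tau> a) xs ?J x p g) \<le>
    2 * exp (- t * fJ) + NJ * t / (real Ep * real L) / real c +
    t\<^sup>2 * ((\<Sum>i\<in>?J. real (card {j \<in> ?J. xs ! j = xs ! i})) / real Ep + NJ * fJ / (real Ep * real L * real H)
       + NJ\<^sup>2 / (real Ep * (real Ep * real L * real H))) + \<nu> / (\<nu> - \<tau> a)\<^sup>2"
    using P.pr_not_found[of "\<theta> a" c x "\<tau> a"] \<theta>(3) c0 xU \<tau>\<nu> \<tau>L
    unfolding t_def fJ_def NJ_def \<nu>_def by simp
  also have "\<dots> \<le> 1 / 2"
    using b1 b2 b3 b4 b5 b6 unfolding distrib_left by linarith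
  finally show ?thesis .
qed

definition correct :: "'u coins \<Rightarrow> bool" where
  "correct \<omega> \<longleftrightarrow> (case \<omega> of (\<delta>, sg, ps) \<Rightarrow>
    estimate_ok (counters \<delta> sg) \<and>
    (\<forall>y\<in>{y \<in> U. S.f y \<le> sqrt (\<epsilon> * S.F2) / 16 \<and> (S.f y)\<^sup>2 < \<epsilon> / 256 * S.F2}.
       \<forall>d\<in>{D..<2 * D}. \<forall>e\<in>{..<Ep}. \<not> miscounted y d e \<delta> (fst (ps d))) \<and>
    (\<forall>x\<in>heavy. \<exists>d\<in>{D..<2 * D}. found L c (\<theta> (counters \<delta> sg)) (\<tau> (counters \<delta> sg)) xs
       {j. j < n \<and> \<delta> j = d} x (fst (ps d)) (snd (ps d))))"

text \<open>The errors are 26/1000 for the estimate, 2/1000 for the load, 1/1000 for light items and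
  1/100 for missed heavy hitters. The last event includes a good estimate and a good load, so that
  \<open>pr_pass_fails\<close> applies; with phases and signs fixed, the passes are independent and
  their failure probabilities multiply.\<close>

lemma pr_incorrect: "pr coins (\<lambda>\<omega>. \<not> correct \<omega>) \<le> 1 / 20"
proof -
  let ?light = "{y \<in> U. S.f y \<le> sqrt (\<epsilon> * S.F2) / 16 \<and> (S.f y)\<^sup>2 < \<epsilon> / 256 * S.F2}"
  let ?E1 = "\<lambda>\<delta> sg. \<not> estimate_ok (counters \<delta> sg)"
  let ?E3 = "\<lambda>\<delta> ps. \<exists>y\<in>?light. \<exists>d\<in>{D..<2 * D}. \<exists>e\<in>{..<Ep}. miscounted y d e \<delta> (fst (ps d))"
  let ?E4 = "\<lambda>\<delta> sg ps. estimate_ok (counters \<delta> sg) \<and> loaded_ok \<delta> \<and>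
      (\<exists>x\<in>heavy. \<forall>d\<in>{D..<2 * D}. \<not> found L c (\<theta> (counters \<delta> sg)) (\<tau> (counters \<delta> sg)) xs
         {j. j < n \<and> \<delta> j = d} x (fst (ps d)) (snd (ps d)))"
  have fin_heavy: "finite heavy" and fin_light: "finite ?light"
    using U by (auto simp: heavy_def)
  have "pr coins (\<lambda>\<omega>. \<not> correct \<omega>) \<le>
      pr coins (\<lambda>(\<delta>, sg, ps). ?E1 \<delta> sg \<or> \<not> loaded_ok \<delta> \<or> ?E3 \<delta> ps \<or> ?E4 \<delta> sg ps)"
    by (intro pr_mono) (auto simp: correct_def)
  also have "\<dots> \<le> pr coins (\<lambda>(\<delta>, sg, ps). ?E1 \<delta> sg) + (pr coins (\<lambda>(\<delta>, sg, ps). \<not> loaded_ok \<delta>) +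
      (pr coins (\<lambda>(\<delta>, sg, ps). ?E3 \<delta> ps) + pr coins (\<lambda>(\<delta>, sg, ps). ?E4 \<delta> sg ps)))"
    unfolding case_prod_unfold by (intro order_trans[OF pr_disj] add_left_mono order_refl)
  also have "pr coins (\<lambda>(\<delta>, sg, ps). ?E1 \<delta> sg) = pr (DS \<times> SG) (\<lambda>(\<delta>, sg). ?E1 \<delta> sg)"
    using fin by (simp add: coins_def pr_def avg_Times avg_const)
  also have "pr coins (\<lambda>(\<delta>, sg, ps). \<not> loaded_ok \<delta>) = pr DS (\<lambda>\<delta>. \<not> loaded_ok \<delta>)"
    using fin by (simp add: coins_def pr_def avg_Times avg_const)
  also have "pr coins (\<lambda>(\<delta>, sg, ps). ?E3 \<delta> ps) \<le> 1 / 1000"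
  proof -
    have one: "pr coins (\<lambda>(\<delta>, sg, ps). miscounted y d e \<delta> (fst (ps d))) \<le> 2 powr (- 3 * real L)"
      if "y \<in> ?light" "d \<in> {D..<2 * D}" "e \<in> {..<Ep}" for y d e
    proof -
      have "pr coins (\<lambda>(\<delta>, sg, ps). miscounted y d e \<delta> (fst (ps d))) =
          avg DS (\<lambda>\<delta>. avg PS (\<lambda>ps. of_bool (miscounted y d e \<delta> (fst (ps d)))))"
        using fin by (simp add: coins_def pr_def avg_Times avg_const)
      also have "\<dots> = avg DS (\<lambda>\<delta>. avg (PA \<times> PB) (\<lambda>z. of_bool (miscounted y d e \<delta> (fst z))))"
        using fin that by (intro avg_cong avg_PiE_1[where F = "\<lambda>z. of_bool (miscounted y d e _ (fst z))"]) auto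
      also have "\<dots> = avg DS (\<lambda>\<delta>. pr PA (miscounted y d e \<delta>))"
        using fin by (simp add: pr_def avg_Times avg_const)
      also have "\<dots> \<le> 2 powr (- 3 * real L)"
        using that by (intro pr_miscounted) auto
      finally show ?thesis .
    qed
    have "pr coins (\<lambda>(\<delta>, sg, ps). ?E3 \<delta> ps) \<le>
        real (card ?light) * (real (card {D..<2 * D}) * (real (card {..<Ep}) * 2 powr (- 3 * real L)))"
      unfolding case_prod_unfold using one[unfolded case_prod_unfold] fin_light
      by (intro pr_Bex_le) auto
    also have "\<dots> \<le> real (card U) * (real D * (real Ep * 2 powr (- 3 * real L)))"
      using U card_mono[of U ?light] by (intro mult_mono) auto
    finally show ?thesis
      using small_tally by simp
  qed
  also have "pr coins (\<lambda>(\<delta>, sg, ps). ?E4 \<delta> sg ps) \<le> 1 / 100"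
  proof -
    have "pr PS (?E4 \<delta> sg) \<le> 1 / 100" for \<delta> sg
    proof (cases "estimate_ok (counters \<delta> sg) \<and> loaded_ok \<delta>")
      case True
      let ?F = "\<lambda>x d z. \<not> found L c (\<theta> (counters \<delta> sg)) (\<tau> (counters \<delta> sg)) xs
         {j. j < n \<and> \<delta> j = d} x (fst z) (snd z)"
      have "pr PS (?E4 \<delta> sg) \<le> pr PS (\<lambda>ps. \<exists>x\<in>heavy. \<forall>d\<in>{D..<2 * D}. ?F x d (ps d))"
        by (intro pr_mono) auto
      also have "\<dots> \<le> real (card heavy) * (1 / 2) ^ D"
      proof (rule pr_Bex_le[OF fin_heavy])
        fix x assume x: "x \<in> heavy"
        have "pr PS (\<lambda>ps. \<forall>d\<in>{D..<2 * D}. ?F x d (ps d)) =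
            avg PS (\<lambda>ps. \<Prod>d\<in>{D..<2 * D}. of_bool (?F x d (ps d)))"
          unfolding pr_def
        proof (rule avg_cong)
          fix ps
          have "of_bool (\<forall>d\<in>K. ?F x d (ps d)) = (\<Prod>d\<in>K. of_bool (?F x d (ps d)) :: real)" if "finite K" for K
            using that by (induction K) auto
          then show "of_bool (\<forall>d\<in>{D..<2 * D}. ?F x d (ps d)) = (\<Prod>d\<in>{D..<2 * D}. of_bool (?F x d (ps d)) :: real)"
            by blast
        qed
        also have "\<dots> = (\<Prod>d\<in>{D..<2 * D}. avg (PA \<times> PB) (\<lambda>z. of_bool (?F x d z)))"
          using fin by (intro avg_PiE_prod[where f = "\<lambda>d z. of_bool (?F x d z)"]) auto
        also have "\<dots> \<le> (\<Prod>d\<in>{D..<2 * D}. 1 / 2)"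
        proof (intro prod_mono conjI)
          fix d assume "d \<in> {D..<2 * D}"
          then show "avg (PA \<times> PB) (\<lambda>z. of_bool (?F x d z)) \<le> 1 / 2"
            using pr_pass_fails[of "counters \<delta> sg" \<delta> d x] True x unfolding pr_def case_prod_unfold by simp
          show "0 \<le> avg (PA \<times> PB) (\<lambda>z. of_bool (?F x d z))"
            by (intro avg_nonneg) auto
        qed
        also have "\<dots> = (1 / 2) ^ D"
          by simp
        finally show "pr PS (\<lambda>ps. \<forall>d\<in>{D..<2 * D}. ?F x d (ps d)) \<le> (1 / 2) ^ D" .
      qed
      also have "\<dots> \<le> 1 / \<epsilon> * (1 / 2) ^ D"
        using card_heavy by (intro mult_right_mono) auto
      finally show ?thesis
        using small_miss by linarith
    next
      case False
      then have "pr PS (?E4 \<delta> sg) = pr PS (\<lambda>_. False)"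
        by (intro pr_cong) auto
      then show ?thesis
        by (simp add: pr_def)
    qed
    then show ?thesis
      unfolding coins_def pr_Times prod.case using fin
      by (intro avg_le_const) (auto simp: pr_def avg_Times intro!: avg_le_const)
  qed
  finally show ?thesis
    using pr_estimate pr_load by simp
qed

end

context scheme
begin

abbreviation absorb :: "'u coins \<Rightarrow> label \<times> 'u \<Rightarrow> int list \<times> 'u finder \<Rightarrow> int list \<times> 'u finder" where
  "absorb \<omega> \<equiv> scan.absorb D L c M m \<theta> \<tau> (fst (snd \<omega>)) (hashes \<omega>)"

definition init :: "int list \<times> 'u finder" where "init = (replicate m 0, finder_init)"

definition schedule :: "'u coins \<Rightarrow> label list" where
  "schedule \<omega> = sort_key schedule_key (map (lab \<omega>) [0..<n])"

definition listed :: "int list \<times> 'u finder \<Rightarrow> 'u set" where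
  "listed st = set (snd (snd (snd st)))"

definition accurate :: "'u multiset \<Rightarrow> 'u set \<Rightarrow> bool" where
  "accurate S A \<longleftrightarrow> heavy_hitters U \<epsilon> S \<subseteq> A \<and> A \<subseteq> heavy_hitters U (\<epsilon> / 256) S"

end

context scheme_stream
begin

lemma heavy_hitters_eq: "heavy_hitters U e (mset xs) = {x \<in> U. e * S.F2 \<le> (S.f x)\<^sup>2}"
proof -
  have "(l2_norm U (mset xs))\<^sup>2 = S.F2"
    by (simp add: l2_norm_def L2_set_def S.F2_def S.f_count sum_nonneg)
  then show ?thesis
    by (simp add: heavy_hitters_def S.f_count)
qed

text \<open>A reported item reached the threshold in some pass and epoch and would be
  \<open>miscounted\<close> if it were light. A heavy hitter is found in some pass, whatever the
  order of copies with equal keys.\<close>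

lemma correct_accurate:
  assumes \<omega>: "\<omega> \<in> coins" "correct \<omega>"
    and zs: "mset zs = mset (zip (map (lab \<omega>) [0..<n]) xs)" "sorted (map (\<lambda>z. schedule_key (fst z)) zs)"
  shows "accurate (mset xs) (listed (fold (absorb \<omega>) zs init))"
proof -
  obtain \<delta> sg ps where w: "\<omega> = (\<delta>, sg, ps)"
    by (metis prod_cases3)
  define a where "a = counters \<delta> sg"
  let ?g = "hashes \<omega>"
  have \<delta>: "\<delta> j < 2 * D" if "j < n" for j
    using \<omega>(1) that unfolding w coins_def by auto
  have ps: "fst (ps d) \<in> PA" "snd (ps d) \<in> PB" if "d \<in> {D..<2 * D}" for d
    using \<omega>(1) PiE_mem[OF _ that, of ps "\<lambda>_. PA \<times> PB"] unfolding w coins_def by (auto simp: mem_Times_iff)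
  have lab1: "fst (lab \<omega> j) = \<delta> j" for j
    by (simp add: w)
  have lab2: "snd (lab \<omega> j) = fst (ps d) j" if "\<delta> j = d" "D \<le> d" for j d
    using that by (simp add: w)
  have len: "length xs = n"
    by (rule S.xs)
  have a_eq: "a = map (\<lambda>k. \<Sum>j<length xs. of_bool (fst (lab \<omega> j) < D) * sg k (xs ! j)) [0..<m]"
    unfolding a_def counters_def lab1 len ..
  note scan = zs(1)[folded len] zs(2) a_eq
  define evs where "evs = scan.evs D L \<theta> ?g zs a"
  define fin_st where "fin_st = fold (react c M (\<tau> a)) evs finder_init"
  have sg_eq: "fst (snd \<omega>) = sg"
    by (simp add: w)
  have run: "fold (absorb \<omega>) zs init = (a, fin_st)"
    unfolding init_def fin_st_def evs_def sg_eq by (rule scan.fold_absorb_sorted[OF scan])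
  have listed: "listed (fold (absorb \<omega>) zs init) = set (snd (snd fin_st))"
    unfolding run listed_def by simp
  have ok: "estimate_ok a" and heavyD: "\<And>x. x \<in> heavy \<Longrightarrow> \<exists>d\<in>{D..<2 * D}. found L c (\<theta> a) (\<tau> a) xs
       {j. j < n \<and> \<delta> j = d} x (fst (ps d)) (snd (ps d))"
    and light: "\<And>y d e. y \<in> U \<Longrightarrow> S.f y \<le> sqrt (\<epsilon> * S.F2) / 16 \<Longrightarrow> (S.f y)\<^sup>2 < \<epsilon> / 256 * S.F2 \<Longrightarrow>
      d \<in> {D..<2 * D} \<Longrightarrow> e < Ep \<Longrightarrow> \<not> miscounted y d e \<delta> (fst (ps d))"
    using \<omega>(2) unfolding correct_def w prod.case a_def by auto
  have Phi: "S.F2 / 16 \<le> Phi a"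
    using ok by (simp add: estimate_ok_def)
  have \<tau>_ge: "sqrt (\<epsilon> * S.F2) / (32 * real D * real Ep) \<le> \<tau> a" and \<tau>0: "0 < \<tau> a"
  proof -
    have "sqrt (\<epsilon> * S.F2) / 4 = sqrt (\<epsilon> * (S.F2 / 16))"
      using pos S.F2_pos by (simp add: real_sqrt_divide)
    also have "\<dots> \<le> sqrt (\<epsilon> * Phi a)"
      using Phi pos by (intro real_sqrt_le_mono mult_left_mono) auto
    finally have le: "sqrt (\<epsilon> * S.F2) / 4 \<le> sqrt (\<epsilon> * Phi a)" .
    then have "sqrt (\<epsilon> * S.F2) / 4 / (8 * real D * real Ep) \<le> \<tau> a"
      unfolding \<tau>_def by (intro divide_right_mono) auto
    then show "sqrt (\<epsilon> * S.F2) / (32 * real D * real Ep) \<le> \<tau> a"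
      by simp
    moreover have "0 < sqrt (\<epsilon> * S.F2) / (32 * real D * real Ep)"
      using pos S.F2_pos by simp
    ultimately show "0 < \<tau> a"
      by linarith
  qed
  have sound: "y \<in> U \<and> \<epsilon> / 256 * S.F2 \<le> (S.f y)\<^sup>2" if y: "y \<in> set (snd (snd fin_st))" for y
  proof -
    obtain d e where de: "\<not> d < D"
      "\<tau> a \<le> real (card {j. j < length xs \<and> fst (lab \<omega> j) = d \<and> tallies L e (snd (lab \<omega> j)) \<and> xs ! j = y})"
      using scan.out_sound[where \<theta> = \<theta> and \<tau> = \<tau> and g = "hashes \<omega>" and L = L and c = c and M = M, OF scan y[unfolded fin_st_def evs_def]] \<tau>0 by auto
    let ?K = "{j. j < length xs \<and> fst (lab \<omega> j) = d \<and> tallies L e (snd (lab \<omega> j)) \<and> xs ! j = y}"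
    have "?K \<noteq> {}"
      using de \<tau>0 by (metis card.empty linorder_not_less of_nat_0)
    then obtain j where j: "j < n" "\<delta> j = d" "tallies L e (snd (lab \<omega> j))" "xs ! j = y"
      unfolding len lab1 by auto
    have d: "d \<in> {D..<2 * D}"
      using \<delta>[OF j(1)] j(2) de by simp
    have yU: "y \<in> U"
      using j S.xs by (auto dest: nth_mem)
    have "fst (ps d) j \<in> pass.A Ep L n"
      using ps(1)[OF d] j unfolding PA_def by auto
    then have e: "e < Ep"
      using j(3) lab2[OF j(2)] d unfolding A_def by (auto simp: tallies_def)
    have "?K = {j \<in> {..<n}. \<delta> j = d \<and> tallies L e (fst (ps d) j) \<and> xs ! j = y}"
      using d lab2 unfolding len lab1 by auto
    then have mis: "miscounted y d e \<delta> (fst (ps d))"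
      using de(2) \<tau>_ge unfolding miscounted_def by simp
    have "\<epsilon> / 256 * S.F2 \<le> (S.f y)\<^sup>2"
    proof (rule ccontr)
      assume "\<not> ?thesis"
      then have f: "(S.f y)\<^sup>2 < \<epsilon> / 256 * S.F2"
        by simp
      have "S.f y \<le> sqrt (\<epsilon> / 256 * S.F2)"
        using f S.f_nonneg[of y] by (intro real_le_rsqrt) simp
      also have "\<dots> = sqrt (\<epsilon> * S.F2) / 16"
        using pos S.F2_pos by (simp add: real_sqrt_divide)
      finally show False
        using light[OF yU _ f d e] mis by blast
    qed
    then show ?thesis
      using yU by blast
  qed
  \<comment> \<open>Reported items are \<open>\<epsilon> / 256\<close> heavy hitters, of which there
    are at most \<open>256 / \<epsilon> < M\<close>. The list is therefore never full, and
    \<open>out_complete\<close> yields membership.\<close>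
  have short: "length (snd (snd fin_st)) < M"
  proof -
    let ?Hs = "{y \<in> U. \<epsilon> / 256 * S.F2 \<le> (S.f y)\<^sup>2}"
    have "real (card ?Hs) * (\<epsilon> / 256 * S.F2) = (\<Sum>y\<in>?Hs. \<epsilon> / 256 * S.F2)"
      by simp
    also have "\<dots> \<le> (\<Sum>y\<in>?Hs. (S.f y)\<^sup>2)"
      by (intro sum_mono) auto
    also have "\<dots> \<le> S.F2"
      unfolding S.F2_def using U by (intro sum_mono2) auto
    finally have "real (card ?Hs) \<le> 256 / \<epsilon>"
      using pos S.F2_pos by (simp add: field_simps)
    moreover have "card (set (snd (snd fin_st))) \<le> card ?Hs"
      using sound U by (intro card_mono) auto
    moreover have "length (snd (snd fin_st)) = card (set (snd (snd fin_st)))"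
      using scan.out_bounded[where \<theta> = \<theta> and \<tau> = \<tau> and g = "hashes \<omega>" and L = L and c = c and M = M, OF scan] unfolding fin_st_def evs_def by (simp add: distinct_card)
    ultimately have "real (length (snd (snd fin_st))) < real M"
      using M by linarith
    then show ?thesis
      by simp
  qed
  have complete: "x \<in> set (snd (snd fin_st))" if x: "x \<in> heavy" for x
  proof -
    obtain d where d: "d \<in> {D..<2 * D}" and F: "found L c (\<theta> a) (\<tau> a) xs
       {j. j < n \<and> \<delta> j = d} x (fst (ps d)) (snd (ps d))"
      using heavyD[OF x] by blast
    have xU: "x \<in> U"
      using x by (simp add: heavy_def)
    have g: "?g d = snd (ps d)"
      by (simp add: hashes_def w)
    have slot: "snd (fst (?g d x)) < L"
      using pass.PB_slot[OF pass_empty ps(2)[OF d] xU] g by simp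
    have "found L c (\<theta> a) (\<tau> a) xs {j. j < length xs \<and> fst (lab \<omega> j) = d} x (\<lambda>j. snd (lab \<omega> j)) (?g d)"
      using F d lab2 unfolding len lab1 g by (subst found_cong[where p' = "fst (ps d)"]) auto
    from scan.out_complete[where \<theta> = \<theta> and \<tau> = \<tau> and g = "hashes \<omega>" and L = L and c = c and M = M, OF scan _ slot \<tau>0 this] show ?thesis
      using d short unfolding fin_st_def evs_def by auto
  qed
  show ?thesis
    unfolding accurate_def heavy_hitters_eq listed
    using sound complete by (auto simp: heavy_def)
qed

end

section \<open>Seeds, the resulting automaton and the number of its states\<close>

context scheme
begin

lemma seed_failure:
  assumes xs: "set xs \<subseteq> U" "length xs = n"
  shows "avg coins (\<lambda>\<omega>. pr {p. p permutes {..<n}} (\<lambda>p. \<not> accurate (mset xs)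
      (listed (fold (absorb \<omega>) (zip (schedule \<omega>) (permute_list p xs)) init)))) \<le> 1 / 20"
proof -
  interpret scheme_stream U n D L Ep H c M m \<epsilon> xs
    using xs pos U by unfold_locales auto
  have "avg coins (\<lambda>\<omega>. pr {p. p permutes {..<length xs}} (\<lambda>p. \<not> accurate (mset xs)
      (listed (fold (absorb \<omega>) (zip (schedule \<omega>) (permute_list p xs)) init)))) \<le> pr coins (\<lambda>\<omega>. \<not> correct \<omega>)"
  proof (rule random_order_sorted_labels[where lab = lab and key = schedule_key and T = shuffle])
    show "bij_betw (shuffle p) coins coins" if "p permutes {..<length xs}" for p
      using that xs by (intro bij_shuffle) simp
    show "lab (shuffle p \<omega>) i = lab \<omega> (p i)" if "p permutes {..<length xs}" "\<omega> \<in> coins" "i < length xs" for p \<omega> i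
      using that xs by (intro lab_shuffle) auto
    fix p \<omega> and ys :: "'u list"
    assume p: "p permutes {..<length xs}" and \<omega>: "\<omega> \<in> coins" and C: "correct (shuffle p \<omega>)"
      and len: "length ys = length xs"
      and eq: "mset (zip (sort_key schedule_key (map (lab \<omega>) [0..<length xs])) ys) =
        mset (zip (map (lab (shuffle p \<omega>)) [0..<length xs]) xs)"
    \<comment> \<open>The automaton runs with \<open>\<omega>\<close>, while correctness is known
      for the relabelled coins; both process a labelled item in the same way.\<close>
    have abs_eq: "absorb (shuffle p \<omega>) = absorb \<omega>"
      using \<omega> by (simp add: hashes_shuffle signs_shuffle)
    have "map fst (zip (schedule \<omega>) ys) = schedule \<omega>"
      using len xs by (simp add: schedule_def)
    moreover have "map (\<lambda>z. schedule_key (fst z)) (zip (schedule \<omega>) ys) =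
        map schedule_key (map fst (zip (schedule \<omega>) ys))"
      by simp
    ultimately have "sorted (map (\<lambda>z. schedule_key (fst z)) (zip (schedule \<omega>) ys))"
      by (simp add: schedule_def)
    from correct_accurate[OF _ C _ this] show "accurate (mset xs) (listed (fold (absorb \<omega>) (zip (schedule \<omega>) ys) init))"
      using eq xs p \<omega> shuffle_in_coins[of p \<omega>] unfolding abs_eq by (simp add: schedule_def)
  qed
  then show ?thesis
    using pr_incorrect xs by simp
qed

text \<open>Of the coins only the index \<open>i\<close> is kept in memory, next to the clock
  \<open>k\<close>; labels, signs and hash values come from the fixed table \<open>s\<close>. The
  guard stops the clock at \<open>n\<close>, which keeps the states finite on inputs of any
  length.\<close>

definition seeded_step :: "(nat \<Rightarrow> 'u coins) \<Rightarrow> 'u \<Rightarrow> nat \<times> nat \<times> int list \<times> 'u finder \<Rightarrow> nat \<times> nat \<times> int list \<times> 'u finder" where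
  "seeded_step s y q = (case q of (i, k, st) \<Rightarrow>
     if k < n then (i, Suc k, absorb (s i) (schedule (s i) ! k, y) st) else q)"

lemma length_schedule [simp]: "length (schedule \<omega>) = n"
  by (simp add: schedule_def)

lemma fold_seeded_step:
  assumes "k + length ys \<le> n"
  shows "fold (seeded_step s) ys (i, k, st) =
    (i, k + length ys, fold (absorb (s i)) (zip (drop k (schedule (s i))) ys) st)"
  using assms
proof (induction ys arbitrary: k st)
  case (Cons y ys)
  have "drop k (schedule (s i)) = schedule (s i) ! k # drop (Suc k) (schedule (s i))"
    using Cons.prems by (simp add: Cons_nth_drop_Suc)
  then show ?case
    using Cons by (simp add: seeded_step_def)
qed simp

text \<open>The argument is the clock: after \<open>k\<close> items no count exceeds
  \<open>k\<close>. Tying the bounds to the clock gives a family of finite sets through which every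
  step passes.\<close>

definition finder_states :: "nat \<Rightarrow> 'u finder set" where
  "finder_states k = {((T, S), r, out) | T S r out.
     T \<in> {..<2 * D} \<times> {..<Ep} \<times> {..<L} \<and> set S \<subseteq> {..<H} \<and> length S \<le> c \<and>
     r \<in> insert None (Some ` (({..<2 * D} \<times> {..<Ep}) \<times> U \<times> {..k})) \<and> set out \<subseteq> U \<and> length out \<le> M}"

definition memory_states :: "nat \<Rightarrow> (int list \<times> 'u finder) set" where
  "memory_states k = {a. set a \<subseteq> {- int k..int k} \<and> length a = m} \<times> finder_states k"

lemma react_states:
  assumes st: "st \<in> finder_states k"
    and "\<And>T h. v = Store T h \<Longrightarrow> T \<in> {..<2 * D} \<times> {..<Ep} \<times> {..<L} \<and> h < H"
    and "\<And>T h y. v = Probe T h y \<Longrightarrow> T \<in> {..<2 * D} \<times> {..<Ep} \<times> {..<L} \<and> y \<in> U"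
    and "\<And>E y. v = Tally E y \<Longrightarrow> E \<in> {..<2 * D} \<times> {..<Ep} \<and> y \<in> U"
  shows "react c M t v st \<in> finder_states (Suc k)"
proof -
  obtain T0 S r out where s: "st = ((T0, S), r, out)"
    by (rule finder_cases)
  have r: "r \<in> insert None (Some ` (({..<2 * D} \<times> {..<Ep}) \<times> U \<times> {..k}))"
    and rest: "T0 \<in> {..<2 * D} \<times> {..<Ep} \<times> {..<L}" "set S \<subseteq> {..<H}" "length S \<le> c" "set out \<subseteq> U" "length out \<le> M"
    using st unfolding s finder_states_def by auto
  have r': "r \<in> insert None (Some ` (({..<2 * D} \<times> {..<Ep}) \<times> U \<times> {..Suc k}))"
    using r by (auto simp: image_iff)
  show ?thesis
  proof (cases v)
    case (Store T h)
    then show ?thesis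
      using assms(2)[of T h] rest r' unfolding s finder_states_def by (auto simp: Let_def)
  next
    case (Probe T h y)
    then have "epoch T \<in> {..<2 * D} \<times> {..<Ep}" "y \<in> U"
      using assms(3)[of T h y] by (auto simp: epoch_def)
    then show ?thesis
      using Probe rest r' unfolding s finder_states_def by auto
  next
    case (Tally E y)
    show ?thesis
    proof (cases r)
      case None
      then show ?thesis
        using Tally rest r' unfolding s finder_states_def by auto
    next
      case (Some a)
      obtain E' z j where a: "a = (E', z, j)"
        by (metis prod_cases3)
      have "E' \<in> {..<2 * D} \<times> {..<Ep}" "z \<in> U" "j \<le> k"
        using r Some a by auto
      then show ?thesis
        using Tally Some a rest assms(4)[of E y] unfolding s finder_states_def by auto
    qed
  next
    case Skip
    then show ?thesis
      using rest r' unfolding s finder_states_def by auto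
  qed
qed

lemma absorb_states:
  assumes \<omega>: "\<omega> \<in> coins" and y: "y \<in> U" and st: "st \<in> memory_states k" and lb: "lb \<in> set (schedule \<omega>)"
  shows "absorb \<omega> (lb, y) st \<in> memory_states (Suc k)"
proof -
  obtain \<delta> sg ps where w: "\<omega> = (\<delta>, sg, ps)"
    by (metis prod_cases3)
  obtain j where j: "j < n" "lb = lab \<omega> j"
    using lb by (auto simp: schedule_def)
  obtain a f where s: "st = (a, f)" "set a \<subseteq> {- int k..int k}" "length a = m" "f \<in> finder_states k"
    using st unfolding memory_states_def by auto
  have \<delta>: "\<delta> j < 2 * D"
    using \<omega> j unfolding w coins_def by auto
  show ?thesis
  proof (cases "\<delta> j < D")
    case True
    have "a ! i + sg i y \<in> {- int (Suc k)..int (Suc k)}" if "i < m" for i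
    proof -
      have "a ! i \<in> {- int k..int k}"
        using s that nth_mem by blast
      moreover have "sg i \<in> signs U"
        using \<omega> that unfolding w coins_def by auto
      then have "sg i y \<in> {-1, 1}"
        using y by (rule PiE_mem)
      ultimately show ?thesis
        by auto
    qed
    moreover have "finder_states k \<subseteq> finder_states (Suc k)"
      unfolding finder_states_def by (fastforce simp: image_iff)
    ultimately show ?thesis
      using True s j unfolding memory_states_def by (auto simp: w scan.absorb_def)
  next
    case False
    let ?d = "\<delta> j"
    have d: "?d \<in> {D..<2 * D}"
      using False \<delta> by simp
    have "ps ?d \<in> PA \<times> PB"
      using \<omega> PiE_mem[OF _ d, of ps "\<lambda>_. PA \<times> PB"] unfolding w coins_def by blast
    then have p: "fst (ps ?d) \<in> PA" and g: "hashes \<omega> ?d \<in> PB"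
      by (auto simp: mem_Times_iff hashes_def w)
    have A: "snd lb \<in> pass.A Ep L n" "fst lb = ?d"
      using p j False unfolding PA_def by (auto simp: w)
    have B: "hashes \<omega> ?d y \<in> pass.B Ep L H"
      using pass.PB_slot[OF pass_empty g y] by blast
    have "react c M (\<tau> a) (event_of L (\<theta> a) (hashes \<omega> ?d) lb y) f \<in> finder_states (Suc k)"
    proof (rule react_states[OF s(4)])
      fix T h assume *: "event_of L (\<theta> a) (hashes \<omega> ?d) lb y = Store T h"
      obtain d e l where T: "T = (d, e, l)"
        by (metis prod_cases3)
      show "T \<in> {..<2 * D} \<times> {..<Ep} \<times> {..<L} \<and> h < H"
        using * B A d unfolding T event_of_eq_Store B_def by auto
    next
      fix T h z assume *: "event_of L (\<theta> a) (hashes \<omega> ?d) lb y = Probe T h z"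
      obtain d e l where T: "T = (d, e, l)"
        by (metis prod_cases3)
      show "T \<in> {..<2 * D} \<times> {..<Ep} \<times> {..<L} \<and> z \<in> U"
        using * B A d y unfolding T event_of_eq_Probe B_def by auto
    next
      fix E z assume *: "event_of L (\<theta> a) (hashes \<omega> ?d) lb y = Tally E z"
      obtain d e where E: "E = (d, e)"
        by (metis prod.exhaust)
      show "E \<in> {..<2 * D} \<times> {..<Ep} \<and> z \<in> U"
        using * A d y unfolding E event_of_eq_Tally tallies_def A_def by auto
    qed
    moreover have "set a \<subseteq> {- int (Suc k)..int (Suc k)}"
      using s by auto
    ultimately show ?thesis
      using False s A unfolding memory_states_def by (auto simp: scan.absorb_def)
  qed
qed

text \<open>The bound is the number of words of length exactly \<open>l\<close> over an alphabet
  with one additional padding symbol.\<close>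

lemma card_lists_le: "finite X \<Longrightarrow> card {xs. set xs \<subseteq> X \<and> length xs \<le> l} \<le> (card X + 1) ^ l"
proof (induction l)
  case 0
  have "{xs. set xs \<subseteq> X \<and> length xs \<le> 0} = {[]}"
    by auto
  then show ?case
    by simp
next
  case (Suc l)
  have "(\<Sum>i\<le>Suc l. card X ^ i) \<le> (card X + 1) ^ l + card X ^ Suc l"
    using Suc by (simp add: card_lists_length_le)
  also have "card X ^ Suc l \<le> card X * (card X + 1) ^ l"
    by (simp add: power_mono)
  finally show ?case
    using Suc.prems by (simp add: card_lists_length_le algebra_simps)
qed

text \<open>The factors belong to the seed, the clock, the sketch, the slot with its identifiers,
  the register and the output list, in this order.\<close>

definition state_bound :: "nat \<Rightarrow> nat" where
  "state_bound N = N * ((n + 1) * ((2 * n + 1) ^ m * ((2 * D * (Ep * L) * (H + 1) ^ c) *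
     ((1 + 2 * D * Ep * (card U * (n + 1))) * (card U + 1) ^ M))))"

lemma card_states:
  "finite ({..<N} \<times> {..n} \<times> memory_states n)" "card ({..<N} \<times> {..n} \<times> memory_states n) \<le> state_bound N"
proof -
  let ?LA = "{a. set a \<subseteq> {- int n..int n} \<and> length a = m}"
  let ?T = "{..<2 * D} \<times> {..<Ep} \<times> {..<L}"
  let ?LS = "{S. set S \<subseteq> {..<H} \<and> length S \<le> c}"
  let ?R = "insert None (Some ` (({..<2 * D} \<times> {..<Ep}) \<times> U \<times> {..n}))"
  let ?LO = "{out. set out \<subseteq> U \<and> length out \<le> M}"
  have eq: "finder_states n = (?T \<times> ?LS) \<times> ?R \<times> ?LO"
    unfolding finder_states_def by blast
  have fin: "finite ?LA" "finite ?T" "finite ?LS" "finite ?R" "finite ?LO"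
    using U by (auto intro: finite_lists_length_eq finite_lists_length_le)
  then show "finite ({..<N} \<times> {..n} \<times> memory_states n)"
    unfolding memory_states_def eq by simp
  have "card ?LA = (2 * n + 1) ^ m"
    by (subst card_lists_length_eq) (auto simp: nat_add_distrib nat_mult_distrib)
  moreover have "card ?LS \<le> (H + 1) ^ c" "card ?LO \<le> (card U + 1) ^ M"
    using card_lists_le[of "{..<H}" c] card_lists_le[OF U, of M] by auto
  moreover have "card ?R \<le> 1 + 2 * D * Ep * (card U * (n + 1))"
  proof -
    have "card ?R \<le> Suc (card (Some ` (({..<2 * D} \<times> {..<Ep}) \<times> U \<times> {..n})))"
      using U by (intro card_insert_le_m1) auto
    also have "\<dots> = Suc (2 * D * Ep * (card U * (n + 1)))"
      by (subst card_image) (auto simp: card_cartesian_product)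
    finally show ?thesis
      by simp
  qed
  moreover have "card ?T = 2 * D * (Ep * L)"
    by (simp add: card_cartesian_product)
  ultimately show "card ({..<N} \<times> {..n} \<times> memory_states n) \<le> state_bound N"
    unfolding memory_states_def eq state_bound_def card_cartesian_product card_lessThan card_atMost
    by (intro mult_le_mono) auto
qed

text \<open>The condition on \<open>N\<close> lets \<open>N\<close> fixed seeds replace the coins
  while the failure probability grows from 1/20 to 1/10. It can be met because the binary logarithm
  of 21/20 is less than 1/10.\<close>

lemma algorithm_exists:
  assumes N: "0 < N" "real (card U ^ n) * (21 / 20) ^ N < 2 powr (real N / 10)"
    and space: "state_bound N \<le> 2 ^ s"
  shows "\<exists>A :: 'u stream_alg. uses_space U A s \<and> (\<forall>xs. length xs = n \<and> set xs \<subseteq> U \<longrightarrow>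
    9 / 10 \<le> measure_pmf.prob (bind_pmf (random_order xs) (answer A)) {A. accurate (mset xs) A})"
proof -
  let ?X = "{xs. set xs \<subseteq> U \<and> length xs = n}"
  let ?P = "{p. p permutes {..<n}}"
  let ?fail = "\<lambda>\<omega> xs. pr ?P (\<lambda>p. \<not> accurate (mset xs)
      (listed (fold (absorb \<omega>) (zip (schedule \<omega>) (permute_list p xs)) init)))"
  have X: "finite ?X" "card ?X = card U ^ n"
    using U by (auto simp: finite_lists_length_eq card_lists_length_eq)
  have "\<exists>s. (\<forall>i<N. s i \<in> coins) \<and> (\<forall>xs\<in>?X. avg {..<N} (\<lambda>i. ?fail (s i) xs) \<le> 1 / 10)"
    using seed_failure N X fin pr_nonneg pr_le_1
    by (intro exists_few_seeds[where p = "1 / 20"]) auto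
  then obtain sd where sd: "\<And>i. i < N \<Longrightarrow> sd i \<in> coins" "\<And>xs. xs \<in> ?X \<Longrightarrow> avg {..<N} (\<lambda>i. ?fail (sd i) xs) \<le> 1 / 10"
    by blast
  \<comment> \<open>Bounds that follow the clock make \<open>Q\<close> closed under steps; for
    counting, \<open>Q\<close> is embedded into the states with all bounds relaxed to
    \<open>n\<close>.\<close>
  define Q where "Q = {(i, k, st) | i k st. i < N \<and> k \<le> n \<and> st \<in> memory_states k}"
  define I where "I = map_pmf (\<lambda>i. (i, 0 :: nat, init)) (pmf_of_set {..<N})"
  have mono: "memory_states k \<subseteq> memory_states n" if "k \<le> n" for k
    using that unfolding memory_states_def finder_states_def by (fastforce simp: image_iff)
  have QS: "Q \<subseteq> {..<N} \<times> {..n} \<times> memory_states n"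
    using mono unfolding Q_def by auto
  have N0: "{..<N} \<noteq> {}"
    using N by (simp add: lessThan_empty_iff)
  have "init \<in> memory_states 0"
    using pos L_pos by (auto simp: init_def memory_states_def finder_states_def)
  have IQ: "set_pmf I \<subseteq> Q"
  proof -
    have "set_pmf I = (\<lambda>i. (i, 0, init)) ` {..<N}"
      using N0 by (simp add: I_def)
    then show ?thesis
      using \<open>init \<in> memory_states 0\<close> unfolding Q_def by blast
  qed
  have "\<exists>A. uses_space U A s \<and> (\<forall>xs. set xs \<subseteq> U \<longrightarrow>
      answer A xs = map_pmf (\<lambda>q. listed (snd (snd (fold (seeded_step sd) xs q)))) I)"
  proof (rule stream_alg_of_automaton[OF _ _ IQ])
    show "finite Q"
      using QS card_states(1) by (rule finite_subset)
    show "card Q \<le> 2 ^ s"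
      using card_mono[OF card_states(1) QS] card_states(2) space by (rule order_trans[OF order_trans])
    fix y q assume y: "y \<in> U" and q: "q \<in> Q"
    obtain i k st where ikst: "q = (i, k, st)" "i < N" "k \<le> n" "st \<in> memory_states k"
      using q unfolding Q_def by auto
    show "seeded_step sd y q \<in> Q"
    proof (cases "k < n")
      case True
      then have "absorb (sd i) (schedule (sd i) ! k, y) st \<in> memory_states (Suc k)"
        using sd(1) ikst y by (intro absorb_states) auto
      then show ?thesis
        using True ikst by (auto simp: seeded_step_def Q_def)
    next
      case False
      then show ?thesis
        using q ikst by (simp add: seeded_step_def)
    qed
  qed
  then obtain A where A: "uses_space U A s" "\<And>xs. set xs \<subseteq> U \<Longrightarrow>
      answer A xs = map_pmf (\<lambda>q. listed (snd (snd (fold (seeded_step sd) xs q)))) I"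
    by blast
  have "9 / 10 \<le> measure_pmf.prob (bind_pmf (random_order xs) (answer A)) {A. accurate (mset xs) A}"
    if xs: "length xs = n" "set xs \<subseteq> U" for xs
  proof -
    have P: "finite ?P" "?P \<noteq> {}"
      using permutes_id[of "{..<n}"] by (auto simp: finite_permutations simp del: permutes_id)
    let ?out = "\<lambda>p i. listed (fold (absorb (sd i)) (zip (schedule (sd i)) (permute_list p xs)) init)"
    have ans: "answer A (permute_list p xs) = map_pmf (?out p) (pmf_of_set {..<N})" if "p \<in> ?P" for p
    proof -
      have "set (permute_list p xs) \<subseteq> U"
        using that xs by simp
      then show ?thesis
        using xs by (simp add: A(2) I_def map_pmf_comp fold_seeded_step)
    qed
    have "bind_pmf (random_order xs) (answer A) =
        bind_pmf (pmf_of_set ?P) (\<lambda>p. answer A (permute_list p xs))"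
      using xs by (simp add: random_order_def bind_map_pmf)
    also have "\<dots> = bind_pmf (pmf_of_set ?P) (\<lambda>p. map_pmf (?out p) (pmf_of_set {..<N}))"
      using ans set_pmf_of_set[OF P(2,1)] by (intro bind_pmf_cong refl) auto
    finally have "bind_pmf (random_order xs) (answer A) =
        bind_pmf (pmf_of_set ?P) (\<lambda>p. map_pmf (?out p) (pmf_of_set {..<N}))" .
    then have "measure_pmf.prob (bind_pmf (random_order xs) (answer A)) {A. accurate (mset xs) A} =
        1 - avg {..<N} (\<lambda>i. ?fail (sd i) xs)"
      using prob_uniform_pair[OF P finite_lessThan N0, of ?out "{A. accurate (mset xs) A}"] by simp
    then show ?thesis
      using sd(2)[of xs] xs by simp
  qed
  then show ?thesis
    using A(1) by blast
qed

end

section \<open>Choice of parameters\<close>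

text \<open>
  The role of \<open>w\<close> is that of \<open>sqrt (log n)\<close>, rounded up, and \<open>k\<close> is the exponent of the universe.
\<close>

definition wide_enough :: "nat \<Rightarrow> nat \<Rightarrow> bool" where
  "wide_enough k w \<longleftrightarrow> 13 \<le> w \<and>
    552960000 * (real w + 7) ^ 3 * (real (k + 1) * real w ^ 2) \<le> 2 ^ (4 * w) \<and>
    40 * (1152001 * (real w + 7) * 2 ^ w)\<^sup>2 * (real (k + 1) * real w ^ 2) \<le> 2 ^ (6 * w) \<and>
    128000 * (real w + 7)\<^sup>2 \<le> 2 ^ (4 * w)"

lemma eventually_wide_enough: "eventually (wide_enough k) sequentially"
proof -
  define K where "K = real (k + 1)"
  have K: "0 < K"
    by (simp add: K_def)
  have p: "(2 :: real) ^ (j * w) = 2 powr (real j * real w)" for j w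
    by (simp add: powr_realpow[symmetric])
  have "eventually (\<lambda>w::nat. 552960000 * (real w + 7) ^ 3 * (K * real w ^ 2) \<le> 2 powr (4 * real w)) sequentially"
    using K by real_asymp
  moreover have "eventually (\<lambda>w::nat. 40 * (1152001 * (real w + 7) * 2 powr real w)\<^sup>2 * (K * real w ^ 2) \<le> 2 powr (6 * real w)) sequentially"
    using K by real_asymp
  moreover have "eventually (\<lambda>w::nat. 128000 * (real w + 7)\<^sup>2 \<le> 2 powr (4 * real w)) sequentially"
    by real_asymp
  moreover have "eventually (\<lambda>w::nat. 13 \<le> w) sequentially"
    by (rule eventually_ge_at_top)
  ultimately show ?thesis
    by eventually_elim (simp add: wide_enough_def K_def p powr_realpow)
qed

text \<open>All parameters are expressed through \<open>w\<close>, and the inequalities in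
  \<open>wide_enough\<close> are what the conditions of \<open>scheme\<close> become after this
  substitution.\<close>

lemma exists_algorithm:
  fixes U :: "'u set" and \<epsilon> :: real
  assumes U: "finite U" "card U \<le> n ^ k"
    and n: "n \<le> 2 ^ w\<^sup>2" "2 ^ (w - 1)\<^sup>2 \<le> n"
    and \<epsilon>: "0 < \<epsilon>" "\<epsilon> \<le> 1" "1 / \<epsilon> \<le> 2 ^ w"
    and w: "wide_enough k w"
  shows "\<exists>(A :: 'u stream_alg) s. uses_space U A s \<and>
    real s \<le> (65000000 + 300 * real k) * (real w)\<^sup>2 / \<epsilon> \<and>
    (\<forall>xs. length xs = n \<and> set xs \<subseteq> U \<longrightarrow>
      9 / 10 \<le> measure_pmf.prob (bind_pmf (random_order xs) (answer A))
        {H. heavy_hitters U \<epsilon> (mset xs) \<subseteq> H \<and> H \<subseteq> heavy_hitters U (\<epsilon> / 256) (mset xs)})"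
proof -
  \<comment> \<open>The surplus 7 brings \<open>1 / \<epsilon> * (1 / 2) ^ D\<close> down to at most
    1/128.\<close>
  define D where "D = w + 7"
  \<comment> \<open>Chosen so that \<open>2 ^ L\<close> bounds the product of the universe size and
    \<open>n\<close>, hence the number of events in the union bound over light items, passes and
    epochs.\<close>
  define L where "L = (k + 1) * w\<^sup>2"
  \<comment> \<open>The exact solution of \<open>G1\<close> with equality. Rounding it down loses at
    most a factor 2, which is the step from 480 to 960 in \<open>G2\<close>.\<close>
  define X where "X = sqrt (\<epsilon> * real n) / (480 * real D * real L)"
  define Ep where "Ep = nat \<lfloor>X\<rfloor>"
  define c where "c = nat \<lceil>1152000 * real D / \<epsilon>\<rceil>"
  define H :: nat where "H = 2 ^ (6 * w)"
  define M where "M = nat \<lfloor>256 / \<epsilon>\<rfloor> + 1"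
  \<comment> \<open>There are at most \<open>2 ^ (k * w\<^sup>2 * n)\<close> streams, and
    \<open>(21 / 20) ^ N\<close> uses up 3/40 of the exponent \<open>N\<close>, so the remaining
    N/40 - that is N/10 minus 3N/40 - has to exceed \<open>k * w\<^sup>2 * n\<close>.\<close>
  define N where "N = 41 * (k + 1) * w\<^sup>2 * n"
  define s where "s = (6 + k + 2 * w\<^sup>2) + ((w\<^sup>2 + 1) + ((w\<^sup>2 + 2) * 320 + ((w\<^sup>2 + 1 + (6 * w + 1) * c) +
    (((k + 2) * w\<^sup>2 + 3) + (k * w\<^sup>2 + 1) * M))))"
  have DL: "real D = real w + 7" "real L = real (k + 1) * real w ^ 2"
    by (simp add: D_def, simp only: L_def of_nat_mult of_nat_power)
  have w13: "13 \<le> w"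
    and e1: "552960000 * (real D) ^ 3 * real L \<le> 2 ^ (4 * w)"
    and e2: "40 * (1152001 * real D * 2 ^ w)\<^sup>2 * real L \<le> 2 ^ (6 * w)"
    and e3: "128000 * (real D)\<^sup>2 \<le> 2 ^ (4 * w)"
    using w unfolding wide_enough_def DL by blast+
  have D0: "1 \<le> real D"
    by (simp add: D_def)
  have w2: "169 \<le> w\<^sup>2"
    using power_mono[OF w13, of 2] by simp
  then have L169: "169 \<le> L"
    using mult_le_mono[of 1 "k + 1" 169 "w\<^sup>2"] by (simp add: L_def)
  have n0: "1 < n"
  proof -
    have "(2 :: nat) ^ 1 \<le> 2 ^ (w - 1)\<^sup>2"
      using w13 by (intro power_increasing) auto
    then show ?thesis
      using n by simp
  qed
  have root: "2 ^ (5 * w) \<le> sqrt (\<epsilon> * real n)"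
  proof (rule real_le_rsqrt)
    \<comment> \<open>The bound 13 in \<open>wide_enough\<close> is the least for which this holds:
      144 against 143. The extra \<open>w\<close> pays for 1/\<epsilon>.\<close>
    have "10 * w + w \<le> (w - 1)\<^sup>2"
    proof -
      obtain u where u: "w = u + 13"
        using w13 le_Suc_ex[of 13 w] by (auto simp: add.commute)
      show ?thesis
        unfolding u by (simp add: power2_eq_square algebra_simps)
    qed
    then have "(2 :: nat) ^ (10 * w + w) \<le> 2 ^ (w - 1)\<^sup>2"
      by (intro power_increasing) auto
    also have "\<dots> \<le> n"
      by (rule n)
    finally have "(2 :: real) ^ (10 * w + w) \<le> real n"
      by (metis of_nat_le_iff of_nat_numeral of_nat_power)
    then have 1: "(2 :: real) ^ (10 * w) * 2 ^ w \<le> real n"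
      by (simp only: power_add)
    have "(2 :: real) ^ (10 * w) = 2 ^ (10 * w) * 1"
      by simp
    also have "\<dots> \<le> 2 ^ (10 * w) * (\<epsilon> * 2 ^ w)"
      using \<epsilon> by (intro mult_left_mono) (auto simp: field_simps)
    also have "\<dots> = \<epsilon> * (2 ^ (10 * w) * 2 ^ w)"
      by simp
    also have "\<dots> \<le> \<epsilon> * real n"
      using 1 \<epsilon> by (intro mult_left_mono) auto
    finally show "(2 ^ (5 * w))\<^sup>2 \<le> \<epsilon> * real n"
      by (simp flip: power_mult)
  qed
  have root_n: "sqrt (\<epsilon> * real n) \<le> real n"
  proof (rule real_le_lsqrt)
    have "\<epsilon> * real n \<le> 1 * real n"
      using \<epsilon> by (intro mult_right_mono) auto
    also have "\<dots> \<le> real n * real n"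
      using n0 by (intro mult_right_mono) auto
    finally show "\<epsilon> * real n \<le> (real n)\<^sup>2"
      by (simp add: power2_eq_square)
  qed (use \<epsilon> in auto)
  have p5: "(2 :: real) ^ (5 * w) = 2 ^ (4 * w) * 2 ^ w"
    by (simp flip: power_add)
  \<comment> \<open>The constant 552960000 is 2 * 576000 * 480; the 2 pays for rounding
    \<open>X\<close> down to \<open>Ep\<close>.\<close>
  have X_big: "576000 * (real D)\<^sup>2 / \<epsilon> * 2 \<le> X"
  proof -
    have "576000 * (real D)\<^sup>2 / \<epsilon> * 2 * (480 * real D * real L) = 552960000 * (real D) ^ 3 * real L * (1 / \<epsilon>)"
      by (simp add: power2_eq_square power3_eq_cube)
    also have "\<dots> \<le> 2 ^ (4 * w) * 2 ^ w"
      using e1 \<epsilon> by (intro mult_mono) auto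
    also have "\<dots> \<le> sqrt (\<epsilon> * real n)"
      using root by (simp only: p5)
    finally show ?thesis
      using D0 L169 by (simp add: X_def field_simps)
  qed
  have "1 \<le> 576000 * (real D)\<^sup>2 / \<epsilon>"
  proof -
    have "1 \<le> (real D)\<^sup>2"
      using D0 by (simp add: one_le_power)
    then show ?thesis
      using \<epsilon> by (simp add: field_simps)
  qed
  then have X1: "2 \<le> X"
    using X_big by linarith
  have Ep_X: "real Ep \<le> X" "X / 2 \<le> real Ep"
  proof -
    have "real Ep = real_of_int \<lfloor>X\<rfloor>"
      using X1 by (simp add: Ep_def)
    moreover have "real_of_int \<lfloor>X\<rfloor> \<le> X" "X - 1 \<le> real_of_int \<lfloor>X\<rfloor>"
      by linarith+
    ultimately show "real Ep \<le> X" "X / 2 \<le> real Ep"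
      using X1 by linarith+
  qed
  have X_eq: "480 * real D * real L * X = sqrt (\<epsilon> * real n)"
    using D0 L169 by (simp add: X_def)
  have G1: "480 * real D * (real Ep * real L) \<le> sqrt (\<epsilon> * real n)"
  proof -
    have "480 * real D * real L * real Ep \<le> 480 * real D * real L * X"
      using Ep_X by (intro mult_left_mono) auto
    then show ?thesis
      unfolding X_eq by (simp add: mult_ac)
  qed
  have G2: "sqrt (\<epsilon> * real n) \<le> 960 * real D * (real Ep * real L)"
  proof -
    have "960 * real D * real L * (X / 2) \<le> 960 * real D * real L * real Ep"
      using Ep_X by (intro mult_left_mono) auto
    then show ?thesis
      unfolding X_eq[symmetric] by (simp add: mult_ac)
  qed
  have DEL: "real D * (real Ep * real L) \<le> real n / 480"
    using order_trans[OF G1 root_n] by simp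
  have DEL_nat: "D * (Ep * L) \<le> n"
  proof -
    have "real (D * (Ep * L)) \<le> real n"
      using DEL unfolding of_nat_mult by linarith
    then show ?thesis
      by (simp only: of_nat_le_iff)
  qed
  have DE_nat: "D * Ep \<le> n"
  proof -
    have "D * Ep \<le> D * Ep * L"
      using L169 by simp
    also have "\<dots> \<le> n"
      using DEL_nat by (simp only: mult.assoc)
    finally show ?thesis .
  qed
  have c_bounds: "1152000 * real D / \<epsilon> \<le> real c" "real c \<le> 1152001 * real D / \<epsilon>"
  proof -
    have "0 \<le> 1152000 * real D / \<epsilon>"
      using \<epsilon> by simp
    then have "real c = real_of_int \<lceil>1152000 * real D / \<epsilon>\<rceil>"
      by (simp add: c_def)
    then have "1152000 * real D / \<epsilon> \<le> real c" "real c \<le> 1152000 * real D / \<epsilon> + 1"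
      by linarith+
    moreover have "1 \<le> real D / \<epsilon>"
      using D0 \<epsilon> by simp
    moreover have "1152001 * real D / \<epsilon> = 1152000 * real D / \<epsilon> + real D / \<epsilon>"
      by (simp add: field_simps)
    ultimately show "1152000 * real D / \<epsilon> \<le> real c" "real c \<le> 1152001 * real D / \<epsilon>"
      by linarith+
  qed
  have M_bounds: "256 / \<epsilon> < real M" "real M \<le> 257 / \<epsilon>"
  proof -
    have "0 \<le> 256 / \<epsilon>"
      using \<epsilon> by simp
    then have "real M = real_of_int \<lfloor>256 / \<epsilon>\<rfloor> + 1"
      by (simp add: M_def)
    moreover have "1 \<le> 1 / \<epsilon>" "257 / \<epsilon> = 256 / \<epsilon> + 1 / \<epsilon>"
      using \<epsilon> by (simp_all add: field_simps)
    ultimately show "256 / \<epsilon> < real M" "real M \<le> 257 / \<epsilon>"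
      by linarith+
  qed
  have U_real: "real (card U) \<le> 2 ^ (k * w\<^sup>2)" and U_nat: "card U \<le> 2 ^ (k * w\<^sup>2)"
  proof -
    have "card U \<le> (2 ^ w\<^sup>2) ^ k"
      using U(2) power_mono[OF n(1), of k] by simp
    then show *: "card U \<le> 2 ^ (k * w\<^sup>2)"
      by (simp add: mult.commute flip: power_mult)
    show "real (card U) \<le> 2 ^ (k * w\<^sup>2)"
      using * by (metis of_nat_le_iff of_nat_numeral of_nat_power)
  qed
  have n_real: "real n \<le> 2 ^ w\<^sup>2"
    using n(1) by (metis of_nat_le_iff of_nat_numeral of_nat_power)
  interpret scheme U n D L Ep H c M 320 \<epsilon>
  proof
    show "finite U"
      by (rule U)
    show "1 < n" "0 < \<epsilon>" "\<epsilon> \<le> 1"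
      using n0 \<epsilon> by auto
    show "0 < D" "0 < H" "54 \<le> L"
      using L169 by (auto simp: D_def H_def)
    show "0 < Ep"
      using Ep_X X1 by (intro gr0I) auto
    show "480 * real D * (real Ep * real L) \<le> sqrt (\<epsilon> * real n)"
      "sqrt (\<epsilon> * real n) \<le> 960 * real D * (real Ep * real L)"
      by (fact G1 G2)+
    show "1152000 * real D / \<epsilon> \<le> real c"
      by (rule c_bounds)
    show "576000 * (real D)\<^sup>2 / \<epsilon> \<le> real Ep"
      using X_big Ep_X by linarith
    show "40 * (real c)\<^sup>2 * real L \<le> real H"
    proof -
      have "real c \<le> 1152001 * real D * 2 ^ w"
        using c_bounds(2) mult_left_mono[OF \<epsilon>(3), of "1152001 * real D"] by simp
      then have "40 * (real c)\<^sup>2 * real L \<le> 40 * (1152001 * real D * 2 ^ w)\<^sup>2 * real L"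
        by (intro mult_right_mono mult_left_mono power_mono) auto
      then show ?thesis
        using e2 by (simp add: H_def)
    qed
    show "256 / \<epsilon> < real M"
      by (rule M_bounds)
    have p5_big: "2 ^ (4 * w) \<le> sqrt (\<epsilon> * real n)"
      using root power_increasing[of "4 * w" "5 * w" "2 :: real"] by linarith
    have "128000 * (real D)\<^sup>2 \<le> sqrt (\<epsilon> * real n)"
      using e3 p5_big by linarith
    moreover have "1 \<le> (real D)\<^sup>2"
      using D0 by (simp add: one_le_power)
    ultimately have root_big: "128000 * (real D)\<^sup>2 \<le> sqrt (\<epsilon> * real n)" "128000 \<le> sqrt (\<epsilon> * real n)"
      by linarith+
    have "sqrt (\<epsilon> * real n) \<le> sqrt (real n)"
      using \<epsilon> by (intro real_sqrt_le_mono mult_left_le_one_le) auto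
    then have "32000 \<le> sqrt (real n)"
      using root_big by linarith
    then show "32 / sqrt (real n) \<le> 1 / 1000"
      using n0 by (simp add: divide_le_eq)
    have "2000 * (real D)\<^sup>2 \<le> real n"
      using root_big root_n by linarith
    then show "real D * (2 * real D / real n) \<le> 1 / 1000"
      using n0 by (simp add: divide_le_eq power2_eq_square)
    show "1 / \<epsilon> * (real D * (128 * real D / sqrt (\<epsilon> * real n))) \<le> 1 / 1000"
    proof -
      have pos: "0 < sqrt (\<epsilon> * real n)"
        using root_big by linarith
      have "1 / \<epsilon> * (128000 * (real D)\<^sup>2) \<le> 2 ^ w * 2 ^ (4 * w)"
        using e3 \<epsilon> by (intro mult_mono) auto
      also have "\<dots> \<le> sqrt (\<epsilon> * real n)"
        using root p5 by (simp add: mult.commute)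
      finally have le: "1 / \<epsilon> * (128000 * (real D)\<^sup>2) / sqrt (\<epsilon> * real n) \<le> 1"
        unfolding divide_le_eq_1_pos[OF pos] .
      have eq: "1 / \<epsilon> * (real D * (128 * real D / sqrt (\<epsilon> * real n))) =
          1 / \<epsilon> * (128000 * (real D)\<^sup>2) / sqrt (\<epsilon> * real n) / 1000"
        by (simp add: power2_eq_square)
      show ?thesis
        unfolding eq by (rule divide_right_mono[OF le]) simp
    qed
    show "real (card U) * (real D * (real Ep * 2 powr (- 3 * real L))) \<le> 1 / 1000"
    proof -
      have "real D * real Ep \<le> 2 ^ w\<^sup>2"
      proof -
        have "real (D * Ep) \<le> real n"
          using DE_nat by (simp only: of_nat_le_iff)
        then show ?thesis
          using n_real unfolding of_nat_mult by (rule order_trans)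
      qed
      then have "real (card U) * (real D * real Ep) \<le> 2 ^ (k * w\<^sup>2) * 2 ^ w\<^sup>2"
        using U_real by (intro mult_mono) auto
      also have "\<dots> = 2 ^ L"
        by (simp add: L_def add.commute flip: power_add)
      also have "\<dots> = 2 powr real L"
        by (simp add: powr_realpow)
      finally have "real (card U) * (real D * real Ep) * 2 powr (- 3 * real L) \<le> 2 powr real L * 2 powr (- 3 * real L)"
        by (intro mult_right_mono) auto
      also have "\<dots> = 2 powr (- 2 * real L)"
        by (simp flip: powr_add)
      also have "\<dots> \<le> 2 powr (- 10)"
        using L169 by (intro powr_mono) auto
      also have "\<dots> \<le> 1 / 1000"
        by (simp add: powr_minus_divide)
      finally show ?thesis
        by (simp add: mult_ac)
    qed
    show "1 / \<epsilon> * (1 / 2) ^ D \<le> 1 / 100"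
    proof -
      have "1 / \<epsilon> * (1 / 2) ^ D \<le> 2 ^ w * (1 / 2) ^ D"
        using \<epsilon> by (intro mult_right_mono) auto
      also have "\<dots> = 1 / 128"
        by (simp add: D_def power_add power_divide)
      finally show ?thesis
        by simp
    qed
  qed simp
  have N0: "0 < N"
    using w13 n0 by (simp add: N_def)
  have "real (card U ^ n) * (21 / 20) ^ N < 2 powr (real N / 10)"
  proof -
    \<comment> \<open>The 40th power of 21/20 is slightly above 7, hence below the third power of
      2.\<close>
    have "((21 / 20) ^ N :: real) ^ 40 = ((21 / 20) ^ 40) ^ N"
      by (metis power_mult mult.commute)
    also have "\<dots> \<le> 8 ^ N"
      by (intro power_mono) (simp_all add: power_divide)
    also have "8 ^ N = 2 powr (real (3 * N))"
      by (subst powr_realpow) (simp_all add: power_mult)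
    also have "\<dots> = (2 powr (3 * real N / 40)) ^ 40"
      by (simp add: powr_power)
    finally have a: "((21 / 20) ^ N :: real) \<le> 2 powr (3 * real N / 40)"
      by (subst (asm) power_mono_iff) auto
    have "real (card U ^ n) \<le> (2 ^ (k * w\<^sup>2)) ^ n"
      using U_real by (simp add: power_mono)
    also have "\<dots> = 2 powr (real (k * w\<^sup>2 * n))"
      by (simp only: powr_realpow[of 2 "k * w\<^sup>2 * n"] power_mult zero_less_numeral)
    finally have "real (card U ^ n) * (21 / 20) ^ N \<le> 2 powr (real (k * w\<^sup>2 * n)) * 2 powr (3 * real N / 40)"
      using a by (intro mult_mono) auto
    also have "\<dots> = 2 powr (real (k * w\<^sup>2 * n) + 3 * real N / 40)"
      by (simp add: powr_add)
    also have "\<dots> < 2 powr (real N / 10)"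
    proof (rule powr_less_mono)
      have "40 * (k * w\<^sup>2 * n) < N"
      proof -
        have "0 < w\<^sup>2 * n"
          using w13 n0 by simp
        then show ?thesis
          by (simp add: N_def algebra_simps)
      qed
      then have "real (40 * (k * w\<^sup>2 * n)) < real N"
        by (simp only: of_nat_less_iff)
      then have "40 * real (k * w\<^sup>2 * n) < real N"
        unfolding of_nat_mult[of 40] by simp
      then show "real (k * w\<^sup>2 * n) + 3 * real N / 40 < real N / 10"
        by linarith
    qed simp
    finally show ?thesis .
  qed
  moreover have "state_bound N \<le> 2 ^ s"
  proof -
    have k1: "k + 1 \<le> 2 ^ k"
      using less_exp[of k] by (simp only: Suc_eq_plus1[symmetric] Suc_le_eq)
    have q1: "w\<^sup>2 \<le> 2 ^ w\<^sup>2"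
      using less_exp[of "w\<^sup>2"] by (rule less_imp_le)
    have N: "N \<le> 2 ^ (6 + k + 2 * w\<^sup>2)"
    proof -
      have "N \<le> 2 ^ 6 * 2 ^ k * 2 ^ w\<^sup>2 * 2 ^ w\<^sup>2"
        unfolding N_def by (intro mult_le_mono k1 q1 n(1)) simp
      also have "\<dots> = 2 ^ (6 + k + (w\<^sup>2 + w\<^sup>2))"
        by (simp only: power_add mult.assoc)
      also have "6 + k + (w\<^sup>2 + w\<^sup>2) = 6 + k + 2 * w\<^sup>2"
        by simp
      finally show ?thesis .
    qed
    have n1: "n + 1 \<le> 2 ^ (w\<^sup>2 + 1)"
      using n(1) n0 by simp
    have m: "(2 * n + 1) ^ 320 \<le> 2 ^ ((w\<^sup>2 + 2) * 320)"
      unfolding power_mult using n(1) n0 by (intro power_mono) auto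
    have S: "2 * D * (Ep * L) * (H + 1) ^ c \<le> 2 ^ (w\<^sup>2 + 1) * 2 ^ ((6 * w + 1) * c)"
      unfolding power_mult
    proof (intro mult_le_mono[of "2 * D * (Ep * L)"] power_mono)
      show "2 * D * (Ep * L) \<le> 2 ^ (w\<^sup>2 + 1)"
        using DEL_nat n(1) by (simp add: mult.assoc)
      show "H + 1 \<le> 2 ^ (6 * w + 1)"
        by (simp add: H_def)
    qed simp
    have R: "1 + 2 * D * Ep * (card U * (n + 1)) \<le> 2 ^ ((k + 2) * w\<^sup>2 + 3)"
    proof -
      have "2 * D * Ep \<le> 2 ^ (1 + w\<^sup>2)"
        using DE_nat n(1) by (simp add: mult.assoc)
      moreover have "card U * (n + 1) \<le> 2 ^ (k * w\<^sup>2) * 2 ^ (w\<^sup>2 + 1)"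
        by (intro mult_le_mono U_nat n1)
      ultimately have "2 * D * Ep * (card U * (n + 1)) \<le> 2 ^ (1 + w\<^sup>2) * (2 ^ (k * w\<^sup>2) * 2 ^ (w\<^sup>2 + 1))"
        by (rule mult_le_mono)
      also have "\<dots> = 2 ^ (1 + w\<^sup>2 + (k * w\<^sup>2 + (w\<^sup>2 + 1)))"
        by (simp only: power_add)
      also have "1 + w\<^sup>2 + (k * w\<^sup>2 + (w\<^sup>2 + 1)) = (k + 2) * w\<^sup>2 + 2"
        by (simp add: algebra_simps)
      finally have "2 * D * Ep * (card U * (n + 1)) \<le> 2 ^ ((k + 2) * w\<^sup>2 + 2)" .
      moreover have "1 + x \<le> 2 ^ (t + 3)" if "x \<le> 2 ^ (t + 2)" for x t :: nat
      proof -
        have "1 + x \<le> 2 ^ (t + 2) + 2 ^ (t + 2)"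
          using that by (intro add_mono) auto
        then show ?thesis
          by (simp add: power_add)
      qed
      ultimately show ?thesis
        by blast
    qed
    have O: "(card U + 1) ^ M \<le> 2 ^ ((k * w\<^sup>2 + 1) * M)"
    proof -
      have "card U + 1 \<le> 2 ^ (k * w\<^sup>2) + 2 ^ (k * w\<^sup>2)"
        using U_nat by (intro add_mono) auto
      also have "\<dots> = 2 ^ (k * w\<^sup>2 + 1)"
        by simp
      finally show ?thesis
        unfolding power_mult[of 2 "k * w\<^sup>2 + 1"] by (intro power_mono) auto
    qed
    have "state_bound N \<le> 2 ^ (6 + k + 2 * w\<^sup>2) * (2 ^ (w\<^sup>2 + 1) * (2 ^ ((w\<^sup>2 + 2) * 320) *
        (2 ^ (w\<^sup>2 + 1) * 2 ^ ((6 * w + 1) * c) * (2 ^ ((k + 2) * w\<^sup>2 + 3) * 2 ^ ((k * w\<^sup>2 + 1) * M)))))"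
      unfolding state_bound_def
      by (rule mult_le_mono[OF N mult_le_mono[OF n1 mult_le_mono[OF m mult_le_mono[OF S mult_le_mono[OF R O]]]]])
    also have "\<dots> = 2 ^ s"
      unfolding s_def by (simp only: power_add)
    finally show ?thesis .
  qed
  ultimately obtain A :: "'u stream_alg" where A: "uses_space U A s"
    "\<And>xs. length xs = n \<and> set xs \<subseteq> U \<Longrightarrow>
      9 / 10 \<le> measure_pmf.prob (bind_pmf (random_order xs) (answer A)) {A. accurate (mset xs) A}"
    using algorithm_exists[OF N0] by blast
  \<comment> \<open>The leading term is \<open>(6 * w + 1) * c\<close>: at most \<open>c\<close>
    identifiers of about \<open>6 * w\<close> bits each, where \<open>c\<close> is of order
    \<open>w / \<epsilon>\<close>. Since \<open>(real w)\<^sup>2 \<le> q\<close>, every remaining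
    term is absorbed into multiples of \<open>q\<close> and \<open>k * q\<close>.\<close>
  have "real s \<le> (65000000 + 300 * real k) * (real w)\<^sup>2 / \<epsilon>"
  proof -
    define q where "q = (real w)\<^sup>2 / \<epsilon>"
    have w1: "1 \<le> (real w)\<^sup>2"
      using w13 by (intro one_le_power) auto
    have "(real w)\<^sup>2 * \<epsilon> \<le> (real w)\<^sup>2 * 1"
      using \<epsilon> by (intro mult_left_mono) auto
    then have wq: "(real w)\<^sup>2 \<le> q"
      unfolding q_def using \<epsilon>(1) by (simp add: pos_le_divide_eq)
    have "real ((6 * w + 1) * c) \<le> 7 * real w * (1152001 * (8 * real w) / \<epsilon>)"
      unfolding of_nat_mult[of "6 * w + 1"]
    proof (rule mult_mono)
      have "1152001 * real D / \<epsilon> \<le> 1152001 * (8 * real w) / \<epsilon>"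
        using w13 \<epsilon> by (intro divide_right_mono mult_left_mono) (auto simp: D_def)
      then show "real c \<le> 1152001 * (8 * real w) / \<epsilon>"
        using c_bounds(2) by linarith
    qed (use w13 in auto)
    also have "\<dots> = 64512056 * q"
      by (simp add: q_def power2_eq_square)
    finally have 1: "real ((6 * w + 1) * c) \<le> 64512056 * q" .
    have "real ((k * w\<^sup>2 + 1) * M) \<le> ((real k + 1) * (real w)\<^sup>2) * (257 / \<epsilon>)"
      unfolding of_nat_mult[of "k * w\<^sup>2 + 1"] using M_bounds w1 by (intro mult_mono) (auto simp: algebra_simps)
    also have "\<dots> = 257 * (real k * q) + 257 * q"
      by (simp add: q_def algebra_simps add_divide_distrib)
    finally have 2: "real ((k * w\<^sup>2 + 1) * M) \<le> 257 * (real k * q) + 257 * q" .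
    have k: "real k * 1 \<le> real k * q" "real k * (real w)\<^sup>2 \<le> real k * q"
      using w1 wq by (auto intro!: mult_left_mono simp del: mult_1_right)
    have "real s = (real k * 1 + real k * (real w)\<^sup>2) + 651 + 326 * (real w)\<^sup>2 +
        real ((6 * w + 1) * c) + real ((k * w\<^sup>2 + 1) * M)"
      by (simp add: s_def algebra_simps)
    moreover have "0 \<le> real k * q"
      using w1 wq by simp
    ultimately have "real s \<le> 65000000 * q + 300 * (real k * q)"
      using 1 2 k w1 wq by linarith
    then show ?thesis
      by (simp add: q_def algebra_simps add_divide_distrib)
  qed
  then show ?thesis
    using A unfolding accurate_def by blast
qed

theorem theorem1p3:
  fixes U :: "nat \<Rightarrow> 'u set"
  assumes finite_universe: "\<And>n. finite (U n)"
    and poly_universe: "\<exists>k. (\<lambda>n. real (card (U n))) \<in> O(\<lambda>n. real n ^ k)"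
  shows "\<exists>(n0::nat) (c0::nat) (C::real).
    \<forall>n\<ge>n0. \<forall>\<epsilon>::real.
      0 < \<epsilon> \<longrightarrow> \<epsilon> \<le> 1 \<longrightarrow> \<epsilon> \<ge> real c0 * (1 / 2 powr sqrt (log 2 (real n))) \<longrightarrow>
      (\<exists>(A::'u stream_alg) (s::nat).
         uses_space (U n) A s \<and>
         real s \<le> C * (log 2 (real n) / \<epsilon>) \<and>
         (\<forall>xs. length xs = n \<and> set xs \<subseteq> U n \<longrightarrow>
            measure_pmf.prob (bind_pmf (random_order xs) (answer A))
              {H. heavy_hitters (U n) \<epsilon> (mset xs) \<subseteq> H \<and>
                  H \<subseteq> heavy_hitters (U n) (\<epsilon> / 256) (mset xs)} \<ge> 9 / 10))"
proof -
  obtain k0 where "(\<lambda>n. real (card (U n))) \<in> O(\<lambda>n. real n ^ k0)"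
    using poly_universe by blast
  then obtain B where B: "0 < B" "eventually (\<lambda>n. real (card (U n)) \<le> B * real n ^ k0) sequentially"
    by (auto elim!: landau_o.bigE)
  \<comment> \<open>One more power of \<open>n\<close> absorbs the constant
    \<open>B\<close>.\<close>
  define k where "k = k0 + 1"
  define w where "w n = nat \<lceil>sqrt (log 2 (real n))\<rceil>" for n :: nat
  have card: "eventually (\<lambda>n. card (U n) \<le> n ^ k) sequentially"
    using B(2) eventually_ge_at_top[of "nat \<lceil>B\<rceil>"]
  proof eventually_elim
    case (elim n)
    have "B \<le> real n"
      using elim(2) by linarith
    then have "B * real n ^ k0 \<le> real n * real n ^ k0"
      by (intro mult_right_mono) auto
    then have "real (card (U n)) \<le> real (n ^ k)"
      using elim(1) by (simp add: k_def)
    then show ?case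
      by (simp only: of_nat_le_iff)
  qed
  have lim: "filterlim (\<lambda>n::nat. sqrt (log 2 (real n))) at_top sequentially"
    by real_asymp
  have "filterlim w at_top sequentially"
    unfolding filterlim_at_top
  proof
    fix Z :: nat
    have "eventually (\<lambda>n. real Z \<le> sqrt (log 2 (real n))) sequentially"
      using lim unfolding filterlim_at_top by blast
    then show "eventually (\<lambda>n. Z \<le> w n) sequentially"
      by eventually_elim (simp add: w_def le_nat_iff, linarith)
  qed
  then have wide: "eventually (\<lambda>n. wide_enough k (w n)) sequentially"
    using eventually_wide_enough by (rule eventually_compose_filterlim[rotated])
  obtain n0 where n0: "\<And>n. n0 \<le> n \<Longrightarrow> card (U n) \<le> n ^ k \<and> wide_enough k (w n)"
    using eventually_conj[OF card wide] unfolding eventually_sequentially by blast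
  \<comment> \<open>Rounding sqrt (log n) up to \<open>w n\<close> at most doubles it, hence the
    factor 4.\<close>
  define C where "C = 4 * (65000000 + 300 * real k)"
  show ?thesis
  \<comment> \<open>\<open>c0 = 1\<close> suffices, since \<open>w n\<close> is rounded up and so
    1/\<epsilon> is at most \<open>2 ^ w n\<close>. The 2 in the maximum ensures that log n is at
    least 1.\<close>
  proof (rule exI[of _ "max n0 2"], rule exI[of _ 1], rule exI[of _ C], intro allI impI, goal_cases)
    case (1 n \<epsilon>)
    note n = 1(1) and \<epsilon> = 1(2-4)
    define l where "l = log 2 (real n)"
    have l: "1 \<le> l"
      using n by (simp add: l_def)
    have n_l: "real n = 2 powr l"
      using n by (simp add: l_def)
    have sl: "1 \<le> sqrt l" "sqrt l * sqrt l = l"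
      using l by auto
    have wn: "sqrt l \<le> real (w n)" "real (w n) < sqrt l + 1" "13 \<le> w n"
    proof -
      have "real (w n) = real_of_int \<lceil>sqrt l\<rceil>"
        using sl(1) by (simp add: w_def l_def)
      then show "sqrt l \<le> real (w n)" "real (w n) < sqrt l + 1"
        by linarith+
      show "13 \<le> w n"
        using n0[of n] n by (auto simp: wide_enough_def)
    qed
    have up: "l \<le> (real (w n))\<^sup>2"
      using mult_mono[OF wn(1) wn(1)] sl by (simp add: power2_eq_square)
    have down: "(real (w n) - 1)\<^sup>2 \<le> l"
      using power_mono[of "real (w n) - 1" "sqrt l" 2] wn sl by (simp add: power2_eq_square)
    have four: "(real (w n))\<^sup>2 \<le> 4 * l"
    proof -
      have "(real (w n))\<^sup>2 \<le> (2 * sqrt l)\<^sup>2"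
        using wn sl by (intro power_mono) auto
      then show ?thesis
        using sl by (simp add: power2_eq_square)
    qed
    have p2: "2 powr real j = real (2 ^ j)" for j
      by (simp add: powr_realpow)
    have "real n \<le> real (2 ^ (w n)\<^sup>2)"
    proof -
      have "2 powr l \<le> 2 powr real ((w n)\<^sup>2)"
        using up by (intro powr_mono) auto
      then show ?thesis
        unfolding p2 n_l .
    qed
    then have n1: "n \<le> 2 ^ (w n)\<^sup>2"
      by (simp only: of_nat_le_iff)
    have "real (2 ^ (w n - 1)\<^sup>2) \<le> real n"
    proof -
      have "2 powr real ((w n - 1)\<^sup>2) \<le> 2 powr l"
        using down wn(3) by (intro powr_mono) (auto simp: of_nat_diff)
      then show ?thesis
        unfolding p2 n_l .
    qed
    then have n2: "2 ^ (w n - 1)\<^sup>2 \<le> n"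
      by (simp only: of_nat_le_iff)
    have "1 / \<epsilon> \<le> 2 powr sqrt l"
      using \<epsilon> by (simp add: l_def field_simps)
    also have "\<dots> \<le> 2 powr real (w n)"
      using wn by (intro powr_mono) auto
    finally have e: "1 / \<epsilon> \<le> 2 ^ w n"
      by (simp add: powr_realpow)
    have cu: "card (U n) \<le> n ^ k" "wide_enough k (w n)"
      using n0[of n] n by auto
    obtain A :: "'u stream_alg" and s where A: "uses_space (U n) A s"
      "real s \<le> (65000000 + 300 * real k) * (real (w n))\<^sup>2 / \<epsilon>"
      "\<forall>xs. length xs = n \<and> set xs \<subseteq> U n \<longrightarrow>
      9 / 10 \<le> measure_pmf.prob (bind_pmf (random_order xs) (answer A))
        {H. heavy_hitters (U n) \<epsilon> (mset xs) \<subseteq> H \<and> H \<subseteq> heavy_hitters (U n) (\<epsilon> / 256) (mset xs)}"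
      using exists_algorithm[OF finite_universe cu(1) n1 n2 \<epsilon>(1,2) e cu(2)] by blast
    have "(65000000 + 300 * real k) * (real (w n))\<^sup>2 / \<epsilon> \<le> (65000000 + 300 * real k) * (4 * l) / \<epsilon>"
      using four \<epsilon> by (intro divide_right_mono mult_left_mono) auto
    also have "\<dots> = C * (log 2 (real n) / \<epsilon>)"
      by (simp add: C_def l_def algebra_simps add_divide_distrib)
    finally have "real s \<le> C * (log 2 (real n) / \<epsilon>)"
      using A(2) by linarith
    then show ?case
      using A by blast
  qed
qed

end
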